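(* Let $q\equiv 7\pmod 8$ be an odd prime different from $7$. Assume that the class number of $\mathbb{Q}(\zeta_q)$ is prime. If $(q-1)/2$ is relatively prime to the class number of $\mathbb{Q}(\sqrt{-q})$, then $\mathbf{R}_{\mathbb{Q}(\zeta_q)/\mathbb{Q}}$ is non-trivial, i.e. $\mathbf{R}_{\mathbb{Q}(\zeta_q)/\mathbb{Q}}\neq\{1\}$. In fact, $\mathbf{R}_{\mathbb{Q}(\zeta_q)/\mathbb{Q}}$ contains a divisor of $(q-1)/2$ other than $1$.
   Context: Here $\zeta_q$ is a primitive $q$-th root of unity. For a Galois extension of number fields $L/K$, the residue degree of a prime ideal $\wp$ of $L$ above a prime $\mathfrak{p}$ of $K$ is $[\mathcal{O}_L/\wp:\mathcal{O}_K/\mathfrak{p}]$, and $$\mathbf{R}_{L/K}=\{f\in\mathbb{N}: \text{the class group of } L \text{ is generated by the classes of prime ideals of } L \text{ that are unramified over } K \text{ and have residue degree } f \text{ for } L/K\}.$$ One always has $1\in\mathbf{R}_{L/K}$; the set $\mathbf{R}_{L/K}$ is called trivial if it equals $\{1\}$ and non-trivial otherwise. *)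

theory Defs
  imports Complex_Main "HOL-Algebra.Algebra" "HOL-Algebra.Algebraic_Closure_Type"
begin

text \<open>Number fields are subfields of the complex numbers, represented by their carriers.\<close>

abbreviation complex_ring :: "complex ring" where
  "complex_ring \<equiv> ring_of_type_algebra"

text \<open>The field generated by a complex number contains 1, hence the rationals.\<close>

definition rat_adjoin :: "complex \<Rightarrow> complex set" where
  "rat_adjoin a = generate_field complex_ring {a}"

definition primitive_root_of_unity :: "nat \<Rightarrow> complex \<Rightarrow> bool" where
  "primitive_root_of_unity n z \<longleftrightarrow> n > 0 \<and> z ^ n = 1 \<and> (\<forall>k. 0 < k \<and> k < n \<longrightarrow> z ^ k \<noteq> 1)"

definition ring_of_integers :: "complex set \<Rightarrow> complex ring" where
  "ring_of_integers L = complex_ring\<lparr>carrier := {x \<in> L. algebraic_int x}\<rparr>"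

definition fractional_ideals :: "complex set \<Rightarrow> complex set set" where
  "fractional_ideals L =
     {I. I \<noteq> {0} \<and>
         (\<exists>d \<in> carrier (ring_of_integers L) - {0}. ideal ((\<lambda>x. d * x) ` I) (ring_of_integers L))}"

definition fractional_ideal_group :: "complex set \<Rightarrow> complex set monoid" where
  "fractional_ideal_group L =
     \<lparr>carrier = fractional_ideals L,
      monoid.mult = ideal_prod complex_ring,
      one = carrier (ring_of_integers L)\<rparr>"

definition principal_fractional_ideals :: "complex set \<Rightarrow> complex set set" where
  "principal_fractional_ideals L = {(\<lambda>x. a * x) ` carrier (ring_of_integers L) | a. a \<in> L - {0}}"

definition class_group :: "complex set \<Rightarrow> complex set set monoid" where
  "class_group L = fractional_ideal_group L Mod principal_fractional_ideals L"

definition ideal_class :: "complex set \<Rightarrow> complex set \<Rightarrow> complex set set" where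
  "ideal_class L I = principal_fractional_ideals L #>\<^bsub>fractional_ideal_group L\<^esub> I"

definition class_number :: "complex set \<Rightarrow> nat" where
  "class_number L = Coset.order (class_group L)"

definition nonzero_prime_ideal :: "complex set \<Rightarrow> complex set \<Rightarrow> bool" where
  "nonzero_prime_ideal L P \<longleftrightarrow> primeideal P (ring_of_integers L) \<and> P \<noteq> {0}"

text \<open>
  In the following, \<open>P\<close> is a nonzero prime ideal of the ring of integers of \<open>L\<close>, and the prime of
  \<open>K\<close> below it is the intersection of \<open>P\<close> with the ring of integers of \<open>K\<close>. The ramification index
  is the exponent of \<open>P\<close> in the factorization of the ideal generated in \<open>L\<close> by the prime below.
\<close>

definition prime_below :: "complex set \<Rightarrow> complex set \<Rightarrow> complex set" where
  "prime_below K P = P \<inter> carrier (ring_of_integers K)"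

definition ramification_index :: "complex set \<Rightarrow> complex set \<Rightarrow> complex set \<Rightarrow> nat" where
  "ramification_index L K P =
     (GREATEST e. \<exists>J. ideal J (ring_of_integers L) \<and>
        genideal (ring_of_integers L) (prime_below K P)
          = ideal_prod (ring_of_integers L) J (P [^]\<^bsub>ideals_set (ring_of_integers L)\<^esub> e))"

definition unramified :: "complex set \<Rightarrow> complex set \<Rightarrow> complex set \<Rightarrow> bool" where
  "unramified L K P \<longleftrightarrow> ramification_index L K P = 1"

text \<open>
  The residue field of \<open>K\<close> at the prime below \<open>P\<close> is identified with its image in the residue
  field of \<open>L\<close> at \<open>P\<close>, i.e. with the set of residue classes of integers of \<open>K\<close>.
\<close>

definition residue_degree :: "complex set \<Rightarrow> complex set \<Rightarrow> complex set \<Rightarrow> nat" where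
  "residue_degree L K P =
     ring.dim (ring_of_integers L Quot P)
       ((\<lambda>x. P +>\<^bsub>ring_of_integers L\<^esub> x) ` carrier (ring_of_integers K))
       (carrier (ring_of_integers L Quot P))"

definition generating_residue_degrees :: "complex set \<Rightarrow> complex set \<Rightarrow> nat set" where
  "generating_residue_degrees L K =
     {f. f > 0 \<and>
         generate (class_group L)
           {ideal_class L P | P.
              nonzero_prime_ideal L P \<and> unramified L K P \<and> residue_degree L K P = f}
         = carrier (class_group L)}"

end

theory Submission
  imports Defs "HOL-Number_Theory.Residue_Primitive_Roots"
begin

text \<open>
  Let \<open>L = \<rat>(\<zeta>)\<close>, \<open>K = \<rat>(\<surd>-q)\<close>, \<open>h = (q - 1) / 2\<close> and \<open>m\<close> the order of 2 modulo \<open>q\<close>. The primes of \<open>L\<close>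
  above 2 are unramified of residue degree \<open>m\<close>, because \<open>x ^ (2 ^ m) \<equiv> x\<close> modulo 2 for all integers \<open>x\<close>
  of \<open>L\<close>, and \<open>m\<close> divides \<open>h\<close> because 2 splits in \<open>K\<close>. The class group of \<open>L\<close> having prime order, it is
  enough that one of these primes is not principal. Otherwise every ideal of \<open>L\<close> containing 2 is
  principal, in particular the extension \<open>(\<delta>)\<close> of the prime \<open>\<pp> = (2, \<omega>)\<close> of \<open>K\<close>, where
  \<open>\<omega> = (1 + \<surd>-q) / 2\<close>. The norm of \<open>\<delta>\<close> to \<open>K\<close> generates \<open>\<pp> ^ h\<close>, so \<open>\<pp>\<close> itself is principal as \<open>h\<close> is
  coprime to the class number of \<open>K\<close>. Then \<open>K\<close> contains an integer of norm 2, that is,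
  \<open>a\<^sup>2 + q b\<^sup>2 = 8\<close> is solvable, which is impossible for \<open>q > 8\<close>.

  That ideals are invertible is deduced from the finiteness of the class numbers alone, and this
  finiteness is part of the hypotheses: an infinite class group has class number 0, which is neither
  prime nor coprime to \<open>h > 1\<close>.
\<close>

section \<open>Algebraic integers\<close>

text \<open>The residue 7 modulo 8 acts twice on 2: it makes 2 a square modulo \<open>q\<close>, and
  it makes the norm \<open>(q + 1) / 4\<close> of \<open>\<omega>\<close> even, so that
  \<open>(2, \<omega>)\<close> is a proper ideal. The congruence
  \<open>x ^ (2 ^ m) \<equiv> x\<close> modulo 2 also works twice: it bounds the residue fields
  above 2, and it excludes nilpotents modulo 2, hence ramification. The ring of integers of
  \<open>L\<close> never has to be determined: \<open>q\<close> times an integer has integral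
  coordinates in the powers of \<open>\<zeta>\<close>, and \<open>q\<close> is odd, so finitely many
  sums of such powers represent all integers modulo 2. This finiteness supports inductions over the
  ideals containing 2, in place of a general factorization theory. The automorphisms of
  \<open>L\<close> rest on the independence of the first \<open>q - 1\<close> powers of
  \<open>\<zeta>\<close>, obtained from total ramification at \<open>q\<close>. They are indexed by
  the exponents of a primitive root \<open>g\<close>; the even exponents fix \<open>K\<close>, so
  the norm to \<open>K\<close> is a product over \<open>h\<close> of them. Cancellation must precede
  invertibility of ideals, and Nakayama's lemma provides it.\<close>

global_interpretation zmod: Modules.module "\<lambda>(n::int) (x::complex). of_int n * x"
  defines zspan = zmod.span and zsubspace = zmod.subspace
  by unfold_locales (auto simp: algebra_simps)

text \<open>Generators are eliminated one at a time, in place of a determinant. Each elimination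
  costs a factor congruent to 1 modulo the non-unital ring \<open>B\<close>, which is why the
  relations are assumed for \<open>u * x\<close> and not for \<open>x\<close> itself.\<close>

lemma nakayama_annihilator:
  fixes B C :: "'a::comm_ring_1 set"
  assumes B: "0 \<in> B" "\<And>x y. x \<in> B \<Longrightarrow> y \<in> B \<Longrightarrow> x + y \<in> B"
      "\<And>x. x \<in> B \<Longrightarrow> - x \<in> B" "\<And>x y. x \<in> B \<Longrightarrow> y \<in> B \<Longrightarrow> x * y \<in> B"
    and "finite S" "S \<subseteq> C" "1 - u \<in> B"
    and "\<And>x. x \<in> C \<Longrightarrow> \<exists>c. (\<forall>s. c s \<in> B) \<and> u * x = (\<Sum>s\<in>S. c s * s)"
  shows "\<exists>t. 1 - t \<in> B \<and> (\<forall>x\<in>C. t * x = 0)"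
  using assms(5-8)
proof (induction S arbitrary: u rule: finite_induct)
  case empty
  then show ?case by auto
next
  case (insert a S)
  have mul: "w * c \<in> B" if "1 - w \<in> B" "c \<in> B" for w c
  proof -
    have "c + - ((1 - w) * c) \<in> B"
      using that B by blast
    then show ?thesis by (simp add: algebra_simps)
  qed
  obtain c where c: "\<forall>s. c s \<in> B" "u * a = (\<Sum>s\<in>insert a S. c s * s)"
    using insert by blast
  \<comment> \<open>Moving the \<open>a\<close>-term of the relation for \<open>a\<close> to the
    left expresses \<open>v * a\<close> through \<open>S\<close>; multiplying any other relation by
    \<open>v\<close> then removes \<open>a\<close> from it.\<close>
  define v where "v = u - c a"
  have v: "1 - v \<in> B"
    using B(2)[OF insert.prems(2) c(1)[rule_format, of a]] by (simp add: v_def algebra_simps)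
  have va: "v * a = (\<Sum>s\<in>S. c s * s)"
    using c(2) insert.hyps by (simp add: v_def algebra_simps)
  have uv: "1 - v * u \<in> B"
    using B(2)[OF v mul[OF v insert.prems(2)]] by (simp add: algebra_simps)
  show ?case
  proof (rule insert.IH[OF _ uv])
    show "S \<subseteq> C" using insert by auto
    fix x assume "x \<in> C"
    then obtain d where d: "\<forall>s. d s \<in> B" "u * x = (\<Sum>s\<in>insert a S. d s * s)"
      using insert by blast
    have "v * u * x = v * (d a * a + (\<Sum>s\<in>S. d s * s))"
      using d insert.hyps by (simp add: mult.assoc)
    also have "\<dots> = d a * (v * a) + v * (\<Sum>s\<in>S. d s * s)"
      by (simp add: algebra_simps)
    also have "\<dots> = (\<Sum>s\<in>S. (d a * c s + v * d s) * s)"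
      unfolding va by (simp add: sum_distrib_left sum.distrib algebra_simps)
    finally show "\<exists>e. (\<forall>s. e s \<in> B) \<and> v * u * x = (\<Sum>s\<in>S. e s * s)"
      using B c d mul[OF v] by (intro exI[of _ "\<lambda>s. d a * c s + v * d s"]) auto
  qed
qed

text \<open>In a domain the annihilating factor can only be 0, and \<open>1 - 0\<close> lies in
  \<open>B\<close>.\<close>

lemma nakayama:
  fixes B :: "'a::idom set"
  assumes B: "0 \<in> B" "\<And>x y. x \<in> B \<Longrightarrow> y \<in> B \<Longrightarrow> x + y \<in> B"
      "\<And>x. x \<in> B \<Longrightarrow> - x \<in> B" "\<And>x y. x \<in> B \<Longrightarrow> y \<in> B \<Longrightarrow> x * y \<in> B"
    and S: "finite S" "s \<in> S" "s \<noteq> 0"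
    and gen: "\<And>x. x \<in> S \<Longrightarrow> \<exists>c. (\<forall>s. c s \<in> B) \<and> x = (\<Sum>s\<in>S. c s * s)"
  shows "1 \<in> B"
proof -
  have "\<exists>t. 1 - t \<in> B \<and> (\<forall>x\<in>S. t * x = 0)"
    by (rule nakayama_annihilator[OF B S(1), where u = 1]) (use gen B(1) in auto)
  then show ?thesis using S by auto
qed

text \<open>The determinant trick without determinants: with \<open>y = 1 / x\<close>, apply \<open>nakayama\<close> to
  the non-unital ring \<open>y \<int>[y]\<close>.\<close>

lemma algebraic_int_if_stable:
  fixes x :: complex
  assumes S: "finite S" "s \<in> S" "s \<noteq> 0" and stab: "\<And>s. s \<in> S \<Longrightarrow> x * s \<in> zspan S"
  shows "algebraic_int x"
proof (cases "x = 0")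
  case False
  define y where "y = inverse x"
  define ev where "ev = (\<lambda>p::complex poly. y * poly p y)"
  define Z where "Z = {p::complex poly. \<forall>i. coeff p i \<in> \<int>}"
  have Z: "0 \<in> Z" "\<And>p r. p \<in> Z \<Longrightarrow> r \<in> Z \<Longrightarrow> p + r \<in> Z" "\<And>p. p \<in> Z \<Longrightarrow> -p \<in> Z"
     "\<And>p r. p \<in> Z \<Longrightarrow> r \<in> Z \<Longrightarrow> p * r \<in> Z"
    by (auto simp: Z_def coeff_mult intro!: Ints_sum)
  have "1 \<in> ev ` Z"
  proof (rule nakayama[OF _ _ _ _ S])
    show "0 \<in> ev ` Z" using Z by (auto simp: ev_def image_iff intro!: bexI[of _ 0])
  next
    fix a b assume "a \<in> ev ` Z" "b \<in> ev ` Z"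
    then obtain p r where pr: "p \<in> Z" "a = ev p" "r \<in> Z" "b = ev r" by auto
    show "a + b \<in> ev ` Z"
      using Z pr by (auto simp: ev_def image_iff algebra_simps intro!: bexI[of _ "p + r"])
    have "pCons 0 (p * r) \<in> Z"
      using Z pr by (auto simp: Z_def coeff_pCons split: nat.splits)
    then show "a * b \<in> ev ` Z"
      using pr by (auto simp: ev_def image_iff algebra_simps intro!: bexI[of _ "pCons 0 (p * r)"])
  next
    fix a assume "a \<in> ev ` Z"
    then obtain p where pr: "p \<in> Z" "a = ev p" by auto
    show "- a \<in> ev ` Z"
      using Z pr by (auto simp: ev_def image_iff algebra_simps intro!: bexI[of _ "-p"])
  next
    fix t assume "t \<in> S"
    then obtain c where c: "x * t = (\<Sum>s\<in>S. of_int (c s) * s)"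
      using stab[of t] zmod.span_finite[OF S(1)] by auto
    \<comment> \<open>Stability under \<open>x\<close> is read backwards: the integer coefficients
      of \<open>x * t\<close> become coefficients in \<open>y \<int>[y]\<close> for \<open>t\<close>
      itself.\<close>
    have "t = y * (x * t)" using False by (simp add: y_def)
    also have "\<dots> = (\<Sum>s\<in>S. ev [:of_int (c s):] * s)"
      by (simp add: c ev_def sum_distrib_left mult.assoc)
    finally show "\<exists>c. (\<forall>s. c s \<in> ev ` Z) \<and> t = (\<Sum>s\<in>S. c s * s)"
      by (intro exI[of _ "\<lambda>s. ev [:of_int (c s):]"])
        (auto simp: Z_def coeff_pCons split: nat.splits)
  qed
  then obtain p where p: "p \<in> Z" "1 = y * poly p y" by (auto simp: ev_def)
  \<comment> \<open>The relation \<open>1 = y * p(y)\<close> makes \<open>y\<close> a root of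
    \<open>P\<close>, whose constant term is 1. Reversing the coefficients gives a monic polynomial
    with root \<open>x\<close>.\<close>
  define P where "P = pCons 1 (- p)"
  have "poly P y = 0" using p by (simp add: P_def)
  then have "poly (reflect_poly P) x = 0"
    using False by (simp add: poly_reflect_poly_nz y_def)
  moreover have "coeff (reflect_poly P) i \<in> \<int>" for i
    using p by (auto simp: P_def Z_def coeff_reflect_poly coeff_pCons split: nat.splits)
  moreover have "lead_coeff (reflect_poly P) = 1"
    using coeff_0_reflect_poly[of "reflect_poly P"] by (simp add: P_def coeff_reflect_poly)
  ultimately show ?thesis by (intro algebraic_int.intros[of "reflect_poly P"]) auto
qed auto

lemma algebraic_int_power_reduction:
  fixes x :: complex
  assumes "algebraic_int x"
  obtains m c where "m > 0" "x ^ m = (\<Sum>i<m. of_int (c i) * x ^ i)"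
proof -
  obtain p where p: "lead_coeff p = 1" "\<forall>i. coeff p i \<in> \<int>" "poly p x = 0"
    using assms by (auto simp: algebraic_int.simps)
  define m where "m = degree p"
  have "\<forall>i. \<exists>c. - coeff p i = of_int c" using p(2) by (metis Ints_cases Ints_minus)
  then obtain c where c: "\<And>i. - coeff p i = of_int (c i)" by metis
  have "m > 0"
  proof (rule ccontr)
    assume "\<not> m > 0"
    then obtain a where "p = [:a:]" using degree_eq_zeroE by (metis m_def neq0_conv)
    then show False using p by auto
  qed
  moreover have "x ^ m = (\<Sum>i<m. of_int (c i) * x ^ i)"
  proof -
    have "0 = (\<Sum>i\<le>m. coeff p i * x ^ i)" using p by (simp add: poly_altdef m_def)
    also have "\<dots> = (\<Sum>i<m. coeff p i * x ^ i) + x ^ m"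
      using p by (simp add: lessThan_Suc_atMost[symmetric] m_def)
    finally show ?thesis
      unfolding c[symmetric] by (simp add: sum_negf algebra_simps add_eq_0_iff)
  qed
  ultimately show ?thesis using that by blast
qed

lemma zspan_mult_closed:
  assumes "\<And>s. s \<in> S \<Longrightarrow> x * s \<in> zspan S" "m \<in> zspan S"
  shows "x * m \<in> zspan S"
  using assms(2)
proof (induction rule: zmod.span_induct_alt)
  case base
  then show ?case by (simp add: zmod.span_zero)
next
  case (step c s m)
  have "x * (of_int c * s + m) = of_int c * (x * s) + x * m" by (simp add: algebra_simps)
  then show ?case using step assms(1) by (metis zmod.span_add zmod.span_scale)
qed

text \<open>The finitely many monomials \<open>x ^ i * y ^ j\<close> below the two degrees span a
  group that is stable under both \<open>x\<close> and \<open>y\<close>, hence under their sum and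
  product.\<close>

lemma algebraic_int_add_mult:
  fixes x y :: complex
  assumes "algebraic_int x" "algebraic_int y"
  shows "algebraic_int (x + y) \<and> algebraic_int (x * y)"
proof -
  obtain m c where m: "m > 0" "x ^ m = (\<Sum>i<m. of_int (c i) * x ^ i)"
    using algebraic_int_power_reduction[OF assms(1)] .
  obtain n d where n: "n > 0" "y ^ n = (\<Sum>i<n. of_int (d i) * y ^ i)"
    using algebraic_int_power_reduction[OF assms(2)] .
  define S where "S = (\<lambda>(i,j). x ^ i * y ^ j) ` ({..<m} \<times> {..<n})"
  have S: "finite S" "1 \<in> S"
    using m n image_eqI[of 1 "\<lambda>(i,j). x ^ i * y ^ j" "(0,0)"] by (auto simp: S_def)
  have inS: "x ^ i * y ^ j \<in> zspan S" if "i < m" "j < n" for i j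
    using that by (intro zmod.span_base) (auto simp: S_def)
  have x: "x * s \<in> zspan S" if s: "s \<in> S" for s
  proof -
    obtain i j where ij: "s = x ^ i * y ^ j" "i < m" "j < n" using s by (auto simp: S_def)
    show ?thesis
    proof (cases "Suc i < m")
      case True
      then show ?thesis using inS[of "Suc i" j] ij by (simp add: mult.assoc)
    next
      case False
      then have "m = Suc i" using ij by simp
      then have "x * s = x ^ m * y ^ j" using ij by simp
      also have "\<dots> = (\<Sum>i<m. of_int (c i) * (x ^ i * y ^ j))"
        unfolding m(2) by (simp add: sum_distrib_right mult.assoc)
      finally show ?thesis using inS ij by (auto intro!: zmod.span_sum zmod.span_scale)
    qed
  qed
  have y: "y * s \<in> zspan S" if s: "s \<in> S" for s
  proof -
    obtain i j where ij: "s = x ^ i * y ^ j" "i < m" "j < n" using s by (auto simp: S_def)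
    show ?thesis
    proof (cases "Suc j < n")
      case True
      then show ?thesis using inS[of i "Suc j"] ij by (simp add: mult_ac)
    next
      case False
      then have "n = Suc j" using ij by simp
      then have "y * s = y ^ n * x ^ i" using ij by (simp add: mult_ac)
      also have "\<dots> = (\<Sum>j<n. of_int (d j) * (x ^ i * y ^ j))"
        unfolding n(2) by (simp add: sum_distrib_left mult_ac)
      finally show ?thesis using inS ij by (auto intro!: zmod.span_sum zmod.span_scale)
    qed
  qed
  have "algebraic_int (x + y)"
    by (rule algebraic_int_if_stable[OF S])
      (use x y in \<open>auto simp: algebra_simps intro: zmod.span_add\<close>)
  moreover have "algebraic_int (x * y)"
  proof (rule algebraic_int_if_stable[OF S])
    show "x * y * s \<in> zspan S" if "s \<in> S" for s
      using zspan_mult_closed[OF x y[OF that]] by (simp add: mult.assoc)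
  qed auto
  ultimately show ?thesis by blast
qed

lemmas algebraic_int_add [intro] = algebraic_int_add_mult[THEN conjunct1]
  and algebraic_int_mult [intro] = algebraic_int_add_mult[THEN conjunct2]

lemma algebraic_int_diff [intro]:
  "algebraic_int x \<Longrightarrow> algebraic_int y \<Longrightarrow> algebraic_int (x - y :: complex)"
  using algebraic_int_add[of x "- y"] by simp

lemma algebraic_int_sum [intro]:
  "(\<And>i. i \<in> A \<Longrightarrow> algebraic_int (f i :: complex)) \<Longrightarrow> algebraic_int (sum f A)"
  by (induction A rule: infinite_finite_induct) auto

lemma algebraic_int_prod [intro]:
  "(\<And>i. i \<in> A \<Longrightarrow> algebraic_int (f i :: complex)) \<Longrightarrow> algebraic_int (prod f A)"
  by (induction A rule: infinite_finite_induct) (auto simp: int_imp_algebraic_int)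

lemma algebraic_int_power [intro]: "algebraic_int x \<Longrightarrow> algebraic_int (x ^ n :: complex)"
  by (induction n) (auto simp: int_imp_algebraic_int)

lemma algebraic_int_of_int [simp, intro]: "algebraic_int (of_int n :: complex)"
  by (simp add: int_imp_algebraic_int)

section \<open>Subgroups of finitely generated additive groups\<close>

lemma int_subgroup_principal:
  fixes K :: "int set"
  assumes "0 \<in> K" "\<And>x y. x \<in> K \<Longrightarrow> y \<in> K \<Longrightarrow> x - y \<in> K"
  obtains g where "g \<in> K" "\<And>x. x \<in> K \<Longrightarrow> g dvd x"
proof (cases "\<exists>n::nat. 0 < n \<and> int n \<in> K")
  case False
  have "x = 0" if "x \<in> K" for x
  proof (rule ccontr)
    assume "x \<noteq> 0"
    have "- x \<in> K" using assms(2)[OF assms(1) that] by simp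
    then have "int (nat \<bar>x\<bar>) \<in> K" using that by (cases "x \<ge> 0") auto
    then show False using False \<open>x \<noteq> 0\<close> by (metis zero_less_abs_iff zero_less_nat_eq)
  qed
  then show ?thesis using that[of 0] assms by auto
next
  case True
  define n where "n = (LEAST n::nat. 0 < n \<and> int n \<in> K)"
  have n: "0 < n" "int n \<in> K" using LeastI_ex[OF True] by (auto simp: n_def)
  have neg: "- x \<in> K" if "x \<in> K" for x using assms(2)[OF assms(1) that] by simp
  have add: "x + y \<in> K" if "x \<in> K" "y \<in> K" for x y using assms(2)[OF that(1) neg[OF that(2)]] by simp
  have nmul: "int j * int n \<in> K" for j
    by (induction j) (use assms(1) add n in \<open>auto simp: algebra_simps\<close>)
  have mul: "j * int n \<in> K" for j
  proof (cases "j \<ge> 0")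
    case True
    then show ?thesis using nmul[of "nat j"] by simp
  next
    case False
    then show ?thesis using neg[OF nmul[of "nat (-j)"]] by simp
  qed
  have "int n dvd x" if "x \<in> K" for x
  proof -
    have "x mod int n \<in> K"
      using assms(2)[OF that mul[of "x div int n"]] by (simp add: minus_div_mult_eq_mod)
    moreover have "0 \<le> x mod int n" "x mod int n < int n" using n by auto
    ultimately have "x mod int n = 0"
      using not_less_Least[of "nat (x mod int n)" "\<lambda>n. 0 < n \<and> int n \<in> K"] n_def
      by (cases "x mod int n = 0") auto
    then show ?thesis by auto
  qed
  then show ?thesis using that n by blast
qed

text \<open>The coefficients of \<open>b\<close> that occur in \<open>H\<close> form a subgroup of
  the integers, generated by some \<open>g\<close>. An element of \<open>H\<close> with coefficient
  \<open>g\<close>, together with generators of the part of \<open>H\<close> inside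
  \<open>zspan B\<close>, generates \<open>H\<close>.\<close>

lemma zspan_noetherian:
  assumes "finite B" "zsubspace H" "H \<subseteq> zspan B"
  shows "\<exists>S. finite S \<and> H = zspan S"
  using assms
proof (induction B arbitrary: H rule: finite_induct)
  case empty
  then show ?case by (intro exI[of _ "{}"]) (auto simp: zmod.subspace_0)
next
  case (insert b B)
  define K where "K = {n::int. \<exists>y\<in>zspan B. of_int n * b + y \<in> H}"
  obtain g where g: "g \<in> K" "\<And>x. x \<in> K \<Longrightarrow> g dvd x"
  proof (rule int_subgroup_principal[of K])
    show "0 \<in> K" using insert.prems
      by (auto simp: K_def zmod.subspace_0 intro!: bexI[of _ 0] zmod.span_zero)
    fix n n' assume "n \<in> K" "n' \<in> K"
    then obtain y y' where y: "y \<in> zspan B" "of_int n * b + y \<in> H"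
        "y' \<in> zspan B" "of_int n' * b + y' \<in> H" by (auto simp: K_def)
    have "(of_int n * b + y) - (of_int n' * b + y') \<in> H"
      using y insert.prems by (intro zmod.subspace_diff)
    then show "n - n' \<in> K"
      using y by (auto simp: K_def algebra_simps intro!: bexI[of _ "y - y'"] zmod.span_diff)
  qed blast
  obtain y0 where y0: "y0 \<in> zspan B" "of_int g * b + y0 \<in> H" using g by (auto simp: K_def)
  define h where "h = of_int g * b + y0"
  obtain S where S: "finite S" "H \<inter> zspan B = zspan S"
    using insert.IH[of "H \<inter> zspan B"] insert.prems
    by (metis inf_le2 zmod.subspace_inter zmod.subspace_span)
  have "H = zspan (insert h S)"
  proof
    show "H \<subseteq> zspan (insert h S)"
    proof
      fix x assume x: "x \<in> H"
      then obtain n where n: "x - of_int n * b \<in> zspan B"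
        using insert.prems zmod.span_breakdown_eq[of x b B] by auto
      then have "n \<in> K" using x by (auto simp: K_def intro!: bexI[of _ "x - of_int n * b"])
      then obtain k where k: "n = g * k" using g by blast
      have "x - of_int k * h \<in> H"
        using x y0 insert.prems by (auto simp: h_def intro!: zmod.subspace_diff zmod.subspace_scale)
      moreover have "(x - of_int n * b) - of_int k * y0 \<in> zspan B"
        by (intro zmod.span_diff zmod.span_scale n y0)
      then have "x - of_int k * h \<in> zspan B"
        by (simp add: h_def k algebra_simps)
      ultimately show "x \<in> zspan (insert h S)"
        using S by (auto simp: zmod.span_breakdown_eq)
    qed
    show "zspan (insert h S) \<subseteq> H"
      using S y0 insert.prems zmod.span_superset[of S]
      by (intro zmod.span_minimal) (auto simp: h_def)
  qed
  then show ?case using S by blast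
qed

section \<open>Fractional ideals and the class group\<close>

text \<open>Products are formed inside the ring of all complex numbers, so that a single operation
  serves the fractional ideals of both fields and also the extension of an ideal from the quadratic
  to the cyclotomic field.\<close>

abbreviation iprod :: "complex set \<Rightarrow> complex set \<Rightarrow> complex set" (infixl "**" 70) where
  "I ** J \<equiv> ideal_prod complex_ring I J"

lemma complex_ring_simps [simp]:
  "carrier complex_ring = UNIV" "monoid.mult complex_ring = (*)" "one complex_ring = 1"
  "ring.zero complex_ring = 0" "add complex_ring = (+)"
  by (simp_all add: ring_of_type_algebra_def fun_eq_iff)

lemma iprodI: "i \<in> I \<Longrightarrow> j \<in> J \<Longrightarrow> i * j \<in> I ** J"
  using ideal_prod.prod[of i I j J complex_ring] by simp

lemma iprod_add: "x \<in> I ** J \<Longrightarrow> y \<in> I ** J \<Longrightarrow> x + y \<in> I ** J"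
  using ideal_prod.sum[of x complex_ring I J y] by simp

lemma iprod_induct [consumes 1, case_names prod sum]:
  assumes "x \<in> I ** J" "\<And>i j. i \<in> I \<Longrightarrow> j \<in> J \<Longrightarrow> P (i * j)"
    "\<And>x y. x \<in> I ** J \<Longrightarrow> y \<in> I ** J \<Longrightarrow> P x \<Longrightarrow> P y \<Longrightarrow> P (x + y)"
  shows "P x"
  using assms(1) by (induction rule: ideal_prod.induct) (use assms in auto)

lemma iprod_subset:
  assumes "\<And>i j. i \<in> I \<Longrightarrow> j \<in> J \<Longrightarrow> i * j \<in> K" "\<And>x y. x \<in> K \<Longrightarrow> y \<in> K \<Longrightarrow> x + y \<in> K"
  shows "I ** J \<subseteq> K"
proof
  fix x assume "x \<in> I ** J"
  then show "x \<in> K" by (induction rule: iprod_induct) (use assms in auto)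
qed

lemma iprod_mono: "I \<subseteq> I' \<Longrightarrow> J \<subseteq> J' \<Longrightarrow> I ** J \<subseteq> I' ** J'"
  by (intro iprod_subset iprodI iprod_add) auto

lemma iprod_comm: "I ** J = J ** I"
proof -
  have "I ** J \<subseteq> J ** I" for I J
    by (intro iprod_subset iprod_add) (subst mult.commute, auto intro: iprodI)
  then show ?thesis by blast
qed

lemma iprod_assoc: "(I ** J) ** K = I ** (J ** K)"
proof -
  have 1: "(I ** J) ** K \<subseteq> I ** (J ** K)" for I J K
  proof (intro iprod_subset iprod_add; assumption?)
    fix x k assume x: "x \<in> I ** J" and k: "k \<in> K"
    show "x * k \<in> I ** (J ** K)"
      using x by (induction rule: iprod_induct)
        (auto simp: algebra_simps mult.assoc intro: iprodI k iprod_add)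
  qed
  have "I ** (J ** K) = (K ** J) ** I" by (metis iprod_comm)
  also have "\<dots> \<subseteq> K ** (J ** I)" by (rule 1)
  also have "\<dots> = (I ** J) ** K" by (metis iprod_comm)
  finally show ?thesis using 1 by blast
qed

lemma zspan_image_mult: "y \<in> zspan B \<Longrightarrow> a * y \<in> zspan ((*) a ` B)"
proof (induction rule: zmod.span_induct_alt)
  case base
  then show ?case by (simp add: zmod.span_zero)
next
  case (step c x y)
  have "a * (of_int c * x + y) = of_int c * (a * x) + a * y" by (simp add: algebra_simps)
  moreover have "a * x \<in> zspan ((*) a ` B)" using step by (intro zmod.span_base) auto
  ultimately show ?case using step by (metis zmod.span_add zmod.span_scale)
qed

lemma zspan_nonzero:
  assumes "x \<in> zspan S" "x \<noteq> 0"
  shows "\<exists>s\<in>S. s \<noteq> 0"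
proof (rule ccontr)
  assume "\<not> ?thesis"
  then have "S \<subseteq> {0}" by auto
  then have "zspan S \<subseteq> {0}" by (intro zmod.span_minimal) (auto simp: zmod.subspace_def)
  then show False using assms by auto
qed

text \<open>The last two assumptions take the place of finite degree over the rationals. The
  integers only have to lie in some finitely generated group, since \<open>zspan_noetherian\<close>
  passes to subgroups; so no integral basis has to be exhibited.\<close>

locale number_field =
  fixes L :: "complex set"
  assumes one_closed: "1 \<in> L"
    and diff_closed: "x \<in> L \<Longrightarrow> y \<in> L \<Longrightarrow> x - y \<in> L"
    and mult_closed: "x \<in> L \<Longrightarrow> y \<in> L \<Longrightarrow> x * y \<in> L"
    and inverse_closed: "x \<in> L \<Longrightarrow> inverse x \<in> L"
    and denominator: "x \<in> L \<Longrightarrow> \<exists>n::int. n \<noteq> 0 \<and> algebraic_int (of_int n * x)"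
    and finitely_generated: "\<exists>B. finite B \<and> {x \<in> L. algebraic_int x} \<subseteq> zspan B"
begin

definition \<O> where O_def: "\<O> = {x \<in> L. algebraic_int x}"

text \<open>The \<open>\<O>\<close>-submodules of the complex numbers: the part of the ideal axioms
  that integral and fractional ideals share.\<close>

definition osub :: "complex set \<Rightarrow> bool" where
  "osub I \<longleftrightarrow> 0 \<in> I \<and> (\<forall>x\<in>I. \<forall>y\<in>I. x + y \<in> I) \<and> (\<forall>r\<in>\<O>. \<forall>x\<in>I. r * x \<in> I)"

lemma zero_closed: "0 \<in> L" using diff_closed[OF one_closed one_closed] by simp

lemma uminus_closed: "x \<in> L \<Longrightarrow> - x \<in> L" using diff_closed[OF zero_closed] by simp

lemma add_closed: "x \<in> L \<Longrightarrow> y \<in> L \<Longrightarrow> x + y \<in> L"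
  using diff_closed[OF _ uminus_closed] by simp

lemma divide_closed: "x \<in> L \<Longrightarrow> y \<in> L \<Longrightarrow> x / y \<in> L"
  by (simp add: divide_inverse mult_closed inverse_closed)

lemma of_int_closed: "of_int n \<in> L"
proof -
  have *: "of_nat n \<in> L" for n
    by (induction n) (auto intro: zero_closed one_closed add_closed)
  show ?thesis
    using *[of "nat n"] uminus_closed[OF *[of "nat (- n)"]] by (cases "n \<ge> 0") auto
qed

lemma of_rat_closed: "of_rat r \<in> L"
  by (cases r) (auto simp: of_rat_rat intro: divide_closed of_int_closed)

lemma O_closed:
  "0 \<in> \<O>" "1 \<in> \<O>" "of_int n \<in> \<O>" "x \<in> \<O> \<Longrightarrow> y \<in> \<O> \<Longrightarrow> x + y \<in> \<O>" "x \<in> \<O> \<Longrightarrow> y \<in> \<O> \<Longrightarrow> x - y \<in> \<O>"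
  "x \<in> \<O> \<Longrightarrow> - x \<in> \<O>" "x \<in> \<O> \<Longrightarrow> y \<in> \<O> \<Longrightarrow> x * y \<in> \<O>"
  using of_int_closed[of 1] by (auto simp: O_def zero_closed of_int_closed add_closed diff_closed
      uminus_closed mult_closed int_imp_algebraic_int)

lemma O_subset: "\<O> \<subseteq> L" by (auto simp: O_def)

lemma ring_of_integers_simps [simp]:
  "carrier (ring_of_integers L) = \<O>" "monoid.mult (ring_of_integers L) = (*)"
  "one (ring_of_integers L) = 1" "ring.zero (ring_of_integers L) = 0" "add (ring_of_integers L) = (+)"
  by (simp_all add: ring_of_integers_def O_def)

lemma cring_O: "cring (ring_of_integers L)"
proof (rule cringI)
  show "abelian_group (ring_of_integers L)"
    by (rule abelian_groupI)
       (auto intro!: O_closed bexI[of _ "- x" for x] simp: algebra_simps)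
  show "Group.comm_monoid (ring_of_integers L)"
    by (rule comm_monoidI) (auto intro!: O_closed)
qed (auto simp: algebra_simps)

lemma osub_uminus: "osub I \<Longrightarrow> x \<in> I \<Longrightarrow> - x \<in> I"
  using O_closed(6)[OF O_closed(2)] unfolding osub_def by (metis mult_minus1)

lemma osub_diff: "osub I \<Longrightarrow> x \<in> I \<Longrightarrow> y \<in> I \<Longrightarrow> x - y \<in> I"
  using osub_uminus[of I y] unfolding osub_def by (metis add_uminus_conv_diff)

lemma osubD:
  assumes "osub I"
  shows "0 \<in> I" "x \<in> I \<Longrightarrow> y \<in> I \<Longrightarrow> x + y \<in> I" "r \<in> \<O> \<Longrightarrow> x \<in> I \<Longrightarrow> r * x \<in> I"
    "r \<in> \<O> \<Longrightarrow> x \<in> I \<Longrightarrow> x * r \<in> I"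
  using assms by (auto simp: osub_def mult.commute)

lemma osub_zsubspace: "osub I \<Longrightarrow> zsubspace I"
  unfolding zmod.subspace_def using osubD O_closed(3) by metis

lemma ideal_iff: "ideal I (ring_of_integers L) \<longleftrightarrow> I \<subseteq> \<O> \<and> osub I"
proof
  assume "ideal I (ring_of_integers L)"
  then interpret ideal I "ring_of_integers L" .
  have "additive_subgroup I (ring_of_integers L)" by (rule is_additive_subgroup)
  then show "I \<subseteq> \<O> \<and> osub I"
    using a_subset I_l_closed additive_subgroup.a_closed[of I "ring_of_integers L"]
      additive_subgroup.zero_closed[of I "ring_of_integers L"] by (auto simp: osub_def)
next
  assume I: "I \<subseteq> \<O> \<and> osub I"
  interpret cring "ring_of_integers L" by (rule cring_O)
  show "ideal I (ring_of_integers L)"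
  proof (rule idealI)
    show "subgroup I (add_monoid (ring_of_integers L))"
    proof (rule group.subgroupI)
      show "Group.group (add_monoid (ring_of_integers L))" by (rule add.is_group)
      fix a assume a: "a \<in> I"
      have "inv\<^bsub>add_monoid (ring_of_integers L)\<^esub> a = - a"
        using I a by (intro group.inv_equality[OF add.is_group]) (auto intro!: O_closed)
      then show "inv\<^bsub>add_monoid (ring_of_integers L)\<^esub> a \<in> I"
        using I a osub_uminus by simp
    qed (use I osubD in auto)
  qed (use I osubD ring_axioms in auto)
qed

lemma osub_O: "osub \<O>" by (auto simp: osub_def intro: O_closed)

lemma osub_iprod: "osub I \<Longrightarrow> osub J \<Longrightarrow> osub (I ** J)"
  unfolding osub_def
proof (intro conjI ballI)
  assume I: "0 \<in> I \<and> (\<forall>x\<in>I. \<forall>y\<in>I. x + y \<in> I) \<and> (\<forall>r\<in>\<O>. \<forall>x\<in>I. r * x \<in> I)"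
    and J: "0 \<in> J \<and> (\<forall>x\<in>J. \<forall>y\<in>J. x + y \<in> J) \<and> (\<forall>r\<in>\<O>. \<forall>x\<in>J. r * x \<in> J)"
  show "0 \<in> I ** J" using iprodI[of 0 I 0 J] I J by simp
  fix x assume x: "x \<in> I ** J"
  show "x + y \<in> I ** J" if "y \<in> I ** J" for y using iprod_add x that .
  fix r assume r: "r \<in> \<O>"
  show "r * x \<in> I ** J"
    using x
  proof (induction rule: iprod_induct)
    case (prod i j)
    then show ?case using iprodI[of "r * i" I j J] I r by (simp add: mult.assoc)
  qed (auto simp: algebra_simps intro: iprod_add)
qed

lemma O_iprod: "osub I \<Longrightarrow> \<O> ** I = I"
proof
  assume I: "osub I"
  show "\<O> ** I \<subseteq> I" by (intro iprod_subset) (use osubD[OF I] in auto)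
  show "I \<subseteq> \<O> ** I" using iprodI[OF O_closed(2)] by fastforce
qed

lemma osub_scale: "osub I \<Longrightarrow> osub ((*) a ` I)"
  unfolding osub_def
proof (intro conjI ballI)
  assume I: "0 \<in> I \<and> (\<forall>x\<in>I. \<forall>y\<in>I. x + y \<in> I) \<and> (\<forall>r\<in>\<O>. \<forall>x\<in>I. r * x \<in> I)"
  show "0 \<in> (*) a ` I" using I by (auto intro: image_eqI[of _ _ 0])
  show "x + y \<in> (*) a ` I" if "x \<in> (*) a ` I" "y \<in> (*) a ` I" for x y
    using I that by (auto simp: distrib_left[symmetric])
  show "r * x \<in> (*) a ` I" if "r \<in> \<O>" "x \<in> (*) a ` I" for r x
    using I that by (auto simp: mult.left_commute)
qed

lemma scale_iprod: "(*) a ` (I ** J) = ((*) a ` I) ** J"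
proof
  show "(*) a ` (I ** J) \<subseteq> ((*) a ` I) ** J"
  proof (intro image_subsetI)
    fix x assume "x \<in> I ** J"
    then show "a * x \<in> ((*) a ` I) ** J"
      by (induction rule: iprod_induct)
         (auto simp: distrib_left mult.assoc[symmetric] intro: iprod_add iprodI)
  qed
  show "((*) a ` I) ** J \<subseteq> (*) a ` (I ** J)"
    by (intro iprod_subset)
       (auto simp: mult.assoc distrib_left[symmetric] intro!: imageI iprodI iprod_add)
qed

lemma scale_O_iprod: "osub I \<Longrightarrow> ((*) a ` \<O>) ** I = (*) a ` I"
  by (simp add: scale_iprod[symmetric] O_iprod)

lemma scale_scale: "(*) a ` (*) b ` I = (*) (a * b :: complex) ` I"
  by (auto simp: image_image mult.assoc)

lemma scale_one: "(*) (1::complex) ` I = I" by simp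

definition fractional :: "complex set \<Rightarrow> bool" where
  "fractional I \<longleftrightarrow> osub I \<and> (\<exists>x\<in>I. x \<noteq> 0) \<and> (\<exists>d\<in>\<O>-{0}. \<forall>x\<in>I. d * x \<in> \<O>)"

lemma fractional_ideals_iff: "I \<in> fractional_ideals L \<longleftrightarrow> fractional I"
proof
  assume "I \<in> fractional_ideals L"
  then obtain d where d: "d \<in> \<O> - {0}" "(*) d ` I \<subseteq> \<O>" "osub ((*) d ` I)" "I \<noteq> {0}"
    by (auto simp: fractional_ideals_def ideal_iff)
  have I: "I = (*) (inverse d) ` (*) d ` I" using d by (simp add: scale_scale)
  have "osub I" by (subst I) (intro osub_scale d)
  moreover have "\<exists>x\<in>I. x \<noteq> 0" using d osubD(1)[OF calculation] by blast
  ultimately show "fractional I" using d unfolding fractional_def image_subset_iff by blast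
next
  assume "fractional I"
  then obtain d x where d: "osub I" "x \<in> I" "x \<noteq> 0" "d \<in> \<O> - {0}" "\<forall>x\<in>I. d * x \<in> \<O>"
    by (auto simp: fractional_def)
  then have "ideal ((\<lambda>x. d * x) ` I) (ring_of_integers L)"
    using osub_scale[OF d(1)] by (auto simp: ideal_iff)
  then show "I \<in> fractional_ideals L"
    unfolding fractional_ideals_def using d by auto
qed

lemma fractional_subset: "fractional I \<Longrightarrow> I \<subseteq> L"
proof
  fix x assume "fractional I" "x \<in> I"
  then obtain d where "d \<in> \<O> - {0}" "d * x \<in> \<O>" by (auto simp: fractional_def)
  then show "x \<in> L" using divide_closed[of "d * x" d] O_subset by auto
qed

lemma fractional_osub: "fractional I \<Longrightarrow> osub I" by (simp add: fractional_def)

lemma integral_denominator: "x \<in> L \<Longrightarrow> \<exists>d\<in>\<O>-{0}. d * x \<in> \<O>"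
  using denominator[of x] O_closed(3) mult_closed of_int_closed
  by (auto simp: O_def intro!: bexI[of _ "of_int n" for n])

lemma fractional_scale:
  assumes "fractional I" "a \<in> L" "a \<noteq> 0"
  shows "fractional ((*) a ` I)"
proof -
  obtain d where d: "d \<in> \<O> - {0}" "\<forall>x\<in>I. d * x \<in> \<O>" "osub I" "\<exists>x\<in>I. x \<noteq> 0"
    using assms by (auto simp: fractional_def)
  obtain e where e: "e \<in> \<O> - {0}" "e * a \<in> \<O>" using integral_denominator[OF assms(2)] by auto
  have "d * e \<in> \<O> - {0}" using d e by (auto intro: O_closed)
  moreover have "d * e * (a * x) \<in> \<O>" if "x \<in> I" for x
    using O_closed(7)[OF e(2) d(2)[rule_format, OF that]] by (simp add: mult_ac)
  moreover have "\<exists>x\<in>(*) a ` I. x \<noteq> 0" using d assms by auto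
  ultimately show ?thesis unfolding fractional_def
    using osub_scale[OF d(3)] by (metis imageE)
qed

lemma fractional_O: "fractional \<O>"
  unfolding fractional_def using osub_O O_closed(2) by (auto intro!: bexI[of _ 1])

lemma fractional_ideal: "I \<subseteq> \<O> \<Longrightarrow> osub I \<Longrightarrow> x \<in> I \<Longrightarrow> x \<noteq> 0 \<Longrightarrow> fractional I"
  unfolding fractional_def using O_closed(2) by (intro conjI bexI[of _ x] bexI[of _ 1]) auto

lemma fractional_iprod:
  assumes "fractional I" "fractional J"
  shows "fractional (I ** J)"
proof -
  obtain d x where d: "d \<in> \<O> - {0}" "\<forall>x\<in>I. d * x \<in> \<O>" "osub I" "x \<in> I" "x \<noteq> 0"
    using assms by (auto simp: fractional_def)
  obtain e y where e: "e \<in> \<O> - {0}" "\<forall>x\<in>J. e * x \<in> \<O>" "osub J" "y \<in> J" "y \<noteq> 0"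
    using assms by (auto simp: fractional_def)
  have "d * e \<in> \<O> - {0}" using d e by (auto intro: O_closed)
  moreover have "d * e * z \<in> \<O>" if "z \<in> I ** J" for z
    using that
  proof (induction rule: iprod_induct)
    case (prod i j)
    then have "(d * i) * (e * j) \<in> \<O>" using O_closed(7) d(2) e(2) prod by auto
    then show ?case by (simp add: mult_ac)
  qed (auto simp: distrib_left intro: O_closed)
  moreover have "x * y \<in> I ** J" "x * y \<noteq> 0" using d e by (auto intro: iprodI)
  ultimately show ?thesis using osub_iprod d e unfolding fractional_def by metis
qed

lemma fractional_fg:
  assumes "fractional I"
  obtains S where "finite S" "I = zspan S"
proof -
  obtain d where d: "d \<in> \<O> - {0}" "\<forall>x\<in>I. d * x \<in> \<O>" "osub I"
    using assms by (auto simp: fractional_def)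
  obtain B where B: "finite B" "\<O> \<subseteq> zspan B" using finitely_generated by (auto simp: O_def)
  have "I \<subseteq> zspan ((*) (inverse d) ` B)"
  proof
    fix x assume "x \<in> I"
    then have "d * x \<in> zspan B" using d B by auto
    from zspan_image_mult[OF this, of "inverse d"] show "x \<in> zspan ((*) (inverse d) ` B)"
      using d by (simp add: mult.assoc[symmetric])
  qed
  from zspan_noetherian[OF _ osub_zsubspace[OF d(3)] this] show ?thesis
    using B that by auto
qed

text \<open>Integral closedness in the form used for ideals: a multiplier of a fractional ideal
  stabilises a nonzero finitely generated group.\<close>

lemma stable_integral:
  assumes "fractional I" "x \<in> L" "\<And>y. y \<in> I \<Longrightarrow> x * y \<in> I"
  shows "x \<in> \<O>"
proof -
  obtain S where S: "finite S" "I = zspan S" using fractional_fg[OF assms(1)] .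
  have "\<exists>s\<in>S. s \<noteq> 0"
    using assms(1) zspan_nonzero unfolding S(2) fractional_def by blast
  then have "algebraic_int x"
    using algebraic_int_if_stable[OF S(1)] assms(3) S(2) zmod.span_base[of _ S] by metis
  then show ?thesis using assms by (simp add: O_def)
qed

text \<open>The only form of cancellation available before ideals are known to be invertible.
  Elements of \<open>B\<close> multiply \<open>C\<close> into itself, so they are integral;
  conversely \<open>C = C ** B\<close> expresses generators of \<open>C\<close> with coefficients in
  \<open>B\<close>, and Nakayama's lemma puts 1 into \<open>B\<close>.\<close>

lemma iprod_cancel_self:
  assumes "fractional C" "fractional B" "C = C ** B"
  shows "B = \<O>"
proof
  show BO: "B \<subseteq> \<O>"
  proof
    fix b assume b: "b \<in> B"
    show "b \<in> \<O>"
      by (rule stable_integral[OF assms(1)])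
         (use b fractional_subset[OF assms(2)] assms(3) iprodI[of _ C b B] in \<open>auto simp: mult.commute\<close>)
  qed
  obtain S where S: "finite S" "C = zspan S" using fractional_fg[OF assms(1)] .
  have B: "osub B" using assms by (simp add: fractional_def)
  have "\<exists>s\<in>S. s \<noteq> 0"
    using assms(1) zspan_nonzero unfolding S(2) fractional_def by blast
  then obtain s where s: "s \<in> S" "s \<noteq> 0" by blast
  have gen: "\<exists>c. (\<forall>s. c s \<in> B) \<and> x = (\<Sum>s\<in>S. c s * s)" if "x \<in> C ** B" for x
    using that
  proof (induction rule: iprod_induct)
    case (prod i j)
    obtain c where c: "i = (\<Sum>s\<in>S. of_int (c s) * s)"
      using prod S zmod.span_finite[OF S(1)] by auto
    then show ?case using prod B O_closed(3)
      by (intro exI[of _ "\<lambda>s. of_int (c s) * j"])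
         (auto simp: sum_distrib_right sum_distrib_left mult_ac intro: osubD)
  next
    case (sum x y)
    then obtain c d where "\<forall>s. c s \<in> B" "x = (\<Sum>s\<in>S. c s * s)" "\<forall>s. d s \<in> B" "y = (\<Sum>s\<in>S. d s * s)"
      by blast
    then show ?case using B
      by (intro exI[of _ "\<lambda>s. c s + d s"]) (auto simp: distrib_right sum.distrib intro: osubD)
  qed
  have "1 \<in> B"
    by (rule nakayama[OF _ _ _ _ S(1) s])
       (use osubD[OF B] osub_uminus[OF B] BO gen S zmod.span_base[of _ S] assms(3) in auto)
  then show "\<O> \<subseteq> B" using osubD(3)[OF B, of _ 1] by auto
qed

abbreviation F where "F \<equiv> fractional_ideal_group L"
abbreviation Pr where "Pr \<equiv> principal_fractional_ideals L"

lemma F_simps [simp]: "carrier F = Collect fractional" "monoid.mult F = (**)" "one F = \<O>"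
  by (auto simp: fractional_ideal_group_def fractional_ideals_iff)

lemma Pr_eq: "Pr = {(*) a ` \<O> | a. a \<in> L \<and> a \<noteq> 0}"
  by (auto simp: principal_fractional_ideals_def)

lemma Pr_iff: "I \<in> Pr \<longleftrightarrow> (\<exists>a\<in>L. a \<noteq> 0 \<and> I = (*) a ` \<O>)"
  by (auto simp: Pr_eq)

lemma comm_monoid_F: "Group.comm_monoid F"
  by (rule comm_monoidI)
     (simp_all add: fractional_iprod fractional_O iprod_assoc O_iprod fractional_osub, rule iprod_comm)

text \<open>Describes an ideal class by scaling alone, so that classes can be compared while
  \<open>F\<close> is only known to be a monoid.\<close>

lemma coset_F: "osub I \<Longrightarrow> Pr #>\<^bsub>F\<^esub> I = {(*) a ` I | a. a \<in> L \<and> a \<noteq> 0}"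
  by (auto simp: r_coset_def Pr_eq scale_O_iprod)

end

section \<open>Class groups of finite order\<close>

locale finite_class_number = number_field +
  assumes class_number_pos: "class_number L > 0"
begin

lemma finite_class_group: "finite (carrier (class_group L))"
  using class_number_pos unfolding class_number_def Coset.order_def by (rule card_ge_0_finite)

text \<open>Finiteness of the class group puts two powers of \<open>A\<close> into the same class, and Nakayama's lemma
  allows cancelling the smaller one.\<close>

lemma inverse_fractional_exists:
  assumes A: "fractional A"
  obtains J where "fractional J" "J ** A = \<O>"
proof -
  interpret F: Group.comm_monoid F by (rule comm_monoid_F)
  have pow: "fractional (A [^]\<^bsub>F\<^esub> (n::nat))" for n
    using F.nat_pow_closed[of A n] A by simp
  have "range (\<lambda>n::nat. Pr #>\<^bsub>F\<^esub> (A [^]\<^bsub>F\<^esub> n)) \<subseteq> carrier (class_group L)"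
    using pow by (auto simp: class_group_def FactGroup_def RCOSETS_def)
  then have "\<not> inj (\<lambda>n::nat. Pr #>\<^bsub>F\<^esub> (A [^]\<^bsub>F\<^esub> n))"
    using finite_class_group finite_subset range_inj_infinite by blast
  then obtain i j where "i \<noteq> (j::nat)" "Pr #>\<^bsub>F\<^esub> (A [^]\<^bsub>F\<^esub> i) = Pr #>\<^bsub>F\<^esub> (A [^]\<^bsub>F\<^esub> j)"
    by (auto simp: inj_def)
  then obtain i j where ij: "i < (j::nat)" "Pr #>\<^bsub>F\<^esub> (A [^]\<^bsub>F\<^esub> i) = Pr #>\<^bsub>F\<^esub> (A [^]\<^bsub>F\<^esub> j)"
    by (metis nat_neq_iff)
  have "A [^]\<^bsub>F\<^esub> i \<in> {(*) a ` (A [^]\<^bsub>F\<^esub> i) | a. a \<in> L \<and> a \<noteq> 0}"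
    using one_closed scale_one[of "A [^]\<^bsub>F\<^esub> i"] by (intro CollectI exI[of _ 1]) simp
  also have "\<dots> = {(*) a ` (A [^]\<^bsub>F\<^esub> j) | a. a \<in> L \<and> a \<noteq> 0}"
    using ij(2) coset_F[OF fractional_osub[OF pow[of i]]] coset_F[OF fractional_osub[OF pow[of j]]] by simp
  finally obtain a where a: "a \<in> L" "a \<noteq> 0" "A [^]\<^bsub>F\<^esub> i = (*) a ` (A [^]\<^bsub>F\<^esub> j)" by blast
  \<comment> \<open>One factor \<open>A\<close> is held back: cancelling \<open>A ^ i\<close> leaves
    a multiple of \<open>A ^ (m + 1)\<close> equal to \<open>\<O>\<close>, so the same multiple of
    \<open>A ^ m\<close> is the inverse of \<open>A\<close>.\<close>
  define m where "m = j - i - 1"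
  have j: "j = i + Suc m" using ij by (simp add: m_def)
  define B where "B = (*) a ` (A [^]\<^bsub>F\<^esub> Suc m)"
  have "A [^]\<^bsub>F\<^esub> i = A [^]\<^bsub>F\<^esub> i ** B"
  proof -
    have "A [^]\<^bsub>F\<^esub> i = (*) a ` (A [^]\<^bsub>F\<^esub> Suc m ** A [^]\<^bsub>F\<^esub> i)"
      using a(3) A unfolding j by (simp only: F.nat_pow_mult[symmetric] F_simps mem_Collect_eq iprod_comm)
    then show ?thesis unfolding B_def by (metis scale_iprod iprod_comm)
  qed
  then have "B = \<O>"
    by (intro iprod_cancel_self[OF pow]) (auto simp only: B_def intro!: fractional_scale pow a)
  then have "((*) a ` (A [^]\<^bsub>F\<^esub> m)) ** A = \<O>"
    by (simp add: B_def scale_iprod)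
  then show ?thesis using that fractional_scale[OF pow a(1,2)] by blast
qed

lemma comm_group_F: "comm_group F"
proof (rule comm_groupI)
  fix x assume "x \<in> carrier F"
  then show "\<exists>y\<in>carrier F. y \<otimes>\<^bsub>F\<^esub> x = \<one>\<^bsub>F\<^esub>"
    using inverse_fractional_exists[of x] by (metis F_simps mem_Collect_eq)
qed (simp_all add: fractional_iprod fractional_O iprod_assoc O_iprod fractional_osub, rule iprod_comm)

sublocale FG: comm_group F by (rule comm_group_F)

lemma subgroup_Pr: "subgroup Pr F"
proof (rule FG.subgroupI)
  show "Pr \<subseteq> carrier F" using fractional_scale[OF fractional_O] by (auto simp: Pr_iff)
  show "Pr \<noteq> {}" using one_closed by (force simp: Pr_eq)
next
  fix I assume "I \<in> Pr"
  then obtain a where a: "a \<in> L" "a \<noteq> 0" "I = (*) a ` \<O>" by (auto simp: Pr_iff)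
  have "inv\<^bsub>F\<^esub> I = (*) (inverse a) ` \<O>"
  proof (rule FG.inv_equality)
    show "(*) (inverse a) ` \<O> \<otimes>\<^bsub>F\<^esub> I = \<one>\<^bsub>F\<^esub>"
      using a osub_scale[OF osub_O] by (simp add: scale_O_iprod scale_scale)
  qed (use a fractional_scale[OF fractional_O] inverse_closed in auto)
  then show "inv\<^bsub>F\<^esub> I \<in> Pr"
    using a inverse_closed by (auto simp: Pr_iff intro!: bexI[of _ "inverse a"])
next
  fix I J assume "I \<in> Pr" "J \<in> Pr"
  then obtain a b where a: "a \<in> L" "a \<noteq> 0" "I = (*) a ` \<O>" "b \<in> L" "b \<noteq> 0" "J = (*) b ` \<O>"
    by (auto simp: Pr_iff)
  then have "I ** J = (*) (a * b) ` \<O>"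
    using osub_scale[OF osub_O] by (simp add: scale_O_iprod scale_scale)
  then show "I \<otimes>\<^bsub>F\<^esub> J \<in> Pr" using a mult_closed[of a b] by (auto simp: Pr_iff intro!: bexI[of _ "a * b"])
qed

sublocale Prn: normal Pr F
  using FG.subgroup_imp_normal[OF subgroup_Pr] .

sublocale CG: Group.group "class_group L"
  unfolding class_group_def by (rule Prn.factorgroup_is_group)

lemma ideal_class_carrier: "fractional I \<Longrightarrow> ideal_class L I \<in> carrier (class_group L)"
  by (auto simp: ideal_class_def class_group_def FactGroup_def RCOSETS_def)

lemma ideal_class_one_iff: "fractional I \<Longrightarrow> ideal_class L I = \<one>\<^bsub>class_group L\<^esub> \<longleftrightarrow> I \<in> Pr"
  using FG.coset_join1[of Pr I] FG.coset_join2[of I Pr] subgroup_Pr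
  by (auto simp: ideal_class_def class_group_def FactGroup_def)

lemma ideal_class_pow:
  assumes "fractional I"
  shows "ideal_class L (I [^]\<^bsub>F\<^esub> (n::nat)) = ideal_class L I [^]\<^bsub>class_group L\<^esub> n"
proof (induction n)
  case 0
  then show ?case using ideal_class_one_iff[OF fractional_O] subgroup.one_closed[OF subgroup_Pr] by simp
next
  case (Suc n)
  have "I [^]\<^bsub>F\<^esub> n \<in> carrier F" using assms by (intro FG.nat_pow_closed) simp
  then show ?case
    using Suc Prn.rcos_sum[of "I [^]\<^bsub>F\<^esub> n" I] assms
    by (simp add: ideal_class_def class_group_def FactGroup_def)
qed

text \<open>The order of the class divides both \<open>n\<close> and the class number.\<close>

lemma principal_if_coprime_power_principal:
  assumes "fractional I" "I [^]\<^bsub>F\<^esub> (n::nat) \<in> Pr" "coprime n (class_number L)"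
  shows "I \<in> Pr"
proof -
  let ?c = "ideal_class L I"
  have c: "?c \<in> carrier (class_group L)" using assms ideal_class_carrier by blast
  have "fractional (I [^]\<^bsub>F\<^esub> n)" using FG.nat_pow_closed[of I n] assms by simp
  then have "?c [^]\<^bsub>class_group L\<^esub> n = \<one>\<^bsub>class_group L\<^esub>"
    using ideal_class_one_iff ideal_class_pow assms by metis
  then have "CG.ord ?c dvd n" using CG.pow_eq_id c by simp
  moreover have "CG.ord ?c dvd class_number L"
    unfolding class_number_def using CG.ord_dvd_group_order c by simp
  ultimately have "CG.ord ?c = 1" using assms(3) by (metis coprime_common_divisor_nat)
  then have "?c = \<one>\<^bsub>class_group L\<^esub>" using CG.ord_eq_1 c by simp
  then show ?thesis using ideal_class_one_iff assms by blast
qed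

lemma generate_class_group:
  assumes "Factorial_Ring.prime (class_number L)" "fractional I" "I \<notin> Pr"
    "ideal_class L I \<in> S" "S \<subseteq> carrier (class_group L)"
  shows "generate (class_group L) S = carrier (class_group L)"
proof -
  let ?H = "generate (class_group L) S"
  have H: "subgroup ?H (class_group L)" using CG.generate_is_subgroup assms by blast
  have "card ?H dvd class_number L"
    unfolding class_number_def using CG.lagrange[OF H] by (metis dvd_triv_right)
  then have "card ?H = 1 \<or> card ?H = class_number L" using assms(1) by (simp add: prime_nat_iff)
  moreover have "card ?H \<noteq> 1"
  proof
    assume "card ?H = 1"
    then obtain z where z: "?H = {z}" by (auto simp: card_1_singleton_iff)
    then show False
      using generate.incl[OF assms(4), of "class_group L"] subgroup.one_closed[OF H]
        ideal_class_one_iff assms by auto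
  qed
  ultimately have "card ?H = card (carrier (class_group L))"
    by (simp add: class_number_def Coset.order_def)
  then show ?thesis
    using card_subset_eq[OF finite_class_group] H subgroup.subset by metis
qed

end

section \<open>Linear independence of the roots of unity\<close>

text \<open>The coefficient map \<open>h\<close> is kept general because the evaluation rules are
  applied to \<open>of_rat\<close> as well as to \<open>of_int\<close>.\<close>

lemma poly_map_add:
  assumes "h 0 = 0" "\<And>a b. h (a + b) = h a + h b"
  shows "poly (map_poly h (p + r)) (x::complex) = poly (map_poly h p) x + poly (map_poly h r) x"
  by (induction p r rule: poly_induct2) (auto simp: assms map_poly_pCons algebra_simps)

lemma poly_map_smult:
  assumes "h 0 = 0" "\<And>a b. h (a * b) = h a * h b"
  shows "poly (map_poly h (smult c p)) (x::complex) = h c * poly (map_poly h p) x"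
  by (induction p) (auto simp: assms map_poly_pCons algebra_simps)

lemma poly_map_mult:
  assumes "h 0 = 0" "\<And>a b. h (a + b) = h a + h b" "\<And>a b. h (a * b) = h a * h b"
  shows "poly (map_poly h (p * r)) (x::complex) = poly (map_poly h p) x * poly (map_poly h r) x"
  by (induction p)
     (auto simp: assms map_poly_pCons poly_map_add poly_map_smult algebra_simps)

lemma poly_map_pcompose:
  assumes "h 0 = 0" "\<And>a b. h (a + b) = h a + h b" "\<And>a b. h (a * b) = h a * h b"
  shows "poly (map_poly h (pcompose p r)) (x::complex) = poly (map_poly h p) (poly (map_poly h r) x)"
  by (induction p)
     (auto simp: assms map_poly_pCons pcompose_pCons poly_map_add poly_map_mult)

definition rpoly :: "rat poly \<Rightarrow> complex \<Rightarrow> complex" where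
  "rpoly p x = poly (map_poly of_rat p) x"

lemma rpoly_simps [simp]:
  "rpoly 0 x = 0" "rpoly 1 x = 1" "rpoly (pCons a p) x = of_rat a + x * rpoly p x"
  "rpoly (p + r) x = rpoly p x + rpoly r x" "rpoly (p * r) x = rpoly p x * rpoly r x"
  "rpoly (smult c p) x = of_rat c * rpoly p x" "rpoly (pcompose p r) x = rpoly p (rpoly r x)"
  by (simp_all add: rpoly_def map_poly_pCons poly_map_add poly_map_mult poly_map_smult
      poly_map_pcompose of_rat_add of_rat_mult)

lemma rpoly_diff [simp]: "rpoly (p - r) x = rpoly p x - rpoly r x"
proof -
  have "rpoly (p - r) x + rpoly r x = rpoly p x" by (simp flip: rpoly_simps(4))
  then show ?thesis by (simp add: algebra_simps)
qed

lemma rpoly_monom [simp]: "rpoly (monom c n) x = of_rat c * x ^ n"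
  by (simp add: rpoly_def map_poly_monom poly_monom)

lemma rpoly_sum [simp]: "rpoly (sum f A) x = (\<Sum>i\<in>A. rpoly (f i) x)"
  by (induction A rule: infinite_finite_induct) auto

lemma rpoly_altdef:
  assumes "degree p < n"
  shows "rpoly p x = (\<Sum>i<n. of_rat (coeff p i) * x ^ i)"
proof -
  have "p = (\<Sum>i\<le>degree p. monom (coeff p i) i)" by (simp add: poly_as_sum_of_monoms)
  also have "\<dots> = (\<Sum>i<n. monom (coeff p i) i)"
    using assms by (intro sum.mono_neutral_left) (auto simp: coeff_eq_0)
  finally have "rpoly p x = rpoly (\<Sum>i<n. monom (coeff p i) i) x" by (rule arg_cong)
  then show ?thesis by simp
qed

lemma rat_poly_clear_denominators:
  fixes p :: "rat poly"
  obtains c e where "c \<noteq> 0" "smult (of_int c) p = map_poly of_int e"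
proof -
  have "\<exists>c e. c \<noteq> 0 \<and> smult (of_int c) p = map_poly of_int e"
  proof (induction p)
    case 0
    show ?case by (intro exI[of _ 1] exI[of _ 0]) auto
  next
    case (pCons a p)
    then obtain c e where ce: "c \<noteq> 0" "smult (of_int c) p = map_poly of_int e" by auto
    obtain n m where nm: "a = of_int n / of_int m" "m \<noteq> 0"
      by (metis quotient_of_div quotient_of_denom_pos less_irrefl surj_pair)
    have "smult (of_int (c * m)) (pCons a p) = pCons (of_int (c * n)) (smult (of_int m) (smult (of_int c) p))"
      using nm by (simp add: mult.commute)
    also have "\<dots> = map_poly of_int (pCons (c * n) (smult m e))"
      by (simp add: ce map_poly_pCons map_poly_smult)
    finally show ?case using ce nm by (intro exI[of _ "c * m"]) auto
  qed
  then show ?thesis using that by blast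
qed

lemma rpoly_of_int: "rpoly (map_poly of_int e) x = poly (map_poly of_int e) x"
  by (induction e) (simp_all add: map_poly_pCons)

section \<open>The cyclotomic field of prime conductor\<close>

locale cyclotomic =
  fixes q :: nat and g :: nat and z :: complex
  assumes prime_q: "Factorial_Ring.prime q" and odd_q: "q > 2"
    and primroot: "residue_primroot q g"
    and primitive_z: "primitive_root_of_unity q z"
begin

lemma z_pow_q: "z ^ q = 1" using primitive_z by (simp add: primitive_root_of_unity_def)

lemma z_nonzero: "z \<noteq> 0" using z_pow_q odd_q by (metis power_0_left zero_neq_one less_numeral_extra(3) not_less_zero)

lemma z_pow_mod: "z ^ (k mod q) = z ^ k"
proof -
  have "z ^ k = z ^ (q * (k div q) + k mod q)" by simp
  also have "\<dots> = z ^ (k mod q)" by (simp only: power_add power_mult z_pow_q) simp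
  finally show ?thesis by simp
qed

lemma z_pow_eq_1: "z ^ k = 1 \<longleftrightarrow> q dvd k"
proof
  assume "z ^ k = 1"
  then have "z ^ (k mod q) = 1" by (simp add: z_pow_mod)
  moreover have "k mod q < q" using odd_q by simp
  ultimately show "q dvd k"
    using primitive_z unfolding primitive_root_of_unity_def by (metis dvd_eq_mod_eq_0 gr0I)
next
  assume "q dvd k"
  then show "z ^ k = 1" using z_pow_mod[of k] by simp
qed

lemma z_pow_cong: "[i = j] (mod q) \<Longrightarrow> z ^ i = z ^ j"
  by (metis z_pow_mod cong_def)

lemma sum_z_pow: "(\<Sum>i<q. z ^ (a * i)) = (if q dvd a then of_nat q else 0)"
proof (cases "q dvd a")
  case True
  then have "z ^ (a * i) = 1" for i by (simp add: z_pow_eq_1)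
  then show ?thesis using True by simp
next
  case False
  then have "z ^ a \<noteq> 1" by (simp add: z_pow_eq_1)
  moreover have "(z ^ a) ^ q = 1" by (metis mult.commute power_mult z_pow_q power_one)
  ultimately have "(\<Sum>i<q. (z ^ a) ^ i) = 0" by (simp add: geometric_sum)
  then show ?thesis using False by (simp add: power_mult)
qed

lemma algint_z: "algebraic_int z"
  using algebraic_int_root[of 1 "monom 1 q" z] odd_q z_pow_q
  by (auto simp: poly_monom degree_monom_eq)

lemma algint_z_pow: "algebraic_int (z ^ k)" using algint_z by auto

text \<open>The factorization of \<open>1 + X + ... + X ^ (q - 1)\<close> into linear factors,
  evaluated at 1. Both sides are monic of degree \<open>q - 1\<close>, so their difference has
  smaller degree and yet vanishes at \<open>q - 1\<close> distinct powers of
  \<open>z\<close>.\<close>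

lemma prod_one_minus_z: "(\<Prod>i\<in>{1..<q}. 1 - z ^ i) = of_nat q"
proof -
  let ?P = "\<Sum>i<q. monom (1::complex) i" and ?Q = "\<Prod>i\<in>{1..<q}. [:- (z ^ i), 1:]"
  have deg: "degree ?Q = q - 1" by (subst degree_prod_eq_sum_degree) auto
  have "lead_coeff ?Q = 1" by (simp add: lead_coeff_prod)
  then have lead: "coeff ?Q (q - 1) = 1" unfolding deg .
  have "?P = ?Q"
  proof (rule ccontr)
    assume neq: "?P \<noteq> ?Q"
    have coeffP: "coeff ?P j = (if j < q then 1 else 0)" for j
      by (simp add: coeff_sum coeff_monom if_distrib cong: if_cong)
    have degP: "degree ?P \<le> q - 1"
      by (rule degree_le) (use coeffP in auto)
    have "degree (?P - ?Q) \<le> q - 1" by (rule degree_diff_le) (use deg degP in auto)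
    moreover have "coeff (?P - ?Q) (q - 1) = 0" using coeffP lead odd_q by simp
    ultimately have lt: "degree (?P - ?Q) < q - 1"
      using neq odd_q by (metis coeff_0_degree_minus_1 eq_iff_diff_eq_0 le_neq_implies_less leading_coeff_0_iff)
    have "(\<lambda>i. z ^ i) ` {1..<q} \<subseteq> {x. poly (?P - ?Q) x = 0}"
    proof safe
      fix i assume i: "i \<in> {1..<q}"
      then have "poly ?P (z ^ i) = 0"
        using sum_z_pow[of i] by (simp add: poly_sum poly_monom power_mult[symmetric] nat_dvd_not_less)
      moreover have "poly ?Q (z ^ i) = 0" using i by (auto simp: poly_prod)
      ultimately show "poly (?P - ?Q) (z ^ i) = 0" by simp
    qed
    moreover have "inj_on (\<lambda>i. z ^ i) {1..<q}"
    proof (rule linorder_inj_onI)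
      fix i j assume "i < j" "i \<in> {1..<q}" "j \<in> {1..<q}"
      then have "z ^ (j - i) \<noteq> 1" by (simp add: z_pow_eq_1 nat_dvd_not_less)
      moreover have "z ^ j = z ^ i * z ^ (j - i)" using \<open>i < j\<close> by (simp flip: power_add)
      ultimately show "z ^ i \<noteq> z ^ j" using z_nonzero by auto
    qed auto
    then have "card ((\<lambda>i. z ^ i) ` {1..<q}) = q - 1" by (simp add: card_image)
    moreover have "finite {x. poly (?P - ?Q) x = 0}" using neq by (intro poly_roots_finite) simp
    ultimately have "q - 1 \<le> card {x. poly (?P - ?Q) x = 0}" by (metis card_mono)
    also have "\<dots> \<le> degree (?P - ?Q)" using neq by (intro card_poly_roots_bound) auto
    finally show False using lt by simp
  qed
  then have "poly ?P 1 = poly ?Q 1" by simp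
  then show ?thesis by (simp add: poly_sum poly_prod poly_monom)
qed

text \<open>Each \<open>1 - z ^ i\<close> with \<open>0 < i < q\<close> is associated to
  \<open>1 - z\<close>: one quotient is a geometric sum in \<open>z\<close>, and the other is a
  geometric sum in \<open>z ^ i\<close>, of which \<open>z\<close> is a power. Multiplying over all
  \<open>i\<close> compares \<open>(1 - z) ^ (q - 1)\<close> with \<open>q\<close>.\<close>

lemma lambda_power:
  obtains u v where "algebraic_int u" "algebraic_int v"
    "of_nat q = (1 - z) ^ (q - 1) * u" "(1 - z) ^ (q - 1) = of_nat q * v"
proof -
  have 1: "\<exists>u. algebraic_int u \<and> 1 - z ^ i = (1 - z) * u" for i
    by (rule exI[of _ "\<Sum>j<i. z ^ j"]) (auto simp: one_diff_power_eq intro: algint_z_pow)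
  have 2: "\<exists>u. algebraic_int u \<and> 1 - z = (1 - z ^ i) * u" if "i \<in> {1..<q}" for i
  proof -
    have "coprime i q"
      using that prime_q by (metis atLeastLessThan_iff coprime_commute nat_dvd_not_less not_one_le_zero
          prime_imp_coprime zero_less_iff_neq_zero)
    then obtain j where j: "[i * j = 1] (mod q)" using cong_solve_coprime_nat by auto
    have "1 - z = 1 - (z ^ i) ^ j" using z_pow_cong[OF j] by (simp add: power_mult)
    also have "\<dots> = (1 - z ^ i) * (\<Sum>k<j. (z ^ i) ^ k)" by (rule one_diff_power_eq)
    finally show ?thesis using algint_z by (intro exI[of _ "\<Sum>k<j. (z ^ i) ^ k"]) auto
  qed
  obtain u where u: "\<And>i. algebraic_int (u i)" "\<And>i. 1 - z ^ i = (1 - z) * u i"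
    using 1 by metis
  obtain v where v: "\<And>i. i \<in> {1..<q} \<Longrightarrow> algebraic_int (v i)"
      "\<And>i. i \<in> {1..<q} \<Longrightarrow> 1 - z = (1 - z ^ i) * v i"
    using 2 by metis
  have "of_nat q = (1 - z) ^ (q - 1) * prod u {1..<q}"
    unfolding prod_one_minus_z[symmetric] u(2) by (simp add: prod.distrib)
  moreover have "(\<Prod>i\<in>{1..<q}. 1 - z) = (\<Prod>i\<in>{1..<q}. (1 - z ^ i) * v i)"
    using v(2) by (intro prod.cong refl)
  then have "(1 - z) ^ card {1..<q} = of_nat q * prod v {1..<q}"
    by (simp only: prod.distrib prod_one_minus_z prod_constant)
  then have "(1 - z) ^ (q - 1) = of_nat q * prod v {1..<q}" by simp
  ultimately show ?thesis using u v that[of "prod u {1..<q}" "prod v {1..<q}"] by blast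
qed

lemma lambda_nonzero: "1 - z \<noteq> 0"
  using z_pow_eq_1[of 1] odd_q by auto

text \<open>Eisenstein's argument in disguise: \<open>q\<close> is totally ramified, with \<open>\<lambda> = 1 - z\<close> a uniformizer.\<close>

lemma q_dvd_coeffs:
  assumes "degree e + k \<le> q - 2" "algebraic_int w"
    "(1 - z) ^ k * poly (map_poly of_int e) (1 - z) = of_nat q * w"
  shows "int q dvd coeff e i"
  using assms
proof (induction e arbitrary: k w i)
  case 0
  then show ?case by simp
next
  case (pCons c e)
  define l where "l = 1 - z"
  define E where "E = poly (map_poly of_int e) l"
  have l0: "l \<noteq> 0" using lambda_nonzero by (simp add: l_def)
  have alg_l: "algebraic_int l" using algint_z by (auto simp: l_def int_imp_algebraic_int)
  have alg_E: "algebraic_int E"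
    unfolding E_def by (induction e) (use alg_l in \<open>auto simp: map_poly_pCons\<close>)
  obtain u v where uv: "algebraic_int u" "algebraic_int v" "of_nat q = l ^ (q - 1) * u"
      "l ^ (q - 1) = of_nat q * v"
    using lambda_power unfolding l_def by blast
  have eq: "l ^ k * (of_int c + l * E) = of_nat q * w"
    using pCons.prems by (simp add: map_poly_pCons l_def E_def)
  have k: "k \<le> q - 2" using pCons.prems by simp
  \<comment> \<open>As \<open>k \<le> q - 2\<close>, both terms on the right still contain
    \<open>l ^ (k + 1)\<close>; cancelling \<open>l ^ k\<close> shows that \<open>l\<close> divides
    the lowest coefficient \<open>c\<close>.\<close>
  have "l ^ k * of_int c = l ^ (q - 1) * u * w - l ^ Suc k * E"
    using eq uv(3) by (simp add: algebra_simps)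
  also have "l ^ (q - 1) = l ^ k * (l * l ^ (q - 2 - k))"
  proof -
    have "q - 1 = k + Suc (q - 2 - k)" using k odd_q by simp
    then show ?thesis by (simp only: power_add power_Suc)
  qed
  finally have "l ^ k * of_int c = l ^ k * (l * (l ^ (q - 2 - k) * u * w - E))"
    by (simp add: algebra_simps)
  then have c: "of_int c = l * (l ^ (q - 2 - k) * u * w - E)" using l0 by simp
  define t where "t = l ^ (q - 2 - k) * u * w - E"
  have alg_t: "algebraic_int t" using alg_l alg_E uv pCons.prems unfolding t_def by blast
  \<comment> \<open>Divisibility of \<open>c\<close> by \<open>l\<close> becomes divisibility by
    \<open>q\<close> after taking the power \<open>q - 1\<close>; the quotient is rational and
    integral, so the divisibility already holds among the integers.\<close>
  have "of_int (c ^ (q - 1)) = of_nat q * (v * t ^ (q - 1))"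
    using c unfolding t_def[symmetric]
    by (simp only: of_int_power power_mult_distrib uv(4) mult.assoc)
  then have "of_int (c ^ (q - 1)) / of_nat q = v * t ^ (q - 1)" using odd_q by simp
  moreover have "algebraic_int (v * t ^ (q - 1))" using alg_t uv by blast
  moreover have "of_int (c ^ (q - 1)) / of_nat q \<in> (\<rat> :: complex set)" by auto
  ultimately obtain m where "of_int (c ^ (q - 1)) / of_nat q = (of_int m :: complex)"
    by (metis rational_algebraic_int_is_int Ints_cases)
  then have "(of_int (c ^ (q - 1)) :: complex) = of_int (m * int q)"
    using odd_q by (simp add: field_simps)
  then have "int q dvd c ^ (q - 1)" by (metis dvd_triv_right of_int_eq_iff)
  then have qc: "int q dvd c"
    using prime_q by (metis prime_dvd_power prime_int_nat_transfer prime_nat_int_transfer)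
  then obtain c' where c': "c = int q * c'" by blast
  have coe: "int q dvd coeff e j" for j
  proof (cases "e = 0")
    case False
    \<comment> \<open>Dropping \<open>c\<close> lowers the degree by one and gains one factor
      \<open>l\<close>, which preserves the bound. This is why the statement carries the factor
      \<open>(1 - z) ^ k\<close>.\<close>
    have "degree e + Suc k \<le> q - 2" using pCons.prems False by simp
    moreover have "l ^ Suc k * E = of_nat q * (w - l ^ k * of_int c')"
      using eq by (simp add: c' algebra_simps)
    moreover have "algebraic_int (w - l ^ k * of_int c')" using alg_l pCons.prems by blast
    ultimately show ?thesis using pCons.IH[of "Suc k" "w - l ^ k * of_int c'" j]
      by (simp add: l_def E_def)
  qed auto
  show ?case using qc coe by (simp add: coeff_pCons split: nat.splits)
qed

text \<open>A primitive polynomial cannot have all its coefficients divisible by \<open>q\<close>.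
  Substituting \<open>1 - X\<close> rewrites the relation in powers of \<open>1 - z\<close>, where
  \<open>q_dvd_coeffs\<close> applies; being an involution, the substitution carries the
  divisibility back.\<close>

lemma int_independent:
  assumes "degree e \<le> q - 2" "poly (map_poly of_int e) z = 0"
  shows "e = 0"
proof (rule ccontr)
  assume e: "e \<noteq> 0"
  define p where "p = primitive_part e"
  define d where "d = pcompose p [:1, -1:]"
  have "of_int (content e) * poly (map_poly of_int p) z = 0"
    using assms(2) poly_map_smult[of of_int "content e" p z] by (simp add: p_def)
  then have "poly (map_poly of_int p) z = 0" using e by simp
  then have "poly (map_poly of_int d) (1 - z) = 0"
    by (simp add: d_def poly_map_pcompose map_poly_pCons)
  moreover have "degree d = degree p" unfolding d_def by (simp add: degree_pcompose)
  ultimately have "int q dvd coeff d i" for i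
    using assms(1) by (intro q_dvd_coeffs[of d 0 0]) (auto simp: p_def)
  then have "[:int q:] dvd d" by (simp add: const_poly_dvd_iff)
  then obtain r where r: "d = [:int q:] * r" by blast
  have "pcompose [:1, -1:] [:1, -1:] = ([:0, 1:] :: int poly)" by (simp add: pcompose_pCons)
  then have "p = pcompose d [:1, -1:]" by (simp add: d_def pcompose_assoc[symmetric])
  also have "\<dots> = [:int q:] * pcompose r [:1, -1:]" by (simp add: r pcompose_mult pcompose_smult)
  finally have "[:int q:] dvd p" by (rule dvdI)
  then have "int q dvd content p" by (simp only: const_poly_dvd_iff_dvd_content)
  then show False using e odd_q by (simp add: p_def)
qed

lemma rat_independent:
  assumes "degree p < q - 1" "rpoly p z = 0"
  shows "p = 0"
proof -
  obtain c e where ce: "c \<noteq> 0" "smult (of_int c) p = map_poly of_int e"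
    using rat_poly_clear_denominators .
  have "degree e = degree p"
    using ce by (metis degree_map_poly degree_smult_eq of_int_eq_0_iff)
  moreover have "poly (map_poly of_int e) z = 0"
    using arg_cong[OF ce(2), of "\<lambda>p. rpoly p z"] assms by (simp add: rpoly_of_int)
  ultimately have "e = 0" using int_independent assms by simp
  then show ?thesis using ce by simp
qed

text \<open>The cyclotomic polynomial of the prime \<open>q\<close>. Reduction modulo it brings
  every polynomial into the degree range of \<open>rat_independent\<close>.\<close>

definition Phi :: "rat poly" where "Phi = (\<Sum>i<q. monom 1 i)"

lemma coeff_Phi: "coeff Phi j = (if j < q then 1 else 0)"
  by (simp add: Phi_def coeff_sum coeff_monom if_distrib cong: if_cong)

lemma degree_Phi: "degree Phi = q - 1"
proof (rule antisym)
  show "degree Phi \<le> q - 1" by (rule degree_le) (auto simp: coeff_Phi)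
  show "q - 1 \<le> degree Phi" using odd_q by (intro le_degree) (auto simp: coeff_Phi)
qed

lemma Phi_nonzero: "Phi \<noteq> 0" using coeff_Phi[of 0] odd_q by auto

lemma rpoly_Phi: "\<not> q dvd a \<Longrightarrow> rpoly Phi (z ^ a) = 0"
  using sum_z_pow[of a] by (simp add: Phi_def power_mult)

lemma degree_mod_Phi: "degree (p mod Phi) < q - 1"
  using degree_mod_less[OF Phi_nonzero, of p] odd_q by (auto simp: degree_Phi)

lemma not_q_dvd_1: "\<not> q dvd 1" using odd_q by auto

lemma rpoly_mod_Phi: "\<not> q dvd a \<Longrightarrow> rpoly (p mod Phi) (z ^ a) = rpoly p (z ^ a)"
proof -
  assume "\<not> q dvd a"
  then have "rpoly Phi (z ^ a) = 0" by (rule rpoly_Phi)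
  moreover have "rpoly (Phi * (p div Phi) + p mod Phi) (z ^ a) = rpoly p (z ^ a)"
    by (simp only: mult_div_mod_eq)
  ultimately show ?thesis by (simp only: rpoly_simps) simp
qed

text \<open>By independence a polynomial vanishing at \<open>z\<close> is a multiple of
  \<open>Phi\<close>, and \<open>Phi\<close> vanishes at all conjugates.\<close>

lemma rpoly_conjugate:
  assumes "rpoly p z = 0" "\<not> q dvd a"
  shows "rpoly p (z ^ a) = 0"
proof -
  have "rpoly (p mod Phi) z = 0" using rpoly_mod_Phi[OF not_q_dvd_1] assms by simp
  then have "p mod Phi = 0" using rat_independent degree_mod_Phi by blast
  then show ?thesis using rpoly_mod_Phi[OF assms(2), of p] by simp
qed

definition L where L_def: "L = rat_adjoin z"

text \<open>The cofactor of \<open>gcd p Phi\<close> in \<open>Phi\<close> vanishes at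
  \<open>z\<close>, so by independence it has the full degree \<open>q - 1\<close> and the gcd is
  constant. The Bezout identity, evaluated at \<open>z\<close>, then gives the inverse.\<close>

lemma inverse_rpoly:
  assumes "rpoly p z \<noteq> 0"
  shows "\<exists>r. inverse (rpoly p z) = rpoly r z"
proof -
  obtain h where h: "Phi = gcd p Phi * h" by (metis dvdE gcd_dvd2)
  obtain h' where h': "p = gcd p Phi * h'" by (metis dvdE gcd_dvd1)
  have "rpoly (gcd p Phi) z \<noteq> 0" using assms arg_cong[OF h', of "\<lambda>p. rpoly p z"] by auto
  moreover have "rpoly (gcd p Phi) z * rpoly h z = 0"
    using arg_cong[OF h, of "\<lambda>p. rpoly p z"] rpoly_Phi[OF not_q_dvd_1] by simp
  ultimately have "rpoly h z = 0" by simp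
  moreover have h0: "h \<noteq> 0" using h Phi_nonzero by auto
  ultimately have "degree h \<ge> q - 1" using rat_independent by (meson not_le)
  moreover have "gcd p Phi \<noteq> 0" using Phi_nonzero by simp
  then have "degree (gcd p Phi) + degree h = q - 1"
    using arg_cong[OF h, of degree] h0 by (simp add: degree_mult_eq degree_Phi)
  ultimately have "degree (gcd p Phi) = 0" by simp
  then have "is_unit (gcd p Phi)" using \<open>gcd p Phi \<noteq> 0\<close> is_unit_iff_degree by blast
  then have "gcd p Phi = 1" by (metis is_unit_normalize normalize_gcd)
  then have "fst (bezout_coefficients p Phi) * p + snd (bezout_coefficients p Phi) * Phi = 1"
    using bezout_coefficients_fst_snd[of p Phi] by simp
  from arg_cong[OF this, of "\<lambda>p. rpoly p z"]
  have "rpoly (fst (bezout_coefficients p Phi)) z * rpoly p z = 1"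
    using rpoly_Phi[OF not_q_dvd_1] by simp
  then show ?thesis by (metis inverse_unique mult.commute)
qed

end

section \<open>Galois action on the cyclotomic field\<close>

lemma complex_ring_uminus: "\<ominus>\<^bsub>complex_ring\<^esub> x = - x"
proof -
  interpret field complex_ring by (rule field_from_type_algebra)
  show ?thesis by (rule minus_equality) auto
qed

lemma complex_ring_inverse: "x \<noteq> 0 \<Longrightarrow> inv\<^bsub>complex_ring\<^esub> x = inverse x"
proof -
  assume "x \<noteq> 0"
  interpret field complex_ring by (rule field_from_type_algebra)
  show ?thesis using \<open>x \<noteq> 0\<close> by (intro comm_inv_char) auto
qed

lemma rat_adjoin_closed:
  "1 \<in> rat_adjoin a" "a \<in> rat_adjoin a" "x \<in> rat_adjoin a \<Longrightarrow> - x \<in> rat_adjoin a"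
  "x \<in> rat_adjoin a \<Longrightarrow> inverse x \<in> rat_adjoin a"
  "x \<in> rat_adjoin a \<Longrightarrow> y \<in> rat_adjoin a \<Longrightarrow> x + y \<in> rat_adjoin a"
  "x \<in> rat_adjoin a \<Longrightarrow> y \<in> rat_adjoin a \<Longrightarrow> x * y \<in> rat_adjoin a"
  unfolding rat_adjoin_def
  using generate_field.one[of complex_ring "{a}"] generate_field.incl[of a "{a}" complex_ring]
    generate_field.a_inv[of x complex_ring "{a}"] generate_field.m_inv[of x complex_ring "{a}"]
    generate_field.eng_add[of x complex_ring "{a}" y] generate_field.eng_mult[of x complex_ring "{a}" y]
  by (cases "x = 0"; simp add: complex_ring_uminus complex_ring_inverse)+

lemma of_rat_in_rat_adjoin: "of_rat r \<in> rat_adjoin a"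
proof -
  have 0: "0 \<in> rat_adjoin a" using rat_adjoin_closed(5)[OF rat_adjoin_closed(1) rat_adjoin_closed(3)[OF rat_adjoin_closed(1)]] by simp
  have n: "of_nat n \<in> rat_adjoin a" for n
    by (induction n) (auto intro: 0 rat_adjoin_closed)
  have i: "of_int n \<in> rat_adjoin a" for n
    using n[of "nat n"] rat_adjoin_closed(3)[OF n[of "nat (- n)"]] by (cases "n \<ge> 0") auto
  show ?thesis
    by (cases r) (auto simp: of_rat_rat divide_inverse intro: rat_adjoin_closed i)
qed

lemma rat_adjoin_subset:
  assumes "a \<in> S" "1 \<in> S" "\<And>x. x \<in> S \<Longrightarrow> - x \<in> S" "\<And>x. x \<in> S \<Longrightarrow> x \<noteq> 0 \<Longrightarrow> inverse x \<in> S"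
    "\<And>x y. x \<in> S \<Longrightarrow> y \<in> S \<Longrightarrow> x + y \<in> S" "\<And>x y. x \<in> S \<Longrightarrow> y \<in> S \<Longrightarrow> x * y \<in> S"
  shows "rat_adjoin a \<subseteq> S"
proof
  fix x assume "x \<in> rat_adjoin a"
  then show "x \<in> S" unfolding rat_adjoin_def
    by (induction rule: generate_field.induct)
       (use assms in \<open>auto simp: complex_ring_uminus complex_ring_inverse\<close>)
qed

lemma rpoly_uminus: "rpoly (- p) x = - rpoly p x"
  by (metis diff_0 rpoly_diff rpoly_simps(1))

lemma sum_periodic_shift:
  fixes f :: "nat \<Rightarrow> 'a::ab_group_add"
  assumes "\<And>k. f (k + m) = f k"
  shows "(\<Sum>k<m. f (k + l)) = (\<Sum>k<m. f k)"
proof (induction l)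
  case (Suc l)
  have "(\<Sum>k<m. f (Suc k + l)) + f l = (\<Sum>k<Suc m. f (k + l))"
    by (subst sum.lessThan_Suc_shift) (simp add: add.commute)
  also have "\<dots> = (\<Sum>k<m. f (k + l)) + f l"
    using assms[of l] by (simp add: add.commute)
  finally have "(\<Sum>k<m. f (Suc k + l)) + f l = (\<Sum>k<m. f (k + l)) + f l" .
  then show ?case using Suc by simp
qed simp

context cyclotomic
begin

lemma L_eq: "L = range (\<lambda>p. rpoly p z)"
proof
  show "L \<subseteq> range (\<lambda>p. rpoly p z)"
    unfolding L_def
  proof (rule rat_adjoin_subset)
    show "z \<in> range (\<lambda>p. rpoly p z)" by (rule range_eqI[of _ _ "[:0,1:]"]) simp
    show "1 \<in> range (\<lambda>p. rpoly p z)" by (rule range_eqI[of _ _ 1]) simp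
  next
    fix x assume "x \<in> range (\<lambda>p. rpoly p z)"
    then obtain p where p: "x = rpoly p z" by auto
    show "- x \<in> range (\<lambda>p. rpoly p z)"
      by (rule range_eqI[of _ _ "- p"]) (simp add: p rpoly_uminus)
    show "inverse x \<in> range (\<lambda>p. rpoly p z)" if "x \<noteq> 0"
      using inverse_rpoly[of p] that by (auto simp: p)
    fix y assume "y \<in> range (\<lambda>p. rpoly p z)"
    then obtain r where r: "y = rpoly r z" by auto
    show "x + y \<in> range (\<lambda>p. rpoly p z)" by (rule range_eqI[of _ _ "p + r"]) (simp add: p r)
    show "x * y \<in> range (\<lambda>p. rpoly p z)" by (rule range_eqI[of _ _ "p * r"]) (simp add: p r)
  qed
  show "range (\<lambda>p. rpoly p z) \<subseteq> L"
  proof safe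
    fix p show "rpoly p z \<in> L"
      unfolding L_def
      by (induction p) (auto intro: rat_adjoin_closed of_rat_in_rat_adjoin[of 0, simplified] of_rat_in_rat_adjoin)
  qed
qed

lemma L_cases:
  assumes "x \<in> L" obtains p where "x = rpoly p z"
  using assms by (auto simp: L_eq)

lemma rpoly_in_L: "rpoly p z \<in> L" by (auto simp: L_eq)

lemma rpoly_pow_in_L: "rpoly p (z ^ k) \<in> L"
  using rpoly_in_L[of "pcompose p (monom 1 k)"] by simp

lemma coprime_g: "coprime q (g ^ k)"
  using primroot by (simp add: residue_primroot_def)

lemma not_dvd_g_pow: "\<not> q dvd g ^ k"
  using coprime_g[of k] prime_q by (metis coprime_absorb_left not_prime_unit)

text \<open>The automorphism \<open>z \<mapsto> z ^ (g ^ k)\<close>; by \<open>rpoly_conjugate\<close> the choice of \<open>p\<close> is immaterial.\<close>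

definition gal :: "nat \<Rightarrow> complex \<Rightarrow> complex" where
  "gal k x = rpoly (SOME p. rpoly p z = x) (z ^ (g ^ k))"

lemma gal_rpoly: "gal k (rpoly p z) = rpoly p (z ^ (g ^ k))"
proof -
  define r where "r = (SOME r. rpoly r z = rpoly p z)"
  have "rpoly r z = rpoly p z" unfolding r_def by (rule someI[of _ p]) simp
  then have "rpoly (r - p) z = 0" by simp
  from rpoly_conjugate[OF this not_dvd_g_pow[of k]] show ?thesis by (simp add: gal_def r_def)
qed

lemma gal_closed: "x \<in> L \<Longrightarrow> gal k x \<in> L"
  by (elim L_cases) (simp add: gal_rpoly rpoly_pow_in_L)

lemma gal_add: "x \<in> L \<Longrightarrow> y \<in> L \<Longrightarrow> gal k (x + y) = gal k x + gal k y"
  by (elim L_cases) (simp add: gal_rpoly flip: rpoly_simps)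

lemma gal_mult: "x \<in> L \<Longrightarrow> y \<in> L \<Longrightarrow> gal k (x * y) = gal k x * gal k y"
  by (elim L_cases) (simp add: gal_rpoly flip: rpoly_simps)

lemma gal_of_rat: "gal k (of_rat r) = of_rat r"
  using gal_rpoly[of k "[:r:]"] by simp

lemma gal_simps [simp]: "gal k 0 = 0" "gal k 1 = 1" "gal k (of_int n) = of_int n" "gal k (of_nat m) = of_nat m"
  using gal_of_rat[of k 0] gal_of_rat[of k 1] gal_of_rat[of k "of_int n"] gal_of_rat[of k "of_nat m"] by simp_all

lemma gal_gal: "x \<in> L \<Longrightarrow> gal j (gal k x) = gal (j + k) x"
proof (elim L_cases)
  fix p assume x: "x = rpoly p z"
  have "gal k x = rpoly (pcompose p (monom 1 (g ^ k))) z" by (simp add: x gal_rpoly)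
  then have "gal j (gal k x) = rpoly (pcompose p (monom 1 (g ^ k))) (z ^ g ^ j)" by (simp only: gal_rpoly)
  then show ?thesis by (simp add: x gal_rpoly power_add power_mult)
qed

lemma z_pow_in_L: "z ^ k \<in> L" using rpoly_in_L[of "monom 1 k"] by simp

lemma gal_z_pow: "gal k (z ^ j) = z ^ (j * g ^ k)"
  using gal_rpoly[of k "monom 1 j"] by (simp add: power_mult mult.commute[of j])

lemma gal_0: "x \<in> L \<Longrightarrow> gal 0 x = x"
  by (elim L_cases) (simp add: gal_rpoly)

lemma g_pow_period: "[g ^ (k + (q - 1)) = g ^ k] (mod q)"
proof -
  have "[g ^ (q - 1) = 1] (mod q)"
    using fermat_theorem[OF prime_q] not_dvd_g_pow[of 1] by simp
  from cong_mult[OF cong_refl this, of "g ^ k"] show ?thesis by (simp add: power_add)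
qed

lemma gal_periodic: "x \<in> L \<Longrightarrow> gal (k + (q - 1)) x = gal k x"
  using z_pow_cong[OF g_pow_period[of k]] by (elim L_cases) (simp add: gal_rpoly)

lemma gal_periodic': "x \<in> L \<Longrightarrow> gal (k + m * (q - 1)) x = gal k x"
proof (induction m)
  case (Suc m)
  then show ?case using gal_periodic[of x "k + m * (q - 1)"] by (simp add: add_ac)
qed simp

text \<open>Exponents count modulo \<open>q - 1\<close>, where \<open>k * (q - 2)\<close> is the
  negative of \<open>k\<close>.\<close>

lemma gal_inverse: "x \<in> L \<Longrightarrow> gal (k * (q - 2)) (gal k x) = x"
proof -
  assume x: "x \<in> L"
  have "k * (q - 2) + k = 0 + k * (q - 1)" using odd_q by (cases q) (auto simp: algebra_simps Suc_diff_le)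
  then show ?thesis using gal_gal[OF x] gal_periodic'[OF x, of 0 k] gal_0[OF x] by metis
qed

lemma gal_nonzero: "x \<in> L \<Longrightarrow> x \<noteq> 0 \<Longrightarrow> gal k x \<noteq> 0"
  using gal_inverse gal_simps(1) by metis

lemma of_rat_in_L: "of_rat r \<in> L" using of_rat_in_rat_adjoin by (simp add: L_def)

lemma L_add: "x \<in> L \<Longrightarrow> y \<in> L \<Longrightarrow> x + y \<in> L" using rat_adjoin_closed by (simp add: L_def)
lemma L_mult: "x \<in> L \<Longrightarrow> y \<in> L \<Longrightarrow> x * y \<in> L" using rat_adjoin_closed by (simp add: L_def)

lemma L_sum: "(\<And>i. i \<in> A \<Longrightarrow> f i \<in> L) \<Longrightarrow> sum f A \<in> L"
  by (induction A rule: infinite_finite_induct) (use of_rat_in_L[of 0] L_add in auto)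

lemma L_prod: "(\<And>i. i \<in> A \<Longrightarrow> f i \<in> L) \<Longrightarrow> prod f A \<in> L"
  by (induction A rule: infinite_finite_induct) (use of_rat_in_L[of 1] L_mult in auto)

lemma gal_sum: "(\<And>i. i \<in> A \<Longrightarrow> f i \<in> L) \<Longrightarrow> gal k (sum f A) = (\<Sum>i\<in>A. gal k (f i))"
  by (induction A rule: infinite_finite_induct) (auto simp: gal_add L_sum)

lemma gal_prod: "(\<And>i. i \<in> A \<Longrightarrow> f i \<in> L) \<Longrightarrow> gal k (prod f A) = (\<Prod>i\<in>A. gal k (f i))"
  by (induction A rule: infinite_finite_induct) (auto simp: gal_mult L_prod)

lemma gal_of_int_poly:
  assumes "x \<in> L"
  shows "poly (map_poly of_int p) x \<in> L \<and>
    gal k (poly (map_poly of_int p) x) = poly (map_poly of_int p) (gal k x)"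
proof (induction p)
  case 0
  then show ?case using of_rat_in_L[of 0] by simp
next
  case (pCons a p)
  then show ?case using assms of_rat_in_L[of "of_int a"]
    by (auto simp: map_poly_pCons gal_add gal_mult L_add L_mult)
qed

lemma gal_algebraic_int: "x \<in> L \<Longrightarrow> algebraic_int x \<Longrightarrow> algebraic_int (gal k x)"
  using gal_of_int_poly gal_simps(1) by (metis algebraic_int_altdef_ipoly)

text \<open>The exponents \<open>g ^ k\<close> run through the nonzero residues modulo
  \<open>q\<close>, so this is the full sum of \<open>sum_z_pow\<close> without the term 1 at
  residue 0.\<close>

lemma sum_gal_z: "(\<Sum>k<q-1. z ^ (j * g ^ k)) = (if q dvd j then of_nat (q - 1) else -1)"
proof -
  have "(\<Sum>k<q-1. z ^ (j * g ^ k)) = (\<Sum>k<totient q. z ^ (j * (g ^ k mod q)))"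
    using prime_q by (intro sum.cong z_pow_cong) (auto simp: totient_prime cong_def mod_mult_right_eq)
  also have "\<dots> = (\<Sum>a\<in>totatives q. z ^ (j * a))"
    using odd_q primroot by (intro sum.reindex_bij_betw residue_primroot_is_generator) auto
  also have "totatives q = {..<q} - {0}" using prime_q by (auto simp: totatives_prime)
  also have "(\<Sum>a\<in>{..<q} - {0}. z ^ (j * a)) = (\<Sum>a<q. z ^ (j * a)) - 1"
    using odd_q by (subst sum_diff1) auto
  finally show ?thesis using odd_q by (simp add: sum_z_pow of_nat_diff)
qed

lemma L_coeffs:
  assumes "x \<in> L"
  obtains c :: "nat \<Rightarrow> rat" where "x = (\<Sum>i<q. of_rat (c i) * z ^ i)"
proof -
  obtain p where "x = rpoly p z" using assms by (elim L_cases)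
  also have "\<dots> = rpoly (p mod Phi) z" using rpoly_mod_Phi[OF not_q_dvd_1] by simp
  also have "\<dots> = (\<Sum>i<q. of_rat (coeff (p mod Phi) i) * z ^ i)"
    using degree_mod_Phi[of p] by (intro rpoly_altdef) simp
  finally show ?thesis using that by blast
qed

lemma gal_coeffs: "gal k (\<Sum>i<m. of_rat (c i) * z ^ i) = (\<Sum>i<m. of_rat (c i) * z ^ (i * g ^ k))"
  using L_mult of_rat_in_L z_pow_in_L by (simp add: gal_sum gal_mult gal_of_rat gal_z_pow)

section \<open>Traces and the denominators of integers\<close>

definition trace :: "complex \<Rightarrow> complex" where "trace x = (\<Sum>k<q-1. gal k x)"

lemma trace_coeffs:
  "trace (\<Sum>i<m. of_rat (c i) * z ^ (h i)) =
     (\<Sum>i<m. of_rat (c i) * (if q dvd h i then of_nat (q - 1) else -1))"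
proof -
  have "trace (\<Sum>i<m. of_rat (c i) * z ^ (h i)) = (\<Sum>k<q-1. \<Sum>i<m. of_rat (c i) * z ^ (h i * g ^ k))"
    unfolding trace_def
    using L_mult of_rat_in_L z_pow_in_L by (simp add: gal_sum gal_mult gal_of_rat gal_z_pow)
  also have "\<dots> = (\<Sum>i<m. of_rat (c i) * (\<Sum>k<q-1. z ^ (h i * g ^ k)))"
    by (subst sum.swap) (simp add: sum_distrib_left)
  finally show ?thesis by (simp only: sum_gal_z)
qed

lemma trace_Int:
  assumes "x \<in> L" "algebraic_int x"
  shows "trace x \<in> \<int>"
proof (rule rational_algebraic_int_is_int)
  show "algebraic_int (trace x)" unfolding trace_def using gal_algebraic_int assms by blast
  obtain c where "x = (\<Sum>i<q. of_rat (c i) * z ^ i)" using L_coeffs assms by metis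
  then show "trace x \<in> \<rat>" using trace_coeffs[of c "\<lambda>i. i" q] by (auto intro!: Rats_sum)
qed

text \<open>The trace isolates coefficients: for \<open>x * z ^ (q - i)\<close>, where
  \<open>q - i\<close> acts as the exponent \<open>-i\<close>, it is \<open>q\<close> times the
  \<open>i\<close>-th coefficient minus the sum \<open>C\<close> of all of them. Subtracting the
  same \<open>C\<close> from every coefficient does not change the value, because the powers of
  \<open>z\<close> sum to 0.\<close>

lemma q_multiple_coeffs:
  assumes "x \<in> L" "algebraic_int x"
  obtains n :: "nat \<Rightarrow> int" where "of_nat q * x = (\<Sum>i<q. of_int (n i) * z ^ i)"
proof -
  obtain c where c: "x = (\<Sum>i<q. of_rat (c i) * z ^ i)" using L_coeffs assms by metis
  define C where "C = (\<Sum>i<q. c i)"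
  have "\<exists>m::int. of_nat q * of_rat (c i) - of_rat C = (of_int m :: complex)" if i: "i < q" for i
  proof -
    have xz: "x * z ^ (q - i) = (\<Sum>j<q. of_rat (c j) * z ^ (j + (q - i)))"
      unfolding c by (simp add: sum_distrib_right power_add mult.assoc)
    have "trace (x * z ^ (q - i)) \<in> \<int>"
      using assms algint_z by (intro trace_Int L_mult z_pow_in_L) auto
    also have "trace (x * z ^ (q - i)) =
        (\<Sum>j<q. of_rat (c j) * (if q dvd j + (q - i) then of_nat (q - 1) else -1))"
      unfolding xz by (rule trace_coeffs)
    also have "\<dots> = (\<Sum>j<q. (if j = i then of_nat q * of_rat (c j) else 0) - of_rat (c j))"
    proof (intro sum.cong refl)
      fix j assume "j \<in> {..<q}"
      then have j: "j < q" by simp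
      have "j = i" if "q dvd j + (q - i)"
      proof -
        have "[j + (q - i) + i = 0 + i] (mod q)" using that by (intro cong_add) (auto simp: cong_0_iff)
        moreover have "j + (q - i) + i = j + q" using i by simp
        ultimately have "[j = i] (mod q)" by (simp add: cong_def)
        then show ?thesis using i j by (simp add: cong_def)
      qed
      then have "q dvd j + (q - i) \<longleftrightarrow> j = i" using i by auto
      then show "of_rat (c j) * (if q dvd j + (q - i) then of_nat (q - 1) else - 1)
        = (if j = i then of_nat q * of_rat (c j) else 0) - (of_rat (c j) :: complex)"
        using odd_q by (auto simp: of_nat_diff algebra_simps)
    qed
    also have "\<dots> = of_nat q * of_rat (c i) - of_rat C"
      using i by (simp add: sum_subtractf C_def of_rat_sum)
    finally show ?thesis by (elim Ints_cases) metis
  qed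
  then obtain n :: "nat \<Rightarrow> int" where
    n: "\<And>i. i < q \<Longrightarrow> of_nat q * of_rat (c i) - of_rat C = (of_int (n i) :: complex)"
    by metis
  have "(\<Sum>i<q. of_int (n i) * z ^ i) = (\<Sum>i<q. (of_nat q * of_rat (c i) - of_rat C) * z ^ i)"
    using n by (intro sum.cong) auto
  also have "\<dots> = of_nat q * x - of_rat C * (\<Sum>i<q. z ^ (1 * i))"
    by (simp add: c algebra_simps sum_subtractf sum_distrib_left)
  also have "\<dots> = of_nat q * x" using sum_z_pow[of 1] not_q_dvd_1 by simp
  finally show ?thesis using that by metis
qed

sublocale number_field L
proof
  show "1 \<in> L" using of_rat_in_L[of 1] by simp
  show "x - y \<in> L" if "x \<in> L" "y \<in> L" for x y
    using L_add[OF that(1) L_mult[OF of_rat_in_L[of "-1"] that(2)]] by (simp add: of_rat_minus)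
  show "x * y \<in> L" if "x \<in> L" "y \<in> L" for x y using L_mult that .
  show "inverse x \<in> L" if "x \<in> L" for x using that rat_adjoin_closed by (simp add: L_def)
next
  fix x assume "x \<in> L"
  then obtain p where x: "x = rpoly p z" by (elim L_cases)
  obtain c e where ce: "c \<noteq> 0" "smult (of_int c) p = map_poly of_int e"
    using rat_poly_clear_denominators .
  have "of_int c * x = rpoly (smult (of_int c) p) z" by (simp add: x)
  also have "\<dots> = poly (map_poly of_int e) z" by (simp add: ce rpoly_of_int)
  also have "algebraic_int \<dots>" by (induction e) (use algint_z in \<open>auto simp: map_poly_pCons\<close>)
  finally show "\<exists>n::int. n \<noteq> 0 \<and> algebraic_int (of_int n * x)" using ce by blast
next
  let ?B = "(\<lambda>i. z ^ i / of_nat q) ` {..<q}"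
  have "x \<in> zspan ?B" if x: "x \<in> L" "algebraic_int x" for x
  proof -
    obtain n where n: "of_nat q * x = (\<Sum>i<q. of_int (n i) * z ^ i)" using q_multiple_coeffs x .
    then have "x = (\<Sum>i<q. of_int (n i) * z ^ i) / of_nat q" using odd_q by (simp add: field_simps)
    also have "\<dots> = (\<Sum>i<q. of_int (n i) * (z ^ i / of_nat q))"
      by (simp add: sum_divide_distrib)
    also have "\<dots> \<in> zspan ?B"
      by (intro zmod.span_sum zmod.span_scale zmod.span_base) auto
    finally show ?thesis .
  qed
  then show "\<exists>B. finite B \<and> {x \<in> L. algebraic_int x} \<subseteq> zspan B"
    by (intro exI[of _ ?B]) auto
qed

lemma gal_O: "x \<in> \<O> \<Longrightarrow> gal k x \<in> \<O>"
  by (simp add: O_def gal_closed gal_algebraic_int)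

lemma gal_diff: "x \<in> L \<Longrightarrow> y \<in> L \<Longrightarrow> gal k (x - y) = gal k x - gal k y"
  using gal_add[of "x - y" y k] diff_closed by simp

end

section \<open>The imaginary quadratic subfield\<close>

lemma sum_even_odd:
  fixes f :: "nat \<Rightarrow> 'a::comm_monoid_add"
  shows "(\<Sum>k<2*m. f k) = (\<Sum>i<m. f (2 * i)) + (\<Sum>i<m. f (2 * i + 1))"
  by (induction m) (auto simp: add_ac)

locale imaginary_quadratic =
  fixes q :: nat and w :: complex
  assumes q_pos: "q > 0" and w_def: "w = csqrt (- of_nat q)"
begin

lemma w_sq: "w ^ 2 = - of_nat q" by (simp only: w_def power2_csqrt)

lemma w_mult: "w * w = - of_nat q" using w_sq by (simp add: power2_eq_square)

lemma w_eq: "w = \<i> * sqrt q"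
  by (simp add: w_def csqrt_of_real_nonpos)

lemma cnj_w: "cnj w = - w" by (simp add: w_eq)

lemma Re_w: "Re w = 0" and Im_w: "Im w = sqrt q" by (simp_all add: w_eq)

definition quad :: "rat \<Rightarrow> rat \<Rightarrow> complex" where "quad a b = of_rat a + of_rat b * w"

lemma Re_of_rat: "Re (of_rat r) = of_rat r" and Im_of_rat: "Im (of_rat r) = 0"
  by (cases r; simp add: of_rat_rat)+

lemma cnj_quad: "cnj (quad a b) = quad a (- b)"
  by (simp add: quad_def cnj_w of_rat_minus complex_eq_iff Re_of_rat Im_of_rat)

lemma quad_ops:
  "- quad a b = quad (- a) (- b)" "quad a b + quad c d = quad (a + c) (b + d)"
  "quad a b * quad c d = quad (a * c - of_nat q * b * d) (a * d + b * c)"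
proof -
  have "quad a b * quad c d = of_rat (a * c) + of_rat (a * d + b * c) * w + of_rat (b * d) * (w * w)"
    by (simp add: quad_def of_rat_add of_rat_mult algebra_simps)
  then show "quad a b * quad c d = quad (a * c - of_nat q * b * d) (a * d + b * c)"
    unfolding w_mult by (simp add: quad_def of_rat_diff of_rat_mult)
qed (simp_all add: quad_def of_rat_add of_rat_minus algebra_simps)

lemma quad_norm: "quad a b * cnj (quad a b) = of_rat (a ^ 2 + of_nat q * b ^ 2)"
  by (simp add: cnj_quad quad_ops) (simp add: quad_def power2_eq_square)

lemma rat_adjoin_w: "rat_adjoin w = {quad a b | a b. True}"
proof
  show "rat_adjoin w \<subseteq> {quad a b | a b. True}"
  proof (rule rat_adjoin_subset)
    show "w \<in> {quad a b | a b. True}"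
      by (intro CollectI exI[of _ 0] exI[of _ 1]) (simp add: quad_def)
    show "1 \<in> {quad a b | a b. True}"
      by (intro CollectI exI[of _ 1] exI[of _ 0]) (simp add: quad_def)
    fix x assume "x \<in> {quad a b | a b. True}"
    then obtain a b where x: "x = quad a b" by auto
    show "- x \<in> {quad a b | a b. True}" by (auto simp: x quad_ops)
    show "x + y \<in> {quad a b | a b. True}" if y: "y \<in> {quad a b | a b. True}" for y
    proof -
      obtain c d where "y = quad c d" using y by auto
      then show ?thesis unfolding x by (simp only: quad_ops(2)) blast
    qed
    show "x * y \<in> {quad a b | a b. True}" if y: "y \<in> {quad a b | a b. True}" for y
    proof -
      obtain c d where "y = quad c d" using y by auto
      then show ?thesis unfolding x by (simp only: quad_ops(3)) blast
    qed
    show "inverse x \<in> {quad a b | a b. True}" if "x \<noteq> 0"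
    proof -
      define N where "N = a ^ 2 + of_nat q * b ^ 2"
      have N: "x * cnj x = of_rat N" by (simp add: x quad_norm N_def)
      then have "N \<noteq> 0" using that by auto
      have "inverse x = of_rat (inverse N) * cnj x"
      proof (rule inverse_unique)
        have "x * (of_rat (inverse N) * cnj x) = of_rat (inverse N) * (x * cnj x)" by simp
        also have "\<dots> = 1" unfolding N using \<open>N \<noteq> 0\<close> by (simp add: of_rat_inverse)
        finally show "x * (of_rat (inverse N) * cnj x) = 1" .
      qed
      also have "\<dots> = quad (inverse N) 0 * quad a (- b)"
        by (simp add: x cnj_quad) (simp add: quad_def)
      finally show ?thesis by (auto simp: quad_ops)
    qed
  qed
  show "{quad a b | a b. True} \<subseteq> rat_adjoin w"
    by (auto simp: quad_def intro: rat_adjoin_closed of_rat_in_rat_adjoin)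
qed

lemma rat_adjoin_w_cases:
  assumes "x \<in> rat_adjoin w" obtains a b where "x = quad a b"
  using assms by (auto simp: rat_adjoin_w)

text \<open>Here \<open>2 * a\<close> and \<open>- 2 * q * b\<close> are the traces to the rationals
  of the element and of its product with \<open>w\<close>, hence rational algebraic integers.
  Bounding the denominators in this way already yields finite generation.\<close>

lemma quad_integral:
  assumes "algebraic_int (quad a b)"
  obtains m k :: int where "2 * a = of_int m" "2 * of_nat q * b = of_int k"
proof -
  have 1: "algebraic_int (cnj (quad a b))" using assms by simp
  have w: "algebraic_int w" using algebraic_int_csqrt[of "- of_nat q"]
    by (simp add: w_def int_imp_algebraic_int)
  have "algebraic_int (of_rat (2 * a) :: complex)"
    using algebraic_int_add[OF assms 1] by (simp add: cnj_quad) (simp add: quad_def of_rat_mult of_rat_minus)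
  moreover have "algebraic_int (of_rat (- (2 * of_nat q * b)) :: complex)"
  proof -
    have "(quad a b - cnj (quad a b)) * w = 2 * of_rat b * (w * w)"
      by (simp add: cnj_quad) (simp add: quad_def of_rat_minus)
    also have "\<dots> = of_rat (- (2 * of_nat q * b))"
      by (simp add: w_mult of_rat_mult of_rat_minus)
    finally show ?thesis using assms 1 w by (metis algebraic_int_diff algebraic_int_mult)
  qed
  ultimately have "(of_rat (2 * a) :: complex) \<in> \<int>" "(of_rat (- (2 * of_nat q * b)) :: complex) \<in> \<int>"
    by (auto intro: rational_algebraic_int_is_int)
  then obtain m k where "(of_rat (2 * a) :: complex) = of_int m"
     "(of_rat (- (2 * of_nat q * b)) :: complex) = of_int k" by (auto elim!: Ints_cases)
  then have "(of_rat (2 * a) :: complex) = of_rat (of_int m)"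
     "(of_rat (- (2 * of_nat q * b)) :: complex) = of_rat (of_int k)" by simp_all
  then have "2 * a = of_int m" "- (2 * of_nat q * b) = of_int k" by (simp_all only: of_rat_eq_iff)
  then show ?thesis using that[of m "- k"] by (metis minus_minus of_int_minus)
qed

sublocale K: number_field "rat_adjoin w"
proof
  show "x - y \<in> rat_adjoin w" if "x \<in> rat_adjoin w" "y \<in> rat_adjoin w" for x y
    using rat_adjoin_closed(5)[OF that(1) rat_adjoin_closed(3)[OF that(2)]] by simp
next
  fix x assume "x \<in> rat_adjoin w"
  then obtain a b where x: "x = quad a b" by (elim rat_adjoin_w_cases)
  obtain n m where a: "a = of_int n / of_int m" "m > 0" by (metis quotient_of_div quotient_of_denom_pos surj_pair)
  obtain n' m' where b: "b = of_int n' / of_int m'" "m' > 0" by (metis quotient_of_div quotient_of_denom_pos surj_pair)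
  have "of_rat (of_int m * a) = (of_int n :: complex)" "of_rat (of_int m' * b) = (of_int n' :: complex)"
    using a b by simp_all
  then have ab: "of_int m * of_rat a = (of_int n :: complex)" "of_int m' * of_rat b = (of_int n' :: complex)"
    by (simp_all only: of_rat_mult of_rat_of_int_eq)
  have "of_int (m * m') * x = of_int m' * (of_int m * of_rat a) + of_int m * (of_int m' * of_rat b) * w"
    unfolding x quad_def of_int_mult by (simp only: distrib_left distrib_right mult_ac)
  then have "of_int (m * m') * x = of_int (n * m') + of_int (n' * m) * w"
    unfolding ab by (simp only: of_int_mult mult_ac)
  moreover have "algebraic_int w" using algebraic_int_csqrt[of "- of_nat q"]
    by (simp add: w_def int_imp_algebraic_int)
  then have "algebraic_int (of_int (n * m') + of_int (n' * m) * w)"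
    by (intro algebraic_int_add algebraic_int_mult algebraic_int_of_int)
  ultimately have "algebraic_int (of_int (m * m') * x)" by (simp only:)
  moreover have "m * m' \<noteq> 0" using a b by simp
  ultimately show "\<exists>n::int. n \<noteq> 0 \<and> algebraic_int (of_int n * x)" by blast
next
  let ?B = "{1 / 2, w / (2 * of_nat q)}"
  have "x \<in> zspan ?B" if x: "x \<in> rat_adjoin w" "algebraic_int x" for x
  proof -
    obtain a b where ab: "x = quad a b" using x by (elim rat_adjoin_w_cases)
    obtain m k :: int where mk: "2 * a = of_int m" "2 * of_nat q * b = of_int k"
      using quad_integral x ab by metis
    then have a: "a = of_int m / 2" and b: "b = of_int k / (2 * of_nat q)"
      using q_pos by (auto simp: field_simps)
    then have "x = of_int m * (1 / 2) + of_int k * (w / (2 * of_nat q))"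
      unfolding ab quad_def a b by (simp add: of_rat_divide of_rat_mult)
    also have "\<dots> \<in> zspan ?B" by (intro zmod.span_add zmod.span_scale zmod.span_base) auto
    finally show ?thesis .
  qed
  then show "\<exists>B. finite B \<and> {x \<in> rat_adjoin w. algebraic_int x} \<subseteq> zspan B"
    by (intro exI[of _ ?B]) auto
qed (auto intro: rat_adjoin_closed)

end

section \<open>Gaussian periods and the quadratic Gauss sum\<close>

locale cyclotomic7 = cyclotomic +
  assumes q_mod_8: "q mod 8 = 7"
begin

definition h where "h = (q - 1) div 2"

lemma q_minus_1: "q - 1 = 2 * h" using q_mod_8 unfolding h_def by presburger

lemma q_minus_Suc_0: "q - Suc 0 = 2 * h" using q_minus_1 by simp

lemma odd_h: "odd h" using q_mod_8 unfolding h_def by presburger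

text \<open>The Gaussian periods with \<open>h\<close> terms: \<open>g ^ 2\<close> generates the
  squares modulo \<open>q\<close>, so the sum runs over the squares for even \<open>k\<close> and
  over the nonsquares for odd \<open>k\<close>.\<close>

definition eta :: "nat \<Rightarrow> complex" where "eta k = (\<Sum>i<h. z ^ (g ^ (2 * i + k)))"

lemma z_g_period: "z ^ (g ^ (k + 2 * h)) = z ^ (g ^ k)"
  using z_pow_cong[OF g_pow_period[of k]] by (simp add: q_minus_Suc_0)

lemma eta_shift: "eta (k + 2) = eta k"
proof -
  have "(\<Sum>i<h. z ^ (g ^ (2 * (i + 1) + k))) = eta k"
    unfolding eta_def using z_g_period[of "2 * i + k" for i]
    by (intro sum_periodic_shift[where f = "\<lambda>i. z ^ (g ^ (2 * i + k))"]) (simp add: algebra_simps)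
  then show ?thesis by (simp add: eta_def algebra_simps)
qed

lemma eta_mod: "eta k = eta (k mod 2)"
proof (induction k rule: less_induct)
  case (less k)
  show ?case
  proof (cases "k < 2")
    case False
    then have "k = (k - 2) + 2" by simp
    then show ?thesis using less[of "k - 2"] eta_shift[of "k - 2"] False
      by (metis add_less_cancel_left diff_less less_le_trans mod_add_self2 not_le pos2 zero_less_numeral)
  qed simp
qed

lemma eta_sum: "eta 0 + eta 1 = -1"
  using sum_gal_z[of 1] sum_even_odd[of "\<lambda>k. z ^ (g ^ k)" h] not_q_dvd_1
  by (simp add: eta_def q_minus_Suc_0)

text \<open>The quadratic Gauss sum, as \<open>tau_alt\<close> makes visible.\<close>

definition tau where "tau = eta 0 - eta 1"

lemma eta_tau: "eta 0 = (- 1 + tau) / 2" "eta 1 = (- 1 - tau) / 2"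
  using eta_sum by (simp_all add: tau_def field_simps algebra_simps)

lemma eta_in_L: "eta k \<in> L" by (auto simp: eta_def intro: L_sum z_pow_in_L)

lemma gal_eta: "gal j (eta k) = eta (k + j)"
  by (simp add: eta_def gal_sum z_pow_in_L gal_z_pow flip: power_add) (simp add: add_ac)

lemma tau_in_L: "tau \<in> L" by (simp add: tau_def diff_closed eta_in_L)

lemma gal_tau: "gal (2 * k) tau = tau" "gal (2 * k + 1) tau = - tau"
  using eta_mod[of "2 * k"] eta_mod[of "Suc (2 * k)"] eta_mod[of "Suc (Suc (2 * k))"]
  by (simp_all add: tau_def gal_diff eta_in_L gal_eta)

lemma g_pow_inj: "i < q - 1 \<Longrightarrow> j < q - 1 \<Longrightarrow> [g ^ i = g ^ j] (mod q) \<Longrightarrow> i = j"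
  using residue_primroot_is_generator[OF _ primroot] odd_q prime_q
  by (auto simp: bij_betw_def inj_on_def totient_prime cong_def)

lemma g_pow_surj:
  assumes "\<not> q dvd j"
  obtains k where "[j = g ^ k] (mod q)"
proof -
  have "j mod q \<in> totatives q"
    using assms prime_q by (auto simp: totatives_prime dvd_eq_mod_eq_0 prime_gt_0_nat)
  then obtain k where "j mod q = g ^ k mod q"
    using residue_primroot_is_generator[OF _ primroot] odd_q unfolding bij_betw_def by fastforce
  then show ?thesis using that by (simp add: cong_def)
qed

text \<open>\<open>g ^ h\<close> squares to 1 without being 1, so it is -1 modulo the prime
  \<open>q\<close>; no other exponent in the range gives the same residue.\<close>

lemma dvd_g_pow_plus_1:
  assumes "d < q - 1"
  shows "q dvd g ^ d + 1 \<longleftrightarrow> d = h"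
proof -
  have h: "h < q - 1" "0 < h" using q_minus_1 odd_q by simp_all
  have "q dvd g ^ h + 1"
  proof -
    have "[g ^ h * g ^ h = 1] (mod q)"
      using g_pow_period[of 0] by (simp add: q_minus_Suc_0 mult_2 power_add)
    then have "[int (g ^ h) * int (g ^ h) = 1] (mod int q)" by (metis cong_int_iff of_nat_1 of_nat_mult)
    then have "int q dvd (int (g ^ h) - 1) * (int (g ^ h) + 1)"
      by (simp add: cong_iff_dvd_diff algebra_simps)
    then have "int q dvd int (g ^ h) - 1 \<or> int q dvd int (g ^ h) + 1"
      using prime_q by (simp add: prime_dvd_mult_iff)
    moreover have "\<not> int q dvd int (g ^ h) - 1"
    proof
      assume "int q dvd int (g ^ h) - 1"
      then have "[g ^ h = g ^ 0] (mod q)"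
        by (metis cong_iff_dvd_diff cong_int_iff of_nat_1 power_0)
      then have "h = 0" using h by (intro g_pow_inj) simp_all
      then show False using h by simp
    qed
    ultimately show ?thesis by (metis int_dvd_int_iff of_nat_1 of_nat_add)
  qed
  moreover have "d = h" if "q dvd g ^ d + 1"
  proof -
    have "[g ^ d + 1 = g ^ h + 1] (mod q)"
      using that \<open>q dvd g ^ h + 1\<close> by (simp add: cong_def dvd_eq_mod_eq_0)
    then have "[g ^ d = g ^ h] (mod q)" by (simp only: cong_add_rcancel_nat)
    then show ?thesis using g_pow_inj assms h by blast
  qed
  ultimately show ?thesis by blast
qed

lemma tau_alt: "tau = (\<Sum>k<q-1. (-1) ^ k * z ^ (g ^ k))"
  unfolding q_minus_1 sum_even_odd by (simp add: tau_def eta_def sum_negf)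

text \<open>Gauss's computation. After the substitution \<open>k = d + l\<close> the sum over
  \<open>l\<close> depends only on whether \<open>q\<close> divides \<open>g ^ d + 1\<close>, that
  is, on whether \<open>d = h\<close>. The alternating sum of the common value -1 vanishes, and
  \<open>(-1) ^ h\<close> is negative because \<open>h\<close> is odd.\<close>

lemma tau_sq: "tau ^ 2 = - of_nat q"
proof -
  have "tau ^ 2 = (\<Sum>l<q-1. \<Sum>k<q-1. (-1) ^ k * z ^ (g ^ k) * ((-1) ^ l * z ^ (g ^ l)))"
    unfolding power2_eq_square tau_alt by (simp only: sum_distrib_left sum_distrib_right)
  also have "\<dots> = (\<Sum>l<q-1. \<Sum>d<q-1. (-1) ^ (d + l) * z ^ (g ^ (d + l)) * ((-1) ^ l * z ^ (g ^ l)))"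
  proof (rule sum.cong[OF refl])
    fix l
    show "(\<Sum>k<q-1. (-1) ^ k * z ^ (g ^ k) * ((-1) ^ l * z ^ (g ^ l))) =
          (\<Sum>d<q-1. (-1) ^ (d + l) * z ^ (g ^ (d + l)) * ((-1) ^ l * z ^ (g ^ l)))"
    proof (rule sum_periodic_shift[symmetric,
        where f = "\<lambda>k. (-1) ^ k * z ^ (g ^ k) * ((-1) ^ l * z ^ (g ^ l))"])
      fix k
      have "(-1 :: complex) ^ (k + 2 * h) = (-1) ^ k" by (simp add: power_add)
      then show "(-1) ^ (k + (q - 1)) * z ^ (g ^ (k + (q - 1))) * ((-1) ^ l * z ^ (g ^ l)) =
          (-1) ^ k * z ^ (g ^ k) * ((-1) ^ l * z ^ (g ^ l))"
        by (simp only: q_minus_1 z_g_period)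
    qed
  qed
  also have "\<dots> = (\<Sum>l<q-1. \<Sum>d<q-1. (-1) ^ d * z ^ ((g ^ d + 1) * g ^ l))"
  proof (intro sum.cong refl)
    fix l d
    have "(-1) ^ (d + l) * z ^ (g ^ (d + l)) * ((-1) ^ l * z ^ (g ^ l)) =
        (-1) ^ d * ((-1) ^ l * (-1) ^ l) * (z ^ (g ^ (d + l)) * z ^ (g ^ l))"
      by (simp add: power_add)
    also have "(-1::complex) ^ l * (-1) ^ l = 1" by (simp flip: power_add)
    finally show "(-1) ^ (d + l) * z ^ (g ^ (d + l)) * ((-1) ^ l * z ^ (g ^ l)) =
        (-1) ^ d * z ^ ((g ^ d + 1) * g ^ l)"
      by (simp add: power_add algebra_simps)
  qed
  also have "\<dots> = (\<Sum>d<q-1. (-1) ^ d * (\<Sum>l<q-1. z ^ ((g ^ d + 1) * g ^ l)))"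
    by (subst sum.swap) (simp add: sum_distrib_left)
  also have "\<dots> = (\<Sum>d<q-1. (-1) ^ d * (if d = h then of_nat (q - 1) else -1))"
    by (intro sum.cong[OF refl]) (simp only: sum_gal_z dvd_g_pow_plus_1 lessThan_iff)
  also have "\<dots> = (\<Sum>d<q-1. (if d = h then (-1) ^ d * of_nat q else 0) - (-1) ^ d)"
    using odd_q by (intro sum.cong refl) (simp add: of_nat_diff algebra_simps)
  also have "\<dots> = (-1) ^ h * of_nat q - (\<Sum>d<q-1. (-1) ^ d)"
    using q_minus_1 odd_q by (simp add: sum_subtractf)
  also have "(\<Sum>d<q-1. (-1::complex) ^ d) = 0"
    unfolding q_minus_1 sum_even_odd by (simp add: sum_negf)
  finally show ?thesis using odd_h by simp
qed

text \<open>Averaging over the even exponents: a fixed \<open>x\<close> satisfies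
  \<open>h * x = (\<Sum>i<h. gal (2 * i) x)\<close>, and this sum sends every power of
  \<open>z\<close> either to \<open>h\<close> or to a Gaussian period, which is a rational
  combination of 1 and \<open>tau\<close>.\<close>

lemma gal_fixed:
  assumes "x \<in> L" "gal 2 x = x"
  obtains a b :: rat where "x = of_rat a + of_rat b * tau"
proof -
  define K where "K = {of_rat a + of_rat b * tau | a b :: rat. True}"
  have K_add: "x + y \<in> K" if "x \<in> K" "y \<in> K" for x y
  proof -
    from that obtain a b c d where "x = of_rat a + of_rat b * tau" "y = of_rat c + of_rat d * tau"
      by (auto simp: K_def)
    then have "x + y = of_rat (a + c) + of_rat (b + d) * tau" by (simp add: of_rat_add algebra_simps)
    then show ?thesis unfolding K_def by blast
  qed
  have K_scale: "of_rat r * x \<in> K" if "x \<in> K" for x r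
  proof -
    from that obtain a b where "x = of_rat a + of_rat b * tau" by (auto simp: K_def)
    then have "of_rat r * x = of_rat (r * a) + of_rat (r * b) * tau" by (simp add: of_rat_mult algebra_simps)
    then show ?thesis unfolding K_def by blast
  qed
  have K_rat: "of_rat r \<in> K" for r unfolding K_def by (intro CollectI exI[of _ r] exI[of _ 0]) simp
  have K_sum: "sum f A \<in> K" if "\<And>i. i \<in> A \<Longrightarrow> f i \<in> K" for f and A :: "nat set"
    using that by (induction A rule: infinite_finite_induct) (use K_rat[of 0] K_add in auto)
  have K_eta: "eta k \<in> K" for k
  proof -
    have "eta 0 = of_rat (- 1 / 2) + of_rat (1 / 2) * tau" "eta 1 = of_rat (- 1 / 2) + of_rat (- 1 / 2) * tau"
      unfolding eta_tau by (simp_all add: of_rat_divide of_rat_minus field_simps)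
    then have "eta 0 \<in> K" "eta 1 \<in> K" unfolding K_def by blast+
    then show ?thesis using eta_mod[of k] by (cases "even k") (auto simp: even_iff_mod_2_eq_zero odd_iff_mod_2_eq_one)
  qed
  have fix_i: "gal (2 * i) x = x" for i
  proof (induction i)
    case 0
    then show ?case using gal_0 assms by simp
  next
    case (Suc i)
    then show ?case using gal_gal[OF assms(1), of "2 * i" 2] assms(2) by (simp add: add.commute)
  qed
  obtain c where c: "x = (\<Sum>j<q. of_rat (c j) * z ^ j)" using L_coeffs assms by metis
  have zK: "(\<Sum>i<h. z ^ (j * g ^ (2 * i))) \<in> K" for j
  proof (cases "q dvd j")
    case True
    then have "z ^ (j * g ^ (2 * i)) = 1" for i by (simp add: z_pow_eq_1)
    then show ?thesis using K_rat[of "of_nat h"] by simp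
  next
    case False
    then obtain k where k: "[j = g ^ k] (mod q)" by (rule g_pow_surj)
    have "z ^ (j * g ^ (2 * i)) = z ^ (g ^ (2 * i + k))" for i
      using cong_mult[OF k cong_refl, of "g ^ (2 * i)"] by (intro z_pow_cong) (simp add: power_add mult.commute)
    then show ?thesis using K_eta[of k] by (simp add: eta_def)
  qed
  have "of_nat h * x = (\<Sum>i<h. gal (2 * i) x)" by (simp add: fix_i)
  also have "\<dots> = (\<Sum>i<h. \<Sum>j<q. of_rat (c j) * z ^ (j * g ^ (2 * i)))"
    unfolding c by (simp only: gal_coeffs)
  also have "\<dots> = (\<Sum>j<q. of_rat (c j) * (\<Sum>i<h. z ^ (j * g ^ (2 * i))))"
    by (subst sum.swap) (simp add: sum_distrib_left)
  also have "\<dots> \<in> K" by (intro K_sum K_scale zK)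
  finally have "of_rat (inverse (of_nat h)) * (of_nat h * x) \<in> K" by (rule K_scale)
  moreover have "h \<noteq> 0" using odd_h by (cases h) auto
  then have "of_rat (inverse (of_nat h)) * (of_nat h * x) = x"
    by (simp add: of_rat_inverse mult.assoc[symmetric])
  ultimately have "x \<in> K" by (simp only:)
  then show ?thesis using that by (auto simp: K_def)
qed

end

section \<open>Arithmetic modulo 2\<close>

text \<open>Lets a dimension be read off from a cardinality. Since \<open>v\<close> lies outside
  \<open>E\<close>, the decomposition of an element of the line extension is unique, and each
  dimension step multiplies the cardinality by \<open>card K\<close>.\<close>

lemma (in ring) card_dimension:
  assumes "dimension n K E" "subfield K R" "finite K"
  shows "finite E \<and> card E = card K ^ n"
  using assms
proof (induction n K E rule: dimension.induct)
  case (Suc_dim v E n K)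
  note step = Suc_dim and K = Suc_dim.prems
  note E = space_subgroup_props[OF K(1) step(3)]
  have Kc: "K \<subseteq> carrier R" using subringE(1)[OF subfieldE(1)[OF K(1)]] .
  have Kd: "k \<oplus> \<ominus> k' \<in> K" if "k \<in> K" "k' \<in> K" for k k'
    using subringE(5,7)[OF subfieldE(1)[OF K(1)]] that by blast
  have img: "line_extension K v E = (\<lambda>(k, e). k \<otimes> v \<oplus> e) ` (K \<times> E)"
    by (auto simp: line_extension_mem_iff image_iff; blast)
  have "inj_on (\<lambda>(k, e). k \<otimes> v \<oplus> e) (K \<times> E)"
  proof (rule inj_onI, clarsimp)
    fix k e k' e' assume k: "k \<in> K" "k' \<in> K" and e: "e \<in> E" "e' \<in> E" and eq: "k \<otimes> v \<oplus> e = k' \<otimes> v \<oplus> e'"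
    have c: "k \<in> carrier R" "k' \<in> carrier R" "e \<in> carrier R" "e' \<in> carrier R" using k e Kc E(1) by auto
    have "(k \<oplus> \<ominus> k') \<otimes> v = e' \<oplus> \<ominus> e"
    proof -
      have "(k \<oplus> \<ominus> k') \<otimes> v = (k \<otimes> v \<oplus> e) \<oplus> (\<ominus> (k' \<otimes> v) \<oplus> \<ominus> e)"
        using c step(1) by algebra
      also have "\<dots> = e' \<oplus> \<ominus> e" unfolding eq using c step(1) by algebra
      finally show ?thesis .
    qed
    also have "\<dots> \<in> E" using e E by blast
    finally have "k \<oplus> \<ominus> k' = \<zero>" using E(6)[of "k \<oplus> \<ominus> k'" v] Kd k step(1,2) by blast
    then have kk: "k = k'" using c r_right_minus_eq[of k k'] by (simp add: a_minus_def)
    have "k' \<otimes> v \<in> carrier R" using c step(1) by blast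
    from add.l_cancel[OF eq[unfolded kk] c(3) c(4) this] have "e = e'" .
    then show "k = k' \<and> e = e'" using kk by blast
  qed
  then show ?case unfolding img using Suc_dim.IH[OF K] K(2) by (simp add: card_image card_cartesian_product)
qed simp

lemma (in number_field) nat_pow_ring_of_integers [simp]:
  "x [^]\<^bsub>ring_of_integers L\<^esub> (n::nat) = x ^ n"
  by (induction n) (auto simp: mult.commute nat_pow_def)

lemma (in number_field) O_power: "x \<in> \<O> \<Longrightarrow> x ^ n \<in> \<O>"
  by (induction n) (auto intro: O_closed)

lemma (in number_field) O_sum: "(\<And>i. i \<in> A \<Longrightarrow> f i \<in> \<O>) \<Longrightarrow> sum f A \<in> \<O>"
  by (induction A rule: infinite_finite_induct) (auto intro: O_closed)

lemma (in number_field) O_prod: "(\<And>i. i \<in> A \<Longrightarrow> f i \<in> \<O>) \<Longrightarrow> prod f A \<in> \<O>"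
  by (induction A rule: infinite_finite_induct) (auto intro: O_closed)

definition (in number_field) cong2 :: "complex \<Rightarrow> complex \<Rightarrow> bool" where
  "cong2 x y \<longleftrightarrow> (\<exists>w\<in>\<O>. x - y = 2 * w)"

context number_field
begin

lemma cong2_refl: "cong2 x x"
  unfolding cong2_def using O_closed by (intro bexI[of _ 0]) auto

lemma cong2_sym: "cong2 x y \<Longrightarrow> cong2 y x"
  unfolding cong2_def using O_closed(6) by (metis minus_diff_eq mult_minus_right)

lemma cong2_trans: "cong2 x y \<Longrightarrow> cong2 y w \<Longrightarrow> cong2 x w"
proof -
  assume "cong2 x y" "cong2 y w"
  then obtain a b where "a \<in> \<O>" "b \<in> \<O>" "x - y = 2 * a" "y - w = 2 * b" by (auto simp: cong2_def)
  then show "cong2 x w"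
    unfolding cong2_def by (intro bexI[of _ "a + b"]) (auto simp: algebra_simps O_closed)
qed

lemma cong2_square:
  assumes "cong2 x y" "x \<in> \<O>" "y \<in> \<O>"
  shows "cong2 (x ^ 2) (y ^ 2)"
proof -
  obtain a where a: "a \<in> \<O>" "x - y = 2 * a" using assms by (auto simp: cong2_def)
  have "x ^ 2 - y ^ 2 = (x - y) * (x + y)" by (simp add: power2_eq_square algebra_simps)
  also have "\<dots> = 2 * (a * (x + y))" using a by simp
  finally show ?thesis using a assms unfolding cong2_def by (blast intro: O_closed)
qed

lemma not_half_integral: "x \<in> \<O> \<Longrightarrow> 1 \<noteq> 2 * x"
proof
  assume "x \<in> \<O>" "1 = 2 * x"
  then have "x = 1 / 2" "algebraic_int x"
    by (metis nonzero_mult_div_cancel_left zero_neq_numeral, simp add: O_def)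
  moreover have "(1 / 2 :: complex) \<in> \<rat>" by auto
  ultimately have "(1 / 2 :: complex) \<in> \<int>" using rational_algebraic_int_is_int by metis
  then obtain n where "(1 / 2 :: complex) = of_int n" by (elim Ints_cases)
  then have "(of_int 1 :: complex) = of_int (2 * n)" by (simp add: field_simps)
  then have "1 = 2 * n" by (simp only: of_int_eq_iff)
  then show False by presburger
qed

end

lemma carrier_ring_of_integers_Rats: "carrier (ring_of_integers \<rat>) = \<int>"
  using rational_algebraic_int_is_int by (auto simp: ring_of_integers_def Ints_subset_Rats int_imp_algebraic_int
      intro: subsetD[OF Ints_subset_Rats])

section \<open>Representatives modulo 2 and the Frobenius map\<close>

context cyclotomic7
begin

lemma z_in_O: "z ^ k \<in> \<O>" using algint_z_pow z_pow_in_L by (simp add: O_def)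

text \<open>\<open>q\<close> is odd, so \<open>x\<close> is congruent to \<open>q * x\<close> modulo
  2, and the latter has integer coordinates in the powers of \<open>z\<close>; only their parities
  matter.\<close>

lemma mod2_representative:
  assumes "x \<in> \<O>"
  obtains S where "S \<subseteq> {..<q}" "cong2 x (\<Sum>i\<in>S. z ^ i)"
proof -
  obtain n where n: "of_nat q * x = (\<Sum>i<q. of_int (n i) * z ^ i)"
    using q_multiple_coeffs assms by (auto simp: O_def)
  define S where "S = {i. i < q \<and> odd (n i)}"
  define y where "y = (\<Sum>i<q. of_int (n i div 2) * z ^ i) - of_nat h * x"
  have "(\<Sum>i\<in>S. z ^ i) = (\<Sum>i<q. of_int (n i mod 2) * z ^ i)"
    unfolding S_def by (intro sum.mono_neutral_cong_left) (auto simp: odd_iff_mod_2_eq_one)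
  moreover have "(\<Sum>i<q. of_int (n i) * z ^ i) =
      (\<Sum>i<q. of_int (n i mod 2) * z ^ i) + 2 * (\<Sum>i<q. of_int (n i div 2) * z ^ i)"
  proof -
    have "of_int (n i) * z ^ i = of_int (n i mod 2) * z ^ i + 2 * (of_int (n i div 2) * z ^ i)" for i
    proof -
      have "n i = n i mod 2 + 2 * (n i div 2)" by simp
      then have "(of_int (n i) :: complex) = of_int (n i mod 2) + 2 * of_int (n i div 2)"
        by (metis of_int_add of_int_mult of_int_numeral)
      then show ?thesis by (simp add: algebra_simps)
    qed
    then show ?thesis by (simp only: sum.distrib sum_distrib_left)
  qed
  moreover have "of_nat q * x = x + 2 * (of_nat h * x)"
  proof -
    have "q = 1 + 2 * h" using q_minus_1 odd_q by simp
    then have "(of_nat q :: complex) = 1 + 2 * of_nat h" by (metis of_nat_1 of_nat_add of_nat_mult of_nat_numeral)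
    then show ?thesis by (simp add: algebra_simps)
  qed
  ultimately have "x - (\<Sum>i\<in>S. z ^ i) = 2 * y" using n by (simp add: y_def algebra_simps)
  moreover have "y \<in> \<O>"
    using O_closed(3)[of "int h"] assms unfolding y_def
    by (intro O_closed(5) O_sum O_closed(7) O_closed(3) z_in_O) simp_all
  moreover have "S \<subseteq> {..<q}" by (auto simp: S_def)
  ultimately show ?thesis using that by (auto simp: cong2_def)
qed

lemma frobenius_sum:
  assumes "finite S"
  shows "cong2 ((\<Sum>i\<in>S. z ^ (f i)) ^ 2) (\<Sum>i\<in>S. z ^ (2 * f i))"
  using assms
proof (induction S rule: finite_induct)
  case empty
  then show ?case using cong2_refl by simp
next
  case (insert a S)
  then obtain w where w: "w \<in> \<O>" "(\<Sum>i\<in>S. z ^ (f i)) ^ 2 - (\<Sum>i\<in>S. z ^ (2 * f i)) = 2 * w"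
    by (auto simp: cong2_def)
  have "w + z ^ f a * (\<Sum>i\<in>S. z ^ (f i)) \<in> \<O>"
    using w by (intro O_closed z_in_O O_sum)
  moreover have "(\<Sum>i\<in>insert a S. z ^ (f i)) ^ 2 - (\<Sum>i\<in>insert a S. z ^ (2 * f i)) =
     2 * (w + z ^ f a * (\<Sum>i\<in>S. z ^ (f i)))"
  proof -
    have "(\<Sum>i\<in>insert a S. z ^ (f i)) ^ 2 - (\<Sum>i\<in>insert a S. z ^ (2 * f i)) =
      ((\<Sum>i\<in>S. z ^ (f i)) ^ 2 - (\<Sum>i\<in>S. z ^ (2 * f i))) + 2 * (z ^ f a * (\<Sum>i\<in>S. z ^ (f i)))"
    proof -
      have "z ^ (2 * f a) = (z ^ f a) ^ 2" by (metis mult.commute power_mult)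
      then show ?thesis unfolding sum.insert[OF insert.hyps] power2_sum by simp
    qed
    then show ?thesis unfolding w(2) by (simp only: distrib_left)
  qed
  ultimately show ?case unfolding cong2_def by blast
qed

lemma frobenius_iterate:
  assumes "finite S"
  shows "cong2 ((\<Sum>i\<in>S. z ^ i) ^ (2 ^ k)) (\<Sum>i\<in>S. z ^ (i * 2 ^ k))"
proof (induction k)
  case 0
  then show ?case using cong2_refl by simp
next
  case (Suc k)
  have "cong2 (((\<Sum>i\<in>S. z ^ i) ^ (2 ^ k)) ^ 2) ((\<Sum>i\<in>S. z ^ (i * 2 ^ k)) ^ 2)"
    by (intro cong2_square Suc O_power O_sum z_in_O)
  moreover have "cong2 ((\<Sum>i\<in>S. z ^ (i * 2 ^ k)) ^ 2) (\<Sum>i\<in>S. z ^ (2 * (i * 2 ^ k)))"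
    by (rule frobenius_sum[OF assms])
  ultimately have "cong2 (((\<Sum>i\<in>S. z ^ i) ^ (2 ^ k)) ^ 2) (\<Sum>i\<in>S. z ^ (2 * (i * 2 ^ k)))"
    by (rule cong2_trans)
  then show ?case by (simp add: mult_ac flip: power_mult)
qed

definition m where "m = ord q 2"

lemma coprime_q_2: "coprime q 2" using q_mod_8 by (simp add: odd_iff_mod_2_eq_one mod_mod_cancel[symmetric, of 2 8])

lemma two_pow_m: "[2 ^ m = 1] (mod q)" using ord_works[of 2 q] by (simp add: m_def)

lemma m_pos: "m > 0"
  using coprime_q_2 unfolding m_def by (metis gr0I ord_eq_0)

lemma m_neq_1: "m \<noteq> 1"
  using two_pow_m odd_q by (auto simp: cong_def)

lemma cong2_frobenius_power: "cong2 x y \<Longrightarrow> x \<in> \<O> \<Longrightarrow> y \<in> \<O> \<Longrightarrow> cong2 (x ^ (2 ^ k)) (y ^ (2 ^ k))"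
proof (induction k)
  case (Suc k)
  then have "cong2 ((x ^ (2 ^ k)) ^ 2) ((y ^ (2 ^ k)) ^ 2)" by (intro cong2_square O_power)
  then show ?case by (simp add: mult.commute flip: power_mult)
qed simp

text \<open>Modulo 2 every integer is a sum of powers of \<open>z\<close>, and \<open>m\<close>
  squarings multiply the exponents by \<open>2 ^ m\<close>, which is 1 modulo
  \<open>q\<close>.\<close>

lemma frobenius_m:
  assumes "x \<in> \<O>"
  shows "cong2 (x ^ (2 ^ m)) x"
proof -
  obtain S where S: "S \<subseteq> {..<q}" "cong2 x (\<Sum>i\<in>S. z ^ i)" using mod2_representative assms .
  have "finite S" using S finite_subset by blast
  have "(\<Sum>i\<in>S. z ^ (i * 2 ^ m)) = (\<Sum>i\<in>S. z ^ i)"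
    using cong_mult[OF cong_refl two_pow_m] by (intro sum.cong refl z_pow_cong) simp
  then have "cong2 ((\<Sum>i\<in>S. z ^ i) ^ (2 ^ m)) (\<Sum>i\<in>S. z ^ i)"
    using frobenius_iterate[OF \<open>finite S\<close>, of m] by simp
  moreover have "cong2 (x ^ (2 ^ m)) ((\<Sum>i\<in>S. z ^ i) ^ (2 ^ m))"
    using S assms by (intro cong2_frobenius_power O_sum z_in_O)
  ultimately show ?thesis using S cong2_trans cong2_sym by blast
qed

lemma eta_in_O: "eta k \<in> \<O>" unfolding eta_def by (intro O_sum z_in_O)

text \<open>\<open>eta 0\<close> is a root of \<open>X ^ 2 + X + (q + 1) / 4\<close>, and the
  constant term is even exactly because \<open>q\<close> is 7 modulo 8.\<close>

lemma eta_square: "eta 0 ^ 2 = - eta 0 - 2 * of_nat ((q + 1) div 8)"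
proof -
  have "q + 1 = 8 * ((q + 1) div 8)" using q_mod_8 by presburger
  then have q: "(of_nat q :: complex) = 8 * of_nat ((q + 1) div 8) - 1"
    by (metis add_diff_cancel_right' of_nat_1 of_nat_add of_nat_mult of_nat_numeral)
  have "eta 0 ^ 2 = (1 - 2 * tau + tau ^ 2) / 4"
    unfolding eta_tau by (simp add: power2_eq_square field_simps)
  then show ?thesis unfolding tau_sq q eta_tau by (simp add: field_simps)
qed

text \<open>Since \<open>z \<mapsto> z ^ 2\<close> is the Frobenius modulo 2, an odd power of the generator would force
  \<open>eta 1 \<equiv> eta 0\<close> modulo 2.\<close>

lemma m_dvd_h: "m dvd h"
proof -
  have "\<not> q dvd 2" using odd_q by (auto dest: dvd_imp_le)
  then obtain k where k: "[2 = g ^ k] (mod q)" by (rule g_pow_surj)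
  have "even k"
  proof (rule ccontr)
    assume odd: "odd k"
    have "cong2 (eta 0 ^ 2) (\<Sum>i<h. z ^ (2 * g ^ (2 * i)))"
      using frobenius_sum[of "{..<h}" "\<lambda>i. g ^ (2 * i)"] by (simp add: eta_def)
    also have "(\<Sum>i<h. z ^ (2 * g ^ (2 * i))) = eta k"
    proof -
      have "[2 * g ^ (2 * i) = g ^ (2 * i + k)] (mod q)" for i
        using cong_mult[OF k cong_refl[of "g ^ (2 * i)"]] by (simp only: power_add mult.commute)
      then show ?thesis unfolding eta_def by (intro sum.cong refl z_pow_cong)
    qed
    also have "eta k = eta 1" using eta_mod[of k] odd by (simp add: odd_iff_mod_2_eq_one)
    also have "eta 1 = -1 - eta 0" using eta_sum by (simp add: algebra_simps add_eq_0_iff)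
    \<comment> \<open>By \<open>eta_square\<close> the left side equals 1 minus an even integer, so
      1 would be twice an algebraic integer.\<close>
    finally obtain y where y: "y \<in> \<O>" "eta 0 ^ 2 - (-1 - eta 0) = 2 * y" by (auto simp: cong2_def)
    then have "1 = 2 * (y + of_int (int ((q + 1) div 8)))" by (simp add: eta_square algebra_simps)
    then show False using not_half_integral O_closed y by blast
  qed
  then obtain j where j: "k = 2 * j" by blast
  have "[2 ^ h = (g ^ k) ^ h] (mod q)" using k by (rule cong_pow)
  also have "(g ^ k) ^ h = g ^ (0 + j * (q - 1))" by (simp add: j q_minus_Suc_0 flip: power_mult) (simp add: mult_ac)
  also have "[g ^ (0 + j * (q - 1)) = g ^ 0] (mod q)"
  proof (induction j)
    case (Suc j)
    have "[g ^ ((0 + j * (q - 1)) + (q - 1)) = g ^ (0 + j * (q - 1))] (mod q)" by (rule g_pow_period)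
    then show ?case using Suc cong_trans by (simp add: add.commute) blast
  qed simp
  finally show ?thesis by (simp add: m_def ord_divides')
qed

lemma odd_not_in_ideal:
  assumes "osub P" "2 \<in> P" "1 \<notin> P" "odd n"
  shows "of_nat n \<notin> P"
proof
  assume n: "of_nat n \<in> P"
  obtain k where k: "n = 2 * k + 1" using assms(4) oddE by blast
  have "of_nat n - of_int (int k) * 2 \<in> P" using n assms O_closed(3) by (intro osub_diff osubD(3))
  then show False using assms by (simp add: k algebra_simps)
qed

text \<open>\<open>1 - z\<close> divides the odd number \<open>q\<close>. This keeps the image of
  \<open>z\<close> in a residue field above 2 different from 1.\<close>

lemma one_minus_z_notin:
  assumes "osub P" "2 \<in> P" "1 \<notin> P"
  shows "1 - z \<notin> P"
proof
  assume "1 - z \<in> P"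
  moreover have "(\<Prod>i\<in>{1..<q} - {1}. 1 - z ^ i) \<in> \<O>"
    using O_closed(2) z_in_O by (intro O_prod O_closed(5)) auto
  ultimately have "(1 - z) * (\<Prod>i\<in>{1..<q} - {1}. 1 - z ^ i) \<in> P" using osubD(4)[OF assms(1)] by blast
  also have "(1 - z) * (\<Prod>i\<in>{1..<q} - {1}. 1 - z ^ i) = of_nat q"
    using odd_q prod.remove[of "{1..<q}" 1 "\<lambda>i. 1 - z ^ i"] by (simp add: prod_one_minus_z[symmetric])
  finally have "of_nat q \<in> P" .
  moreover have "odd q" using coprime_q_2 by simp
  ultimately show False using odd_not_in_ideal assms by blast
qed

text \<open>Let the residue field have \<open>2 ^ n\<close> elements. Its nonzero elements are roots
  of unity of order dividing \<open>2 ^ m - 1\<close>, so \<open>n \<le> m\<close>; and the image of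
  \<open>z\<close> has order exactly \<open>q\<close> among them, so \<open>q\<close> divides
  \<open>2 ^ n - 1\<close> and \<open>m\<close> divides \<open>n\<close>.\<close>

lemma residue_degree_above_2:
  assumes "maximalideal P (ring_of_integers L)" and two: "2 \<in> P"
  shows "residue_degree L \<rat> P = m"
proof -
  let ?R = "ring_of_integers L"
  let ?Q = "?R Quot P"
  interpret R: cring ?R by (rule cring_O)
  interpret P: maximalideal P ?R by fact
  interpret Q: field ?Q by (rule P.quotient_is_field) (rule cring_O)
  interpret \<pi>: ring_hom_ring ?R ?Q "(+>\<^bsub>?R\<^esub>) P" by (rule P.rcos_ring_hom_ring)
  define \<pi> where "\<pi> = (+>\<^bsub>?R\<^esub>) P"
  have P: "P \<subseteq> \<O>" "osub P" using P.ideal_axioms by (simp_all add: ideal_iff)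
  have "1 \<notin> P"
  proof
    assume "1 \<in> P"
    then have "\<O> \<subseteq> P" using osubD(3)[OF P(2), of _ 1] by auto
    then show False using P P.I_notcarr by simp
  qed
  have carr: "carrier ?Q = \<pi> ` \<O>"
    by (auto simp: FactRing_def A_RCOSETS_def' \<pi>_def)
  have zero: "\<pi> x = \<zero>\<^bsub>?Q\<^esub> \<longleftrightarrow> x \<in> P" if "x \<in> \<O>" for x
    using that P.rcos_const_imp_mem[of x] P.a_rcos_const[of x] by (auto simp: \<pi>_def FactRing_def)
  have mult: "\<pi> (x * y) = \<pi> x \<otimes>\<^bsub>?Q\<^esub> \<pi> y" if "x \<in> \<O>" "y \<in> \<O>" for x y
    using \<pi>.hom_mult[of x y] that by (simp add: \<pi>_def)
  have add: "\<pi> (x + y) = \<pi> x \<oplus>\<^bsub>?Q\<^esub> \<pi> y" if "x \<in> \<O>" "y \<in> \<O>" for x y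
    using \<pi>.hom_add[of x y] that by (simp add: \<pi>_def)
  have one: "\<pi> 1 = \<one>\<^bsub>?Q\<^esub>" using \<pi>.hom_one by (simp add: \<pi>_def)
  have pow: "\<pi> (x ^ n) = \<pi> x [^]\<^bsub>?Q\<^esub> n" if "x \<in> \<O>" for x and n :: nat
    using \<pi>.hom_nat_pow[of x n] that by (simp add: \<pi>_def)
  have closed: "\<pi> x \<in> carrier ?Q" if "x \<in> \<O>" for x using that carr by blast
  have eqI: "\<pi> x = \<pi> y" if "x \<in> \<O>" "y \<in> \<O>" "x - y \<in> P" for x y
  proof -
    have "\<pi> x = \<pi> (x - y) \<oplus>\<^bsub>?Q\<^esub> \<pi> y" using add[of "x - y" y] that O_closed by simp
    then show ?thesis using zero[of "x - y"] that O_closed closed by simp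
  qed
  have cong2_eq: "\<pi> x = \<pi> y" if "cong2 x y" "x \<in> \<O>" "y \<in> \<O>" for x y
    using that two P(2) by (intro eqI) (auto simp: cong2_def osubD)
  have finQ: "finite (carrier ?Q)"
  proof (rule finite_subset)
    show "carrier ?Q \<subseteq> (\<lambda>S. \<pi> (\<Sum>i\<in>S. z ^ i)) ` Pow {..<q}"
    proof
      fix y assume "y \<in> carrier ?Q"
      then obtain x where x: "x \<in> \<O>" "y = \<pi> x" using carr by blast
      obtain S where S: "S \<subseteq> {..<q}" "cong2 x (\<Sum>i\<in>S. z ^ i)" using mod2_representative[OF x(1)] .
      then have "y = \<pi> (\<Sum>i\<in>S. z ^ i)" using x cong2_eq[OF S(2) x(1) O_sum[OF z_in_O]] by simp
      then show "y \<in> (\<lambda>S. \<pi> (\<Sum>i\<in>S. z ^ i)) ` Pow {..<q}" using S by blast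
    qed
  qed simp
  \<comment> \<open>Cancelling one factor in \<open>y ^ (2 ^ m) = y\<close> turns the nonzero
    residue classes into roots of \<open>y ^ N = 1\<close>, of which a field has at most
    \<open>N\<close>; the class of 0 accounts for the remaining one.\<close>
  define N where "N = (2::nat) ^ m - 1"
  have "1 < (2::nat) ^ m" using m_pos by (intro one_less_power) auto
  then have N: "2 ^ m = Suc N" "N > 0" unfolding N_def by linarith+
  have "card (carrier ?Q) \<le> 2 ^ m"
  proof -
    have "carrier ?Q \<subseteq> insert \<zero>\<^bsub>?Q\<^esub> {y \<in> carrier ?Q. y [^]\<^bsub>?Q\<^esub> N = \<one>\<^bsub>?Q\<^esub>}"
    proof
      fix y assume y: "y \<in> carrier ?Q"
      then obtain x where x: "x \<in> \<O>" "y = \<pi> x" using carr by blast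
      have "y [^]\<^bsub>?Q\<^esub> N \<otimes>\<^bsub>?Q\<^esub> y = \<one>\<^bsub>?Q\<^esub> \<otimes>\<^bsub>?Q\<^esub> y"
        using cong2_eq[OF frobenius_m[OF x(1)] O_power[OF x(1)] x(1)] x O_power y
        by (simp add: N pow[symmetric] mult[symmetric] mult.commute)
      then have "y \<noteq> \<zero>\<^bsub>?Q\<^esub> \<Longrightarrow> y [^]\<^bsub>?Q\<^esub> N = \<one>\<^bsub>?Q\<^esub>"
        using y Q.m_rcancel[of y "y [^]\<^bsub>?Q\<^esub> N" "\<one>\<^bsub>?Q\<^esub>"] by simp
      then show "y \<in> insert \<zero>\<^bsub>?Q\<^esub> {y \<in> carrier ?Q. y [^]\<^bsub>?Q\<^esub> N = \<one>\<^bsub>?Q\<^esub>}" using y by auto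
    qed
    then have "card (carrier ?Q) \<le> card (insert \<zero>\<^bsub>?Q\<^esub> {y \<in> carrier ?Q. y [^]\<^bsub>?Q\<^esub> N = \<one>\<^bsub>?Q\<^esub>})"
      using finQ by (intro card_mono) auto
    also have "\<dots> \<le> Suc (card {y \<in> carrier ?Q. y [^]\<^bsub>?Q\<^esub> N = \<one>\<^bsub>?Q\<^esub>})" by (rule card_insert_le_m1) auto
    also have "\<dots> \<le> Suc N" using Q.num_roots_le_deg[OF finQ, of N] N by simp
    finally show ?thesis using N by simp
  qed
  have "q dvd card (carrier ?Q) - 1"
  proof -
    interpret M: Group.group "Multiplicative_Group.mult_of ?Q" by (rule Q.field_mult_group)
    have zO: "z \<in> \<O>" using z_in_O[of 1] by simp
    have z0: "\<pi> z \<noteq> \<zero>\<^bsub>?Q\<^esub>"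
    proof
      assume "\<pi> z = \<zero>\<^bsub>?Q\<^esub>"
      then have "z \<in> P" using zero zO by simp
      then have "z ^ (q - 1) * z \<in> P" using z_in_O osubD(3)[OF P(2)] by blast
      then show False using \<open>1 \<notin> P\<close> z_pow_q odd_q by (simp flip: power_Suc2)
    qed
    then have zM: "\<pi> z \<in> carrier (Multiplicative_Group.mult_of ?Q)" using closed zO by simp
    have "\<pi> z [^]\<^bsub>Multiplicative_Group.mult_of ?Q\<^esub> q = \<one>\<^bsub>Multiplicative_Group.mult_of ?Q\<^esub>"
      using pow[OF zO, of q] one by (simp add: z_pow_q Multiplicative_Group.nat_pow_mult_of)
    then have "M.ord (\<pi> z) dvd q" using M.pow_eq_id[OF zM] by simp
    moreover have "M.ord (\<pi> z) \<noteq> 1"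
    proof
      assume "M.ord (\<pi> z) = 1"
      then have "\<pi> z = \<pi> 1" using M.ord_eq_1[OF zM] one by simp
      then have "\<pi> (1 - z) \<oplus>\<^bsub>?Q\<^esub> \<pi> z = \<zero>\<^bsub>?Q\<^esub> \<oplus>\<^bsub>?Q\<^esub> \<pi> z"
        using add[of "1 - z" z] zO O_closed closed by simp
      then have "\<pi> (1 - z) = \<zero>\<^bsub>?Q\<^esub>" using closed[of "1 - z"] closed[OF zO] zO O_closed
        by (intro Q.add.r_cancel[of "\<pi> (1 - z)" "\<pi> z" "\<zero>\<^bsub>?Q\<^esub>"]) auto
      then show False using zero one_minus_z_notin[OF P(2) two \<open>1 \<notin> P\<close>] zO O_closed by blast
    qed
    ultimately have "M.ord (\<pi> z) = q" using prime_q by (metis prime_nat_iff)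
    then have "q dvd Coset.order (Multiplicative_Group.mult_of ?Q)" using M.ord_dvd_group_order[OF zM] by simp
    then show ?thesis using Q.order_mult_of[OF finQ] by (simp add: Coset.order_def)
  qed
  define K where "K = {\<zero>\<^bsub>?Q\<^esub>, \<one>\<^bsub>?Q\<^esub>}"
  have one_one: "\<one>\<^bsub>?Q\<^esub> \<oplus>\<^bsub>?Q\<^esub> \<one>\<^bsub>?Q\<^esub> = \<zero>\<^bsub>?Q\<^esub>"
    using add[of 1 1] zero[of 2] two P O_closed(2) one by auto
  then have m1: "\<ominus>\<^bsub>?Q\<^esub> \<one>\<^bsub>?Q\<^esub> = \<one>\<^bsub>?Q\<^esub>" by (intro Q.minus_equality) auto
  have K: "subfield K ?Q"
  proof (rule Q.subfieldI')
    show "subring K ?Q" by (rule Q.subringI) (auto simp: K_def m1 one_one)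
  qed (auto simp: K_def)
  \<comment> \<open>Since 2 lies in \<open>P\<close> and 1 does not, the image of the rational
    integers is the field with two elements, over which the residue degree is a dimension.\<close>
  have K_eq: "(\<lambda>x. P +>\<^bsub>?R\<^esub> x) ` carrier (ring_of_integers \<rat>) = K"
  proof -
    have n: "\<pi> (of_int n) = (if even n then \<zero>\<^bsub>?Q\<^esub> else \<one>\<^bsub>?Q\<^esub>)" for n
    proof (cases "even n")
      case True
      then obtain k where "n = 2 * k" by blast
      then have "of_int n \<in> P" using osubD(4)[OF P(2) O_closed(3) two, of k] by simp
      then show ?thesis using True zero O_closed by simp
    next
      case False
      then obtain k where "n = 2 * k + 1" using oddE by blast
      then have "of_int n - 1 \<in> P" using osubD(4)[OF P(2) O_closed(3) two, of k] by simp
      then show ?thesis using False eqI O_closed one by metis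
    qed
    have "\<pi> ` \<int> = K"
    proof
      show "\<pi> ` \<int> \<subseteq> K"
      proof (rule image_subsetI)
        fix x :: complex assume "x \<in> \<int>"
        then obtain k where "x = of_int k" by (elim Ints_cases)
        then show "\<pi> x \<in> K" by (simp add: n K_def)
      qed
      have 01: "\<zero>\<^bsub>?Q\<^esub> = \<pi> 0" "\<one>\<^bsub>?Q\<^esub> = \<pi> 1" using n[of 0] n[of 1] by simp_all
      show "K \<subseteq> \<pi> ` \<int>"
        unfolding K_def 01 by (intro insert_subsetI imageI Ints_0 Ints_1 empty_subsetI)
    qed
    then show ?thesis by (simp add: carrier_ring_of_integers_Rats \<pi>_def)
  qed
  have cardK: "card K = 2" "finite K" using Q.one_not_zero by (auto simp: K_def)
  obtain xs where xs: "set xs = carrier ?Q" using finite_list[OF finQ] by blast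
  have "Q.Span K xs = carrier ?Q"
  proof
    show "Q.Span K xs \<subseteq> carrier ?Q"
      using xs subringE(1)[OF subfieldE(1)[OF K]] by (intro Q.Span_in_carrier) simp_all
    show "carrier ?Q \<subseteq> Q.Span K xs" using Q.Span_base_incl[OF K, of xs] xs by simp
  qed
  then have "Q.finite_dimension K (carrier ?Q)" using Q.Span_finite_dimension[OF K, of xs] xs by simp
  then obtain n where n: "Q.dimension n K (carrier ?Q)" unfolding Q.finite_dimension_def by blast
  have card: "card (carrier ?Q) = 2 ^ n" using Q.card_dimension[OF n K cardK(2)] cardK by simp
  have "[2 ^ n = 1] (mod q)"
    using \<open>q dvd card (carrier ?Q) - 1\<close> unfolding card
    by (subst cong_altdef_nat) simp_all
  then have "m dvd n" by (simp add: m_def ord_divides')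
  moreover have "n > 0"
  proof (rule gr0I)
    assume "n = 0"
    then have "card (carrier ?Q) = 1" using card by simp
    then obtain y where "carrier ?Q = {y}" using card_1_singletonE by blast
    then show False using Q.one_not_zero Q.one_closed Q.zero_closed by (metis singletonD)
  qed
  ultimately have "m \<le> n" by (simp add: dvd_imp_le)
  moreover have "n \<le> m" using \<open>card (carrier ?Q) \<le> 2 ^ m\<close> card by simp
  ultimately have "n = m" by simp
  then show ?thesis
    using Q.dimI[OF K n] unfolding residue_degree_def K_eq over_def by simp
qed

end

lemma (in number_field) iprod_ring_of_integers: "ideal_prod (ring_of_integers L) I J = I ** J"
proof (intro equalityI subsetI)
  fix x assume "x \<in> ideal_prod (ring_of_integers L) I J"
  then show "x \<in> I ** J"
    by (induction rule: ideal_prod.induct) (auto intro: iprodI iprod_add)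
next
  fix x assume "x \<in> I ** J"
  then show "x \<in> ideal_prod (ring_of_integers L) I J"
    using ideal_prod.prod[of _ I _ J "ring_of_integers L"] ideal_prod.sum[of _ "ring_of_integers L" I J]
    by (induction rule: iprod_induct) auto
qed

lemma (in number_field) pow_ideals_set:
  "I [^]\<^bsub>ideals_set (ring_of_integers L)\<^esub> (n::nat) = I [^]\<^bsub>F\<^esub> n"
proof (induction n)
  case 0
  then show ?case by (simp add: nat_pow_def ideals_set_def)
next
  case (Suc n)
  then show ?case by (simp add: nat_pow_def ideals_set_def iprod_ring_of_integers)
qed

lemma (in number_field) maximalideal_iff:
  "maximalideal P (ring_of_integers L) \<longleftrightarrow> P \<subseteq> \<O> \<and> osub P \<and> P \<noteq> \<O> \<and>
    (\<forall>J. J \<subseteq> \<O> \<and> osub J \<and> P \<subseteq> J \<longrightarrow> J = P \<or> J = \<O>)"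
  by (auto simp: maximalideal_def maximalideal_axioms_def ideal_iff)

lemma (in number_field) osub_eq_O: "osub I \<Longrightarrow> I \<subseteq> \<O> \<Longrightarrow> 1 \<in> I \<Longrightarrow> I = \<O>"
  using osubD(3)[of I _ 1] by auto

lemma (in finite_class_number) inverse_ideal:
  assumes "fractional I"
  obtains J where "fractional J" "I ** J = \<O>" "J ** I = \<O>"
  using inverse_fractional_exists[OF assms] iprod_comm by metis

section \<open>Ideals containing 2\<close>

context cyclotomic7
begin

definition mod2_reps where "mod2_reps = (\<lambda>S. \<Sum>i\<in>S. z ^ i) ` Pow {..<q}"

lemma finite_mod2_reps: "finite mod2_reps" by (simp add: mod2_reps_def)

text \<open>The measure for the inductions over ideals containing 2. An element of \<open>J\<close>
  outside \<open>I\<close> differs from its representative by a multiple of 2, hence by an element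
  of \<open>I\<close>, so the representative also separates the two ideals.\<close>

lemma mod2_reps_psubset:
  assumes "osub I" "osub J" "2 \<in> I" "I \<subset> J" "J \<subseteq> \<O>"
  shows "card (mod2_reps - J) < card (mod2_reps - I)"
proof (rule psubset_card_mono)
  obtain x where x: "x \<in> J" "x \<notin> I" using assms by blast
  then obtain S where S: "S \<subseteq> {..<q}" "cong2 x (\<Sum>i\<in>S. z ^ i)" using mod2_representative[of x] assms by blast
  define r where "r = (\<Sum>i\<in>S. z ^ i)"
  obtain y where y: "y \<in> \<O>" "x - r = 2 * y" using S by (auto simp: cong2_def r_def)
  then have I: "x - r \<in> I" using osubD(4)[OF assms(1) y(1) assms(3)] by simp
  have "r \<in> J" using osub_diff[OF assms(2) x(1), of "x - r"] I assms by auto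
  moreover have "r \<notin> I" using osubD(2)[OF assms(1), of r "x - r"] I x by auto
  moreover have "r \<in> mod2_reps" using S by (auto simp: mod2_reps_def r_def)
  ultimately show "mod2_reps - J \<subset> mod2_reps - I" using assms by blast
qed (simp add: finite_mod2_reps)

lemma exists_maximalideal:
  assumes "I \<subseteq> \<O>" "osub I" "2 \<in> I" "I \<noteq> \<O>"
  shows "\<exists>P. maximalideal P (ring_of_integers L) \<and> I \<subseteq> P"
  using assms
proof (induction "card (mod2_reps - I)" arbitrary: I rule: less_induct)
  case less
  show ?case
  proof (cases "maximalideal I (ring_of_integers L)")
    case False
    then obtain J where J: "J \<subseteq> \<O>" "osub J" "I \<subseteq> J" "J \<noteq> I" "J \<noteq> \<O>"
      using less.prems by (auto simp: maximalideal_iff)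
    then have "card (mod2_reps - J) < card (mod2_reps - I)" using less.prems by (intro mod2_reps_psubset) auto
    then show ?thesis using less.hyps[of J] J less.prems by blast
  qed auto
qed

end

locale cyclotomic7_finite = cyclotomic7 +
  assumes class_number_L: "class_number L > 0"
begin

sublocale finite_class_number L
  by unfold_locales (rule class_number_L)

text \<open>A proper \<open>I\<close> lies in a maximal ideal \<open>P\<close>; dividing by
  \<open>P\<close> gives an integral ideal that contains \<open>I\<close>, hence 2, and is strictly
  larger because equality would allow cancelling \<open>I\<close>. So the induction peels off
  principal factors.\<close>

lemma principal_above_2:
  assumes "\<And>P. maximalideal P (ring_of_integers L) \<Longrightarrow> 2 \<in> P \<Longrightarrow> P \<in> Pr"
    and "I \<subseteq> \<O>" "osub I" "2 \<in> I"
  shows "I \<in> Pr"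
  using assms(2-)
proof (induction "card (mod2_reps - I)" arbitrary: I rule: less_induct)
  case less
  show ?case
  proof (cases "I = \<O>")
    case True
    then show ?thesis using FG.one_closed subgroup.one_closed[OF subgroup_Pr] by simp
  next
    case False
    then obtain P where P: "maximalideal P (ring_of_integers L)" "I \<subseteq> P"
      using exists_maximalideal less.prems by blast
    have PO: "P \<subseteq> \<O>" "osub P" "P \<noteq> \<O>" using P by (auto simp: maximalideal_iff)
    have "2 \<in> P" using P less.prems by blast
    then have fP: "fractional P" using PO fractional_ideal[of P 2] by simp
    have fI: "fractional I" using less.prems fractional_ideal[of I 2] by simp
    obtain Q where Q: "fractional Q" "P ** Q = \<O>" "Q ** P = \<O>" using inverse_ideal[OF fP] .
    have "\<O> \<subseteq> Q"
    proof -
      have "P ** Q \<subseteq> \<O> ** Q" by (intro iprod_mono PO order_refl)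
      then show ?thesis using O_iprod[OF fractional_osub[OF Q(1)]] Q(2) by simp
    qed
    define J where "J = I ** Q"
    have JP: "J ** P = I" unfolding J_def using iprod_assoc Q(3) O_iprod iprod_comm fractional_osub[OF fI] by metis
    have fJ: "fractional J" unfolding J_def by (intro fractional_iprod fI Q)
    have "J \<subseteq> \<O>" unfolding J_def Q(2)[symmetric] by (intro iprod_mono P) simp
    moreover have "I \<subseteq> J"
      using iprod_mono[OF order_refl \<open>\<O> \<subseteq> Q\<close>, of I] O_iprod[OF fractional_osub[OF fI]] iprod_comm[of I \<O>]
      by (simp add: J_def)
    moreover have "J \<noteq> I"
    proof
      assume "J = I"
      then have "P = \<O>" using iprod_cancel_self[OF fI fP] JP by simp
      then show False using PO by simp
    qed
    ultimately have "J \<in> Pr"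
      using less.prems fractional_osub[OF fJ] by (intro less.hyps mod2_reps_psubset) auto
    moreover have "P \<in> Pr" using assms(1) P \<open>2 \<in> P\<close> by blast
    ultimately show ?thesis using subgroup.m_closed[OF subgroup_Pr, of J P] JP by simp
  qed
qed

text \<open>If \<open>P\<close> divided 2 twice, the quotient of \<open>(2)\<close> by
  \<open>P\<close> would have its square inside \<open>(2)\<close>. As the integers modulo 2 have no
  nilpotents by \<open>frobenius_m\<close>, this quotient would be \<open>(2)\<close> itself, and
  cancellation would give \<open>P = \<O>\<close>.\<close>

lemma unramified_above_2:
  assumes max: "maximalideal P (ring_of_integers L)" and two: "2 \<in> P"
  shows "unramified L \<rat> P"
proof -
  have P: "P \<subseteq> \<O>" "osub P" "P \<noteq> \<O>" using max by (auto simp: maximalideal_iff)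
  have one: "1 \<notin> P" using osub_eq_O P by blast
  have fP: "fractional P" using P two fractional_ideal[of P 2] by simp
  have O2: "2 \<in> \<O>" using O_closed(3)[of 2] by simp
  let ?T = "(*) 2 ` \<O>"
  have T: "?T \<subseteq> \<O>" "osub ?T" "2 \<in> ?T" using O_closed(7)[OF O2] osub_scale[OF osub_O] O_closed(2)
    by (auto intro: image_eqI[of _ _ 1])
  have below: "prime_below \<rat> P = {of_int n | n. even n}"
  proof -
    have "of_int n \<in> P \<longleftrightarrow> even n" for n
    proof
      assume n: "of_int n \<in> P"
      show "even n"
      proof (rule ccontr)
        assume "odd n"
        then obtain k where "n = 2 * k + 1" using oddE by blast
        then have "1 = of_int n - of_int k * (2::complex)" by simp
        also have "\<dots> \<in> P" using n two P O_closed(3) by (intro osub_diff osubD(3))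
        finally show False using one by simp
      qed
    next
      assume "even n"
      then obtain k where "n = 2 * k" by blast
      then show "of_int n \<in> P" using osubD(4)[OF P(2) O_closed(3) two, of k] by simp
    qed
    then show ?thesis unfolding prime_below_def carrier_ring_of_integers_Rats by (auto elim!: Ints_cases)
  qed
  have gen: "genideal (ring_of_integers L) (prime_below \<rat> P) = ?T"
  proof
    interpret R: cring "ring_of_integers L" by (rule cring_O)
    show "genideal (ring_of_integers L) (prime_below \<rat> P) \<subseteq> ?T"
    proof (rule R.genideal_minimal)
      show "ideal ?T (ring_of_integers L)" using T by (simp add: ideal_iff)
      show "prime_below \<rat> P \<subseteq> ?T" using O_closed(3) by (auto simp: below)
    qed
    show "?T \<subseteq> genideal (ring_of_integers L) (prime_below \<rat> P)"
      unfolding genideal_def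
    proof clarify
      fix x I assume x: "x \<in> \<O>" and I: "ideal I (ring_of_integers L)" "prime_below \<rat> P \<subseteq> I"
      have "2 \<in> prime_below \<rat> P" unfolding below by (intro CollectI exI[of _ 2]) simp
      then have "2 \<in> I" using I(2) by (rule subsetD[rotated])
      then show "2 * x \<in> I" using I x osubD(4) by (simp add: ideal_iff)
    qed
  qed
  let ?good = "\<lambda>e. \<exists>J. J \<subseteq> \<O> \<and> osub J \<and> ?T = J ** (P [^]\<^bsub>F\<^esub> (e::nat))"
  have pow: "fractional (P [^]\<^bsub>F\<^esub> (n::nat))" for n using FG.nat_pow_closed[of P n] fP by simp
  have pow1: "P [^]\<^bsub>F\<^esub> (1::nat) = P" using FG.nat_pow_eone fP by simp
  have "?good 1"
  proof -
    obtain Q where Q: "fractional Q" "P ** Q = \<O>" "Q ** P = \<O>" using inverse_ideal[OF fP] .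
    have "?T \<subseteq> P" using osubD(4)[OF P(2) _ two] by auto
    then have "?T ** Q \<subseteq> \<O>" unfolding Q(2)[symmetric] by (intro iprod_mono) auto
    moreover have "osub (?T ** Q)" using T Q fractional_osub osub_iprod by blast
    moreover have "?T = (?T ** Q) ** P"
      using iprod_assoc Q(3) O_iprod[OF T(2)] iprod_comm[of ?T \<O>] by metis
    ultimately show ?thesis unfolding pow1 by blast
  qed
  moreover have "e \<le> 1" if good: "?good e" for e
  proof (rule ccontr)
    assume "\<not> e \<le> 1"
    then have "e = (e - 2) + 2" by simp
    then obtain k where k: "e = k + 2" by blast
    obtain J where J: "J \<subseteq> \<O>" "osub J" "?T = J ** (P [^]\<^bsub>F\<^esub> e)" using good by blast
    \<comment> \<open>With \<open>e = k + 2\<close> this is the quotient of \<open>(2)\<close> by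
      \<open>P\<close>, and it still contains at least one factor \<open>P\<close>.\<close>
    define J' where "J' = J ** (P [^]\<^bsub>F\<^esub> (k + 1))"
    have powO: "P [^]\<^bsub>F\<^esub> (n::nat) \<subseteq> \<O>" for n
    proof (induction n)
      case (Suc n)
      have "P [^]\<^bsub>F\<^esub> n ** P \<subseteq> \<O> ** \<O>" by (intro iprod_mono Suc P)
      then show ?case using O_iprod[OF osub_O] by simp
    qed simp
    have e: "P [^]\<^bsub>F\<^esub> e = P [^]\<^bsub>F\<^esub> (k + 1) ** P" by (simp add: k)
    have TJ': "?T = J' ** P" unfolding J'_def iprod_assoc e[symmetric] by (rule J(3))
    have osJ': "osub J'" unfolding J'_def by (intro osub_iprod J fractional_osub pow)
    have "J' ** J' \<subseteq> ?T"
    proof -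
      \<comment> \<open>The exponents satisfy \<open>(k + 1) + (k + 1) = e + k\<close>, so the
        product contains the full factor \<open>J ** P ^ e\<close>, which is
        \<open>?T\<close>.\<close>
      have "J' ** J' = (J ** (P [^]\<^bsub>F\<^esub> (k + 1) ** P [^]\<^bsub>F\<^esub> (k + 1))) ** J"
        unfolding J'_def by (metis iprod_assoc iprod_comm)
      also have "P [^]\<^bsub>F\<^esub> (k + 1) ** P [^]\<^bsub>F\<^esub> (k + 1) = P [^]\<^bsub>F\<^esub> e ** P [^]\<^bsub>F\<^esub> k"
        using FG.nat_pow_mult[of P "k+1" "k+1"] FG.nat_pow_mult[of P e k] fP by (simp add: k mult_2)
      also have "(J ** (P [^]\<^bsub>F\<^esub> e ** P [^]\<^bsub>F\<^esub> k)) ** J = ?T ** (P [^]\<^bsub>F\<^esub> k ** J)"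
        unfolding J(3) by (metis iprod_assoc)
      also have "\<dots> \<subseteq> ?T ** (\<O> ** \<O>)" by (intro iprod_mono powO J) simp
      also have "\<dots> = ?T" using O_iprod[OF osub_O] O_iprod[OF T(2)] iprod_comm[of ?T \<O>] by simp
      finally show ?thesis .
    qed
    have J'O: "J' \<subseteq> \<O>"
      using iprod_mono[OF J(1) powO[of "k + 1"]] O_iprod[OF osub_O] by (simp add: J'_def)
    have "J' \<subseteq> ?T"
    proof
      fix x assume x: "x \<in> J'"
      then have xO: "x \<in> \<O>" using J'O by blast
      have "x ^ 2 \<in> ?T" using iprodI[OF x x] \<open>J' ** J' \<subseteq> ?T\<close> by (auto simp: power2_eq_square)
      \<comment> \<open>The exponent \<open>2 ^ m\<close> is at least 2, so
        \<open>x ^ (2 ^ m)\<close> is a multiple of \<open>x ^ 2\<close> and lies in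
        \<open>?T\<close>; its congruence with \<open>x\<close> brings \<open>x\<close> there
        too.\<close>
      moreover have "(2::nat) ^ 1 \<le> 2 ^ m" using m_pos by (intro power_increasing) auto
      then have "2 ^ m = (2 ^ m - 2) + (2::nat)" by simp
      then have "x ^ (2 ^ m) = x ^ (2 ^ m - 2) * x ^ 2" by (metis power_add)
      ultimately have "x ^ (2 ^ m) \<in> ?T" using osubD(3)[OF T(2) O_power[OF xO]] by simp
      moreover have "x ^ (2 ^ m) - x \<in> ?T" using frobenius_m[OF xO] by (auto simp: cong2_def)
      ultimately have "x ^ (2 ^ m) - (x ^ (2 ^ m) - x) \<in> ?T" by (rule osub_diff[OF T(2)])
      then show "x \<in> ?T" by simp
    qed
    moreover have "?T \<subseteq> J'"
      unfolding TJ' by (intro iprod_subset osubD(2)[OF osJ'] osubD(4)[OF osJ']) (use P in auto)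
    ultimately have "J' = ?T" by blast
    moreover from this have "fractional J'" using fractional_ideal[of ?T 2] T by simp
    ultimately have "P = \<O>" using iprod_cancel_self[of J' P] fP TJ' by simp
    then show False using P by simp
  qed
  ultimately have "(GREATEST e. ?good e) = 1" by (intro Greatest_equality) auto
  then show ?thesis
    unfolding unramified_def ramification_index_def gen iprod_ring_of_integers pow_ideals_set
    by (simp add: ideal_iff conj_assoc)
qed

end

section \<open>The norm to the quadratic field\<close>

context imaginary_quadratic
begin

lemma cnj_in_K_O: "x \<in> K.\<O> \<Longrightarrow> cnj x \<in> K.\<O>"
proof -
  assume x: "x \<in> K.\<O>"
  then obtain a b where "x = quad a b" by (auto simp: K.O_def elim: rat_adjoin_w_cases)
  then have "cnj x \<in> rat_adjoin w" unfolding rat_adjoin_w by (auto simp: cnj_quad)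
  then show ?thesis using x by (simp add: K.O_def)
qed

definition omega where "omega = (1 + w) / 2"

lemma omega_in_K: "omega \<in> rat_adjoin w"
  unfolding omega_def using K.divide_closed[OF K.add_closed[OF K.one_closed] K.of_int_closed[of 2]] rat_adjoin_closed(2) by simp

lemma omega_cnj: "omega + cnj omega = 1" "omega * cnj omega = of_nat (q + 1) / 4"
proof -
  show "omega + cnj omega = 1" by (simp add: omega_def cnj_w field_simps)
  have "omega * cnj omega = (1 - w * w) / 4" by (simp add: omega_def cnj_w field_simps)
  then show "omega * cnj omega = of_nat (q + 1) / 4" by (simp add: w_mult)
qed

text \<open>\<open>quad_integral\<close> leaves a possible denominator \<open>q\<close> in
  \<open>b\<close>; the norm equation makes the prime \<open>q\<close> divide \<open>k\<close>,
  which removes it. In \<open>M ^ 2 + q * l ^ 2 = 8\<close> the bound on \<open>q\<close> forces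
  \<open>l = 0\<close>, and 8 is not a square. For \<open>q = 7\<close> there is the solution
  \<open>M = l = 1\<close>.\<close>

lemma no_element_of_norm_2:
  assumes "x \<in> K.\<O>" "x * cnj x = 2" "Factorial_Ring.prime q" "q > 8"
  shows False
proof -
  obtain a b where ab: "x = quad a b" using assms(1) by (auto simp: K.O_def elim: rat_adjoin_w_cases)
  obtain M k where mk: "2 * a = of_int M" "2 * of_nat q * b = of_int k"
    using quad_integral assms(1) ab by (metis (mono_tags, lifting) K.O_def mem_Collect_eq)
  have "(of_rat (a ^ 2 + of_nat q * b ^ 2) :: complex) = of_rat 2"
    using assms(2) unfolding ab quad_norm by simp
  then have N: "a ^ 2 + of_nat q * b ^ 2 = 2" by (simp only: of_rat_eq_iff)
  have "of_nat q * (2 * a) ^ 2 + (2 * of_nat q * b) ^ 2 = 4 * of_nat q * (a ^ 2 + of_nat q * b ^ 2)"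
    by (simp add: power2_eq_square algebra_simps)
  also have "\<dots> = 8 * of_nat q" unfolding N by simp
  finally have "rat_of_int (int q * M ^ 2 + k ^ 2) = of_int (8 * int q)"
    unfolding mk by simp
  then have eq: "int q * M ^ 2 + k ^ 2 = 8 * int q" by (simp only: of_int_eq_iff)
  then have "k ^ 2 = int q * (8 - M ^ 2)" by (simp add: algebra_simps)
  then have "int q dvd k ^ 2" by simp
  then have "int q dvd k" using assms(3) prime_dvd_power by (metis prime_int_nat_transfer prime_nat_int_transfer)
  then obtain l where l: "k = int q * l" by blast
  have "int q * (M ^ 2 + int q * l ^ 2) = int q * 8"
    using eq by (simp add: l power2_eq_square algebra_simps)
  then have eq8: "M ^ 2 + int q * l ^ 2 = 8" using assms(4) by simp
  have "l = 0"
  proof (rule ccontr)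
    assume "l \<noteq> 0"
    then have "1 \<le> l ^ 2" by (simp add: int_one_le_iff_zero_less)
    then have "int q * 1 \<le> int q * l ^ 2" by (intro mult_left_mono) auto
    moreover have "0 \<le> M ^ 2" by simp
    ultimately show False using eq8 assms(4) by linarith
  qed
  then have M: "\<bar>M\<bar> ^ 2 = 8" using eq8 by simp
  have "\<bar>M\<bar> < 3" by (rule power2_less_imp_less) (use M in auto)
  moreover have "2 < \<bar>M\<bar>" by (rule power2_less_imp_less) (use M in auto)
  ultimately show False by linarith
qed

end

section \<open>Ideals of the quadratic field inside the cyclotomic field\<close>

locale cyclotomic7_quadratic = cyclotomic7_finite q g z + imaginary_quadratic q w for q g z w +
  assumes class_number_K: "class_number (rat_adjoin w) > 0"
begin

sublocale K: finite_class_number "rat_adjoin w"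
  by unfold_locales (rule class_number_K)

text \<open>Which sign occurs is the classical question about the sign of the Gauss sum. It stays
  open here, as both signs generate the same field.\<close>

lemma tau_w: "tau = w \<or> tau = - w"
  using tau_sq w_sq power2_eq_iff by metis

lemma w_in_L: "w \<in> L"
  using tau_w tau_in_L uminus_closed[OF tau_in_L] by (metis minus_minus)

lemma K_subset_L: "x \<in> rat_adjoin w \<Longrightarrow> x \<in> L"
  using w_in_L by (auto simp: quad_def elim!: rat_adjoin_w_cases intro!: add_closed mult_closed of_rat_closed)

lemma K_O_subset: "K.\<O> \<subseteq> \<O>" using K_subset_L by (auto simp: K.O_def O_def)

lemma K_O_iff: "x \<in> K.\<O> \<longleftrightarrow> x \<in> \<O> \<and> x \<in> rat_adjoin w"
  using K_O_subset by (auto simp: K.O_def O_def)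

lemma gal_K:
  assumes "x \<in> rat_adjoin w"
  shows "gal (2 * i) x = x"
proof -
  have "gal (2 * i) w = w"
    using gal_tau(1)[of i] tau_w gal_diff[OF zero_closed w_in_L, of "2 * i"] by auto
  then show ?thesis using assms w_in_L
    by (auto simp: quad_def gal_add gal_mult gal_of_rat mult_closed of_rat_closed elim!: rat_adjoin_w_cases)
qed

lemma fixed_in_K:
  assumes "x \<in> L" "gal 2 x = x" shows "x \<in> rat_adjoin w"
proof -
  obtain a b where "x = of_rat a + of_rat b * tau" using gal_fixed[OF assms] .
  then have "x = quad a b \<or> x = quad a (- b)" using tau_w by (auto simp: quad_def of_rat_minus)
  then show ?thesis by (auto simp: rat_adjoin_w)
qed

lemma omega_in_O: "omega \<in> K.\<O>"
proof -
  have "omega = - eta 0 \<or> omega = - eta 1"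
    using tau_w unfolding eta_tau omega_def by (auto simp: field_simps)
  then have "algebraic_int omega" using eta_in_O by (auto simp: O_def)
  then show ?thesis using omega_in_K by (simp add: K.O_def)
qed

lemma omega_norm: "omega * cnj omega = 2 * of_int (int ((q + 1) div 8))"
proof -
  have "q + 1 = 8 * ((q + 1) div 8)" using q_mod_8 by presburger
  then have "(of_nat (q + 1) :: complex) = 8 * of_nat ((q + 1) div 8)"
    by (metis of_nat_mult of_nat_numeral)
  then show ?thesis unfolding omega_cnj by simp
qed

text \<open>The ideal \<open>\<pp>\<close> of the quadratic field; \<open>PL\<close> is its
  extension to \<open>L\<close>. Both are given by the same two generators, so that automorphisms
  fixing \<open>omega\<close> can be applied to their elements term by term.\<close>

definition PK where "PK = {2 * x + omega * y | x y. x \<in> K.\<O> \<and> y \<in> K.\<O>}"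

definition PL where "PL = {2 * x + omega * y | x y. x \<in> \<O> \<and> y \<in> \<O>}"

lemma two_in_O: "2 \<in> \<O>" "2 \<in> K.\<O>" using O_closed(3)[of 2] K.O_closed(3)[of 2] by simp_all

lemma omega_in_O_L: "omega \<in> \<O>" using omega_in_O K_O_subset by blast

lemma PL: "PL \<subseteq> \<O>" "osub PL" "2 \<in> PL"
proof -
  show "PL \<subseteq> \<O>" using two_in_O omega_in_O_L by (auto simp: PL_def intro!: O_closed)
  show "2 \<in> PL" unfolding PL_def using O_closed by (intro CollectI exI[of _ 1] exI[of _ 0]) auto
  show "osub PL"
    unfolding osub_def
  proof (intro conjI ballI)
    show "0 \<in> PL" unfolding PL_def using O_closed by (intro CollectI exI[of _ 0]) auto
    fix a assume "a \<in> PL"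
    then obtain x y where a: "a = 2 * x + omega * y" "x \<in> \<O>" "y \<in> \<O>" by (auto simp: PL_def)
    show "a + b \<in> PL" if "b \<in> PL" for b
    proof -
      obtain x' y' where "b = 2 * x' + omega * y'" "x' \<in> \<O>" "y' \<in> \<O>" using \<open>b \<in> PL\<close> by (auto simp: PL_def)
      then show ?thesis using a unfolding PL_def
        by (intro CollectI exI[of _ "x + x'"] exI[of _ "y + y'"]) (auto simp: algebra_simps intro: O_closed)
    qed
    show "r * a \<in> PL" if "r \<in> \<O>" for r
      using a that unfolding PL_def
      by (intro CollectI exI[of _ "r * x"] exI[of _ "r * y"]) (auto simp: algebra_simps intro: O_closed)
  qed
qed

lemma PK: "PK \<subseteq> K.\<O>" "K.osub PK" "2 \<in> PK" "omega \<in> PK"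
proof -
  show "PK \<subseteq> K.\<O>" using two_in_O omega_in_O by (auto simp: PK_def intro!: K.O_closed)
  show "2 \<in> PK" unfolding PK_def using K.O_closed by (intro CollectI exI[of _ 1] exI[of _ 0]) auto
  show "omega \<in> PK" unfolding PK_def using K.O_closed by (intro CollectI exI[of _ 0] exI[of _ 1]) auto
  show "K.osub PK"
    unfolding K.osub_def
  proof (intro conjI ballI)
    show "0 \<in> PK" unfolding PK_def using K.O_closed by (intro CollectI exI[of _ 0]) auto
    fix a assume "a \<in> PK"
    then obtain x y where a: "a = 2 * x + omega * y" "x \<in> K.\<O>" "y \<in> K.\<O>" by (auto simp: PK_def)
    show "a + b \<in> PK" if "b \<in> PK" for b
    proof -
      obtain x' y' where "b = 2 * x' + omega * y'" "x' \<in> K.\<O>" "y' \<in> K.\<O>" using \<open>b \<in> PK\<close> by (auto simp: PK_def)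
      then show ?thesis using a unfolding PK_def
        by (intro CollectI exI[of _ "x + x'"] exI[of _ "y + y'"]) (auto simp: algebra_simps intro: K.O_closed)
    qed
    show "r * a \<in> PK" if "r \<in> K.\<O>" for r
      using a that unfolding PK_def
      by (intro CollectI exI[of _ "r * x"] exI[of _ "r * y"]) (auto simp: algebra_simps intro: K.O_closed)
  qed
qed

lemma PK_fractional: "K.fractional PK"
  using K.fractional_ideal[OF PK(1,2,3)] by simp

lemma K_O_iprod_O: "K.\<O> ** \<O> = \<O>"
proof
  show "K.\<O> ** \<O> \<subseteq> \<O>" using K_O_subset by (intro iprod_subset) (auto intro: O_closed)
  show "\<O> \<subseteq> K.\<O> ** \<O>" using iprodI[OF K.O_closed(2), of _ \<O>] by fastforce
qed

text \<open>Extending an ideal to \<open>L\<close> adds no elements of the quadratic field.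
  Multiplying by the inverse \<open>J\<close> reduces this to the case of the unit ideal, where it
  says that an integer of \<open>L\<close> lying in the subfield is an integer of the subfield;
  multiplying back by \<open>I\<close> gives the claim.\<close>

lemma descend:
  assumes I: "K.fractional I" and b: "b \<in> rat_adjoin w" "b \<in> I ** \<O>"
  shows "b \<in> I"
proof -
  obtain J where J: "K.fractional J" "I ** J = K.\<O>" "J ** I = K.\<O>" using K.inverse_ideal[OF I] .
  have *: "b * j \<in> K.\<O>" if "j \<in> J" for j
  proof -
    have "b * j \<in> (I ** \<O>) ** J" using b that by (intro iprodI)
    also have "(I ** \<O>) ** J = (I ** J) ** \<O>" by (metis iprod_assoc iprod_comm)
    also have "\<dots> = \<O>" by (simp add: J K_O_iprod_O)
    finally have "b * j \<in> \<O>" .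
    moreover have "b * j \<in> rat_adjoin w"
      using b K.fractional_subset[OF J(1)] that by (intro K.mult_closed) auto
    ultimately show ?thesis by (simp add: K_O_iff)
  qed
  have "b * x \<in> I" if "x \<in> J ** I" for x
    using that
  proof (induction rule: iprod_induct)
    case (prod j i)
    then show ?case using K.osubD(3)[OF K.fractional_osub[OF I] *, of j i] by (simp add: mult.assoc)
  next
    case (sum x y)
    then show ?case using K.osubD(2)[OF K.fractional_osub[OF I]] by (simp add: distrib_left)
  qed
  from this[of 1] show ?thesis using J K.O_closed(2) by simp
qed

text \<open>If the extension \<open>PL\<close> of \<open>PK\<close> is generated by \<open>\<delta>\<close>, then the norm of \<open>\<delta>\<close> to the quadratic
  field generates \<open>PK ^ h\<close>.\<close>

lemma PK_power_principal:
  assumes "PL \<in> Pr"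
  shows "PK [^]\<^bsub>K.F\<^esub> h \<in> K.Pr"
proof -
  obtain \<delta> where d: "\<delta> \<in> L" "\<delta> \<noteq> 0" "PL = (*) \<delta> ` \<O>" using assms by (auto simp: Pr_iff)
  have dPL: "\<delta> \<in> PL" unfolding d(3) using O_closed(2) by (intro image_eqI[of _ _ 1]) auto
  \<comment> \<open>Partial norms. Both comparisons with the powers of \<open>PK\<close> are
    inductions on the number \<open>n\<close> of conjugates of \<open>\<delta>\<close>; only the
    full product \<open>\<beta> h\<close> lies in the quadratic field.\<close>
  define \<beta> where "\<beta> n = (\<Prod>i<n. gal (2 * i) \<delta>)" for n
  have powS: "PK [^]\<^bsub>K.F\<^esub> Suc n = PK [^]\<^bsub>K.F\<^esub> n ** PK" "PK [^]\<^bsub>K.F\<^esub> (0::nat) = K.\<O>" for n by simp_all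
  have pow: "K.fractional (PK [^]\<^bsub>K.F\<^esub> (n::nat))" for n
    using K.FG.nat_pow_closed[of PK n] PK_fractional by simp
  have sub: "\<exists>y\<in>\<O>. x = \<beta> n * y" if "x \<in> PK [^]\<^bsub>K.F\<^esub> n" for x n
    using that
  proof (induction n arbitrary: x)
    case 0
    then show ?case using K_O_subset by (auto simp: \<beta>_def)
  next
    case (Suc n)
    from Suc.prems[unfolded powS] show ?case
    proof (induction rule: iprod_induct)
      case (prod i j)
      obtain y where y: "y \<in> \<O>" "i = \<beta> n * y" using Suc.IH prod by blast
      have "j \<in> PL" using prod K_O_subset by (auto simp: PK_def PL_def)
      then obtain v where v: "v \<in> \<O>" "j = \<delta> * v" using d by auto
      have "j \<in> rat_adjoin w" using prod PK(1) by (auto simp: K.O_def)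
      \<comment> \<open>An element of \<open>PK\<close> is fixed by the automorphism, so being a
        multiple of \<open>\<delta>\<close> it is also a multiple of the conjugate that enters
        \<open>\<beta>\<close> next.\<close>
      then have "j = gal (2 * n) (\<delta> * v)" using gal_K[of j n] v by simp
      also have "\<dots> = gal (2 * n) \<delta> * gal (2 * n) v" using d v O_subset by (intro gal_mult) auto
      finally have "i * j = \<beta> (Suc n) * (y * gal (2 * n) v)" by (simp add: y \<beta>_def)
      then show ?case by (rule bexI) (intro O_closed(7) gal_O y v)
    next
      case (sum x y)
      then obtain a b where "a \<in> \<O>" "b \<in> \<O>" "x = \<beta> (Suc n) * a" "y = \<beta> (Suc n) * b" by blast
      then show ?case by (intro bexI[of _ "a + b"]) (auto simp: distrib_left intro: O_closed)
    qed
  qed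
  have sup: "\<beta> n \<in> (PK [^]\<^bsub>K.F\<^esub> n) ** \<O>" for n
  proof (induction n)
    case 0
    then show ?case using O_closed(2) by (simp add: \<beta>_def K_O_iprod_O)
  next
    case (Suc n)
    \<comment> \<open>Both generators 2 and \<open>omega\<close> are fixed, so the conjugates of
      \<open>\<delta>\<close> stay in the extension of \<open>PK\<close>.\<close>
    obtain x y where xy: "\<delta> = 2 * x + omega * y" "x \<in> \<O>" "y \<in> \<O>" using dPL by (auto simp: PL_def)
    have L: "2 \<in> L" "omega \<in> L" "x \<in> L" "y \<in> L" using two_in_O omega_in_O_L xy O_subset by auto
    have "gal (2 * n) \<delta> = gal (2 * n) 2 * gal (2 * n) x + gal (2 * n) omega * gal (2 * n) y"
      using L by (simp add: xy gal_add gal_mult mult_closed)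
    also have "gal (2 * n) 2 = 2" using gal_simps(4)[of "2 * n" 2] by simp
    also have "gal (2 * n) omega = omega" using gal_K omega_in_K by blast
    finally have "gal (2 * n) \<delta> \<in> PK ** \<O>" using PK gal_O xy by (auto intro!: iprod_add iprodI)
    with Suc have "\<beta> n * gal (2 * n) \<delta> \<in> ((PK [^]\<^bsub>K.F\<^esub> n) ** \<O>) ** (PK ** \<O>)" by (rule iprodI)
    also have "\<dots> = ((PK [^]\<^bsub>K.F\<^esub> n) ** PK) ** (\<O> ** \<O>)" by (metis iprod_assoc iprod_comm)
    also have "\<O> ** \<O> = \<O>" using O_iprod osub_O .
    finally show ?case by (simp add: \<beta>_def)
  qed
  have \<beta>L: "\<beta> h \<in> L" unfolding \<beta>_def using d by (intro L_prod gal_closed)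
  \<comment> \<open>The automorphism shifts the \<open>h\<close> factors by one place; the last one
    becomes the first since \<open>2 * h = q - 1\<close> is a period.\<close>
  have "gal 2 (\<beta> h) = (\<Prod>i<h. gal (2 * Suc i) \<delta>)"
    unfolding \<beta>_def using d by (simp add: gal_prod gal_closed gal_gal)
  also have "gal (2 * h) \<delta> = gal (2 * 0) \<delta>" using gal_periodic[OF d(1), of 0] by (simp add: q_minus_Suc_0)
  then have "(\<Prod>i<h. gal (2 * Suc i) \<delta>) = \<beta> h"
  proof -
    assume eq: "gal (2 * h) \<delta> = gal (2 * 0) \<delta>"
    have "gal (2 * 0) \<delta> * (\<Prod>i<h. gal (2 * Suc i) \<delta>) = (\<Prod>i<Suc h. gal (2 * i) \<delta>)"
      by (rule prod.lessThan_Suc_shift[symmetric])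
    also have "\<dots> = \<beta> h * gal (2 * h) \<delta>" unfolding \<beta>_def by (rule prod.lessThan_Suc)
    also have "\<dots> = gal (2 * 0) \<delta> * \<beta> h" unfolding eq by (rule mult.commute)
    finally show ?thesis using gal_nonzero[OF d(1,2)] by simp
  qed
  finally have \<beta>K: "\<beta> h \<in> rat_adjoin w" by (intro fixed_in_K \<beta>L)
  have \<beta>0: "\<beta> h \<noteq> 0" unfolding \<beta>_def using gal_nonzero[OF d(1,2)] by simp
  have "PK [^]\<^bsub>K.F\<^esub> h = (*) (\<beta> h) ` K.\<O>"
  proof
    show "PK [^]\<^bsub>K.F\<^esub> h \<subseteq> (*) (\<beta> h) ` K.\<O>"
    proof
      fix x assume x: "x \<in> PK [^]\<^bsub>K.F\<^esub> h"
      then obtain y where y: "y \<in> \<O>" "x = \<beta> h * y" using sub by blast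
      have "x \<in> rat_adjoin w" using x K.fractional_subset[OF pow] by blast
      then have "y \<in> rat_adjoin w" using K.divide_closed[OF _ \<beta>K, of x] y \<beta>0 by simp
      then show "x \<in> (*) (\<beta> h) ` K.\<O>" unfolding y(2) using y(1) by (intro imageI) (simp add: K_O_iff)
    qed
    show "(*) (\<beta> h) ` K.\<O> \<subseteq> PK [^]\<^bsub>K.F\<^esub> h"
      using descend[OF pow \<beta>K sup] K.osubD(4)[OF K.fractional_osub[OF pow]] by auto
  qed
  then show ?thesis using \<beta>K \<beta>0 by (auto simp: K.Pr_iff)
qed

text \<open>A generator \<open>c\<close> would have norm exactly 2. The norm of every element of
  \<open>PK\<close> is twice an integer \<open>t\<close>, because that of \<open>omega\<close> is
  even; conversely 2 is a multiple of \<open>c * cnj c\<close>. So \<open>t\<close> is a unit of the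
  integers, and it is 1 by positivity.\<close>

lemma PK_not_principal:
  assumes "q \<noteq> 7"
  shows "PK \<notin> K.Pr"
proof
  assume "PK \<in> K.Pr"
  then obtain c where c: "c \<in> rat_adjoin w" "c \<noteq> 0" "PK = (*) c ` K.\<O>" by (auto simp: K.Pr_iff)
  obtain u v where uv: "u \<in> K.\<O>" "2 = c * u" "v \<in> K.\<O>" "omega = c * v" using PK(3,4) c(3) by auto
  have "c \<in> PK" unfolding c(3) using K.O_closed(2) by (intro image_eqI[of _ _ 1]) auto
  then obtain x y where xy: "c = 2 * x + omega * y" "x \<in> K.\<O>" "y \<in> K.\<O>" by (auto simp: PK_def)
  define t where "t = 2 * (x * cnj x) + x * cnj omega * cnj y + omega * y * cnj x
      + of_int (int ((q + 1) div 8)) * (y * cnj y)"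
  have t: "t \<in> K.\<O>" unfolding t_def
    by (intro K.O_closed cnj_in_K_O xy omega_in_O two_in_O)
  have "c * cnj c = 2 * (2 * (x * cnj x) + x * cnj omega * cnj y + omega * y * cnj x)
      + (omega * cnj omega) * (y * cnj y)"
    by (simp add: xy algebra_simps)
  also have "\<dots> = 2 * t" unfolding omega_norm t_def by (simp add: algebra_simps)
  finally have N: "c * cnj c = 2 * t" .
  \<comment> \<open>Chosen so that \<open>c * cnj c * s = 2 * cnj omega + omega * 2\<close>, which
    is 2 because \<open>omega\<close> has trace 1.\<close>
  define s where "s = u * cnj v + v * cnj u"
  have s: "s \<in> K.\<O>" unfolding s_def by (intro K.O_closed cnj_in_K_O uv)
  have cu: "cnj c * cnj u = 2" using arg_cong[OF uv(2), of cnj] by simp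
  have cv: "cnj c * cnj v = cnj omega" using arg_cong[OF uv(4), of cnj] by simp
  have "c * cnj c * s = (c * u) * (cnj c * cnj v) + (c * v) * (cnj c * cnj u)"
    by (simp add: s_def algebra_simps)
  also have "\<dots> = 2 * (omega + cnj omega)"
    unfolding cu cv uv(2)[symmetric] uv(4)[symmetric] by (simp add: algebra_simps)
  finally have "2 * (t * s) = 2" unfolding N omega_cnj by simp
  then have ts: "t * s = 1" by simp
  obtain a b where ab: "c = quad a b" using c(1) by (elim rat_adjoin_w_cases)
  define r where "r = (a ^ 2 + of_nat q * b ^ 2) / 2"
  have tr: "t = of_rat r" using N unfolding ab quad_norm r_def by (simp add: of_rat_divide)
  have "t \<in> \<int>" using t by (intro rational_algebraic_int_is_int) (auto simp: K.O_def tr)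
  then obtain n where n: "t = of_int n" by (elim Ints_cases)
  have "t \<noteq> 0" using ts by auto
  then have "s = 1 / t" using ts by (simp add: field_simps)
  then have "s \<in> \<rat>" by (simp add: tr)
  then have "s \<in> \<int>" using s by (intro rational_algebraic_int_is_int) (auto simp: K.O_def)
  then obtain n' where n': "s = of_int n'" by (elim Ints_cases)
  have "(of_int (n * n') :: complex) = of_int 1" using ts n n' by simp
  then have "n * n' = 1" by (simp only: of_int_eq_iff)
  moreover have "n \<ge> 0"
  proof -
    have "(of_rat r :: complex) = of_rat (of_int n)" using tr n by simp
    then have "r = of_int n" by (simp only: of_rat_eq_iff)
    moreover have "r \<ge> 0" by (simp add: r_def)
    ultimately show ?thesis by simp
  qed
  ultimately have "n = 1" using pos_zmult_eq_1_iff_lemma by fastforce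
  then have "c * cnj c = 2" using N n by simp
  moreover have "c \<in> K.\<O>" using \<open>c \<in> PK\<close> PK(1) by blast
  moreover have "q > 8" using q_mod_8 assms by presburger
  ultimately show False using no_element_of_norm_2 prime_q by blast
qed

lemma exists_nonprincipal_above_2:
  assumes "q \<noteq> 7" "coprime h (class_number (rat_adjoin w))"
  shows "\<exists>P. maximalideal P (ring_of_integers L) \<and> 2 \<in> P \<and> P \<notin> Pr"
proof (rule ccontr)
  assume "\<not> ?thesis"
  then have "PL \<in> Pr" using principal_above_2[OF _ PL] by blast
  then have "PK [^]\<^bsub>K.F\<^esub> h \<in> K.Pr" by (rule PK_power_principal)
  then have "PK \<in> K.Pr" using K.principal_if_coprime_power_principal PK_fractional assms(2) by blast
  then show False using PK_not_principal assms(1) by blast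
qed

end

theorem theorem1p3:
  fixes q :: nat and \<zeta> :: complex
  assumes "Factorial_Ring.prime q" and "odd q" and "q mod 8 = 7" and "q \<noteq> 7"
    and "primitive_root_of_unity q \<zeta>"
    and "Factorial_Ring.prime (class_number (rat_adjoin \<zeta>))"
    and "coprime ((q - 1) div 2) (class_number (rat_adjoin (csqrt (- of_nat q))))"
  shows "generating_residue_degrees (rat_adjoin \<zeta>) \<rat> \<noteq> {1} \<and>
         (\<exists>f \<in> generating_residue_degrees (rat_adjoin \<zeta>) \<rat>. f dvd (q - 1) div 2 \<and> f \<noteq> 1)"
proof -
  have q: "q > 8" using assms(3,4) by presburger
  obtain g where g: "residue_primroot q g"
    using prime_primitive_root_exists[of q] assms(1) prime_gt_1_nat by blast
  have "class_number (rat_adjoin (csqrt (- of_nat q))) > 0"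
  proof (rule gr0I)
    assume "class_number (rat_adjoin (csqrt (- of_nat q))) = 0"
    then have "(q - 1) div 2 = 1" using assms(7) by simp
    then show False using q by simp
  qed
  moreover have "cyclotomic q g \<zeta>" by unfold_locales (use assms g q in auto)
  \<comment> \<open>The finiteness assumption of the locale is phrased with its own name for the
    field; this equation connects it with the class number in the hypothesis.\<close>
  then have L: "cyclotomic.L \<zeta> = rat_adjoin \<zeta>" by (rule cyclotomic.L_def)
  ultimately interpret cyclotomic7_quadratic q g \<zeta> "csqrt (- of_nat q)"
    by unfold_locales (use assms g q prime_gt_0_nat in auto)
  have h: "h = (q - 1) div 2" by (rule h_def)
  obtain P where P: "maximalideal P (ring_of_integers L)" "2 \<in> P" "P \<notin> Pr"
    using exists_nonprincipal_above_2 assms(4,7) h by auto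
  have PO: "P \<subseteq> \<O>" "osub P" using P by (auto simp: maximalideal_iff)
  have fP: "fractional P" using PO P(2) fractional_ideal[of P 2] by simp
  let ?S = "{ideal_class L P | P. nonzero_prime_ideal L P \<and> unramified L \<rat> P \<and> residue_degree L \<rat> P = m}"
  have "primeideal P (ring_of_integers L)" using cring.maximalideal_prime[OF cring_O P(1)] .
  then have "nonzero_prime_ideal L P" using P(2) by (auto simp: nonzero_prime_ideal_def)
  then have PS: "ideal_class L P \<in> ?S"
    using unramified_above_2[OF P(1,2)] residue_degree_above_2[OF P(1,2)] by blast
  have "?S \<subseteq> carrier (class_group L)"
  proof clarify
    fix I assume "nonzero_prime_ideal L I"
    then have I: "I \<subseteq> \<O>" "osub I" "I \<noteq> {0}"
      by (auto simp: nonzero_prime_ideal_def primeideal_def ideal_iff)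
    then obtain x where "x \<in> I" "x \<noteq> 0" using osubD(1)[OF I(2)] by blast
    then show "ideal_class L I \<in> carrier (class_group L)"
      using I by (intro ideal_class_carrier fractional_ideal)
  qed
  then have "generate (class_group L) ?S = carrier (class_group L)"
    using generate_class_group[OF _ fP P(3) PS] assms(6) by (simp add: L_def)
  then have "m \<in> generating_residue_degrees L \<rat>"
    using m_pos by (simp add: generating_residue_degrees_def)
  then show ?thesis using m_neq_1 m_dvd_h h L_def by auto
qed

end
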